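(* Let $A$ be an $n\times n$ matrix drawn from the GOE with Laplacian matrix $\mathcal{L}_A$, and fix an integer $k\ge1$. Let $$a_n := \sqrt{2\log n},\qquad b_n := \sqrt{2\log n}-\frac{\log\log n+\log(4\pi)-2}{2\sqrt{2\log n}}.$$ Then, for any fixed $x_1,\dots,x_k\in\mathbb{R}$, $$\lim_{n\to\infty}\mathbb{P}\left(a_n(\lambda_1(\mathcal{L}_A)-b_n)\le x_1,\dots,a_n(\lambda_k(\mathcal{L}_A)-b_n)\le x_k\right)=F_k(x_1,\dots,x_k),$$ where $F_k$ is the limiting joint cumulative distribution function of the $k$ largest (rescaled) order statistics of $n$ iid standard Gaussian random variables, as defined in the context.
   Context: An $n\times n$ real symmetric random matrix $A$ is drawn from the Gaussian Orthogonal Ensemble (GOE) if its entries $A_{ij}$, $1\le i\le j\le n$, are independent Gaussian random variables, $A_{ij}$ having mean zero and variance $\frac{1+\delta_{ij}}{n}$ ($\delta_{ij}$ the Kronecker delta). For a real symmetric $n\times n$ matrix $A$, its Laplacian matrix is $\mathcal{L}_A := D_A-A$, where $D_A$ is the diagonal matrix with $(D_A)_{ii}=\sum_{j=1}^n A_{ij}$. For an $n\times n$ real symmetric matrix $M$, $\lambda_n(M)\le\cdots\le\lambda_1(M)$ denote its ordered eigenvalues. Definition of $F_k$: let $\xi_1,\dots,\xi_n$ be iid standard Gaussian random variables with order statistics $\xi^{(n)}_1>\xi^{(n)}_2>\cdots>\xi^{(n)}_n$, and let $b_n' := \sqrt{2\log n}-\frac{\log\log n+\log(4\pi)}{2\sqrt{2\log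 n}}$. Then $F_k:\mathbb{R}^k\to[0,1]$ is the (non-trivial) joint cumulative distribution function given by $$F_k(x_1,\dots,x_k)=\lim_{n\to\infty}\mathbb{P}\left(a_n(\xi^{(n)}_1-b_n')\le x_1,\dots,a_n(\xi^{(n)}_k-b_n')\le x_k\right);$$ the existence of this limit for all fixed $x_1,\dots,x_k\in\mathbb{R}$ is a classical fact of extreme value theory. In particular $F_1(x)=\exp(-e^{-x})$. *)

theory Defs
  imports "HOL-Probability.Probability" "Jordan_Normal_Form.Char_Poly"
begin

(* Matrix indices start at 0, so the independent entries are those with i <= j < n.
   In the library, normal_density takes the standard deviation, not the variance. *)
definition GOE :: "nat \<Rightarrow> 'a measure \<Rightarrow> ('a \<Rightarrow> real mat) \<Rightarrow> bool" where
  "GOE n M A \<longleftrightarrow>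
     prob_space M \<and>
     (\<forall>\<omega>\<in>space M. A \<omega> \<in> carrier_mat n n \<and> transpose_mat (A \<omega>) = A \<omega>) \<and>
     prob_space.indep_vars M (\<lambda>_. borel) (\<lambda>(i, j) \<omega>. A \<omega> $$ (i, j))
       {(i, j). i \<le> j \<and> j < n} \<and>
     (\<forall>i j. i \<le> j \<longrightarrow> j < n \<longrightarrow>
        distributed M lborel (\<lambda>\<omega>. A \<omega> $$ (i, j))
          (normal_density 0 (sqrt ((1 + (if i = j then 1 else 0)) / real n))))"

definition laplacian :: "real mat \<Rightarrow> real mat" where
  "laplacian A = mat_diag (dim_row A) (\<lambda>i. \<Sum>j<dim_row A. A $$ (i, j)) - A"

(* Repetitions are counted and k = 1 gives the maximum; unspecified unless 1 <= k <= size X. *)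
definition kth_largest :: "nat \<Rightarrow> real multiset \<Rightarrow> real" where
  "kth_largest k X = rev (sorted_list_of_multiset X) ! (k - 1)"

(* lambda_k(A). For a real symmetric matrix all roots of the characteristic polynomial are
   real, so the multiset of its real roots consists of all eigenvalues with multiplicity. *)
definition ordered_eigenvalue :: "nat \<Rightarrow> real mat \<Rightarrow> real" where
  "ordered_eigenvalue k A = kth_largest k (proots (char_poly A))"

definition order_statistic :: "nat \<Rightarrow> nat \<Rightarrow> (nat \<Rightarrow> real) \<Rightarrow> real" where
  "order_statistic n k \<xi> = kth_largest k (image_mset \<xi> (mset_set {..<n}))"

definition iid_std_gaussian :: "nat \<Rightarrow> (nat \<Rightarrow> real) measure" where
  "iid_std_gaussian n = (\<Pi>\<^sub>M i\<in>{..<n}. density lborel std_normal_density)"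

definition a_seq :: "nat \<Rightarrow> real" where
  "a_seq n = sqrt (2 * ln (real n))"

definition b_seq :: "nat \<Rightarrow> real" where
  "b_seq n = sqrt (2 * ln (real n))
     - (ln (ln (real n)) + ln (4 * pi) - 2) / (2 * sqrt (2 * ln (real n)))"

definition b'_seq :: "nat \<Rightarrow> real" where
  "b'_seq n = sqrt (2 * ln (real n))
     - (ln (ln (real n)) + ln (4 * pi)) / (2 * sqrt (2 * ln (real n)))"

(* F_k(x_1, ..., x_k); only x 1, ..., x k matter. The limit exists by classical extreme value
   theory. *)
definition F_cdf :: "nat \<Rightarrow> (nat \<Rightarrow> real) \<Rightarrow> real" where
  "F_cdf k x = lim (\<lambda>n. measure (iid_std_gaussian n)
     {\<xi> \<in> space (iid_std_gaussian n).
        \<forall>i\<in>{1..k}. a_seq n * (order_statistic n i \<xi> - b'_seq n) \<le> x i})"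

end

theory Submission
  imports Defs "HOL-Real_Asymp.Real_Asymp"
begin

text \<open>Write \<open>L = diag(d) - G\<close> with \<open>G\<close> the off-diagonal part of \<open>A\<close>, and \<open>a = a_seq n\<close>. An entry \<open>d\<^sub>i\<close>
  of size about \<open>a\<close> produces an eigenvalue \<open>d\<^sub>i + \<Sum>\<^sub>j G\<^sub>i\<^sub>j\<^sup>2 / (a - d\<^sub>j) + o(1/a) = d\<^sub>i + 1/a + o(1/a)\<close>, because
  the rows of \<open>G\<close> are nearly orthonormal, \<open>G\<close> has bounded norm and most \<open>d\<^sub>j\<close> are \<open>o(a)\<close>; the shift \<open>1/a\<close> is
  exactly \<open>b_seq n - b'_seq n\<close>. The upper bound completes the square between the coordinates with
  \<open>d\<^sub>i > 9a/10\<close> and the others; the lower bound uses the test vectors \<open>e\<^sub>i - G e\<^sub>i / a\<close>. The few coordinates where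
  \<open>d\<^sub>j\<close> is not \<open>o(a)\<close> are harmless since principal submatrices of \<open>G\<close> on a small proportion of the coordinates have
  small norm, by a union bound over lattice vectors.

  The entries \<open>d\<^sub>i\<close> are correlated, but any fixed number of them become independent after discarding the
  finitely many common entries of \<open>A\<close>. So the joint factorial moments of their exceedance counts agree in the limit with those
  of independent Gaussians, and the factorial moments determine the limit law in both cases.\<close>

unbundle no inner_syntax and no vec_syntax

section \<open>Spectral theorem and eigenvalue counting\<close>

text \<open>The top degrees fluctuate on the scale 1/a, the same as the shift, so every error has to
  be at most \<epsilon>/a. A crude norm bound 20 for G is enough where it competes with a.
  Coordinates with d_j between sqrt a and 9a/10 are the obstacle: their gap to the level may be only
  a/20, so they cost 20 \<tau>^2/a, with \<tau> the norm of G on them. This set depends on the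
  matrix, hence \<tau> must be small for all sparse supports at once; \<tau> is fixed in terms of
  \<epsilon>, and the sparsity \<eta> in terms of \<tau>. What is needed of the random matrix is
  collected in \<open>typical\<close>; the comparison of eigenvalues with degrees is then
  deterministic, for all typical matrices of large size. Indices are labelled by the set of levels
  they exceed, which treats the k thresholds jointly and in any order. Both models converge to the
  same explicit series \<open>order_limit\<close>, so the limit in \<open>F_cdf\<close> is obtained
  rather than assumed; a continuity estimate for it in x finally removes \<epsilon>.\<close>

lemma real_symmetric_eigenvector:
  fixes A :: "real mat"
  assumes A: "A \<in> carrier_mat n n" and sym: "transpose_mat A = A" and n: "n > 0"
  obtains e v where "v \<in> carrier_vec n" "scalar_prod v v = 1" "A *\<^sub>v v = e \<cdot>\<^sub>v v"
proof -
  define B where "B = map_mat complex_of_real A"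
  have B: "B \<in> carrier_mat n n" using A by (simp add: B_def)
  have deg: "degree (char_poly B) = n" using degree_monic_char_poly[OF B] by auto
  have "\<not> constant (poly (char_poly B))" using n deg constant_degree[of "char_poly B"] by simp
  then obtain l where "poly (char_poly B) l = 0" using fundamental_theorem_of_algebra by blast
  then have "eigenvalue B l" using eigenvalue_root_char_poly[OF B] by simp
  then obtain z where z: "z \<in> carrier_vec n" "z \<noteq> 0\<^sub>v n" "B *\<^sub>v z = l \<cdot>\<^sub>v z"
    using B by (auto simp: eigenvalue_def eigenvector_def)
  define x y where "x = map_vec Re z" and "y = map_vec Im z"
  define a b where "a = Re l" and "b = Im l"
  have xy: "x \<in> carrier_vec n" "y \<in> carrier_vec n" using z by (auto simp: x_def y_def)
  have eq: "(\<Sum>j<n. of_real (A $$ (i,j)) * z $ j) = l * z $ i" if "i < n" for i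
  proof -
    have "(B *\<^sub>v z) $ i = (l \<cdot>\<^sub>v z) $ i" using z by simp
    then show ?thesis using that z(1) A B
      by (simp add: scalar_prod_def B_def atLeast0LessThan)
  qed
  have ex: "(\<Sum>j<n. A $$ (i,j) * x $ j) = a * x $ i - b * y $ i"
   and ey: "(\<Sum>j<n. A $$ (i,j) * y $ j) = b * x $ i + a * y $ i" if "i < n" for i
    using arg_cong[OF eq[OF that], of Re] arg_cong[OF eq[OF that], of Im] that z(1)
    by (auto simp: x_def y_def a_def b_def algebra_simps)
  have symij: "A $$ (i,j) = A $$ (j,i)" if "i < n" "j < n" for i j
    using arg_cong[OF sym, of "\<lambda>M. M $$ (i,j)"] that A by simp
  \<comment> \<open>The bilinear form of a symmetric matrix takes the same value on (x, y) and on
    (y, x). Inserting the two eigenvalue equations leaves \<open>b\<close> times the squared norm of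
    \<open>z\<close>, so \<open>b\<close> vanishes.\<close>
  have "(\<Sum>i<n. y $ i * (\<Sum>j<n. A $$ (i,j) * x $ j)) = (\<Sum>i<n. x $ i * (\<Sum>j<n. A $$ (i,j) * y $ j))"
    unfolding sum_distrib_left by (subst sum.swap) (intro sum.cong refl, simp add: symij)
  also have "(\<Sum>i<n. x $ i * (\<Sum>j<n. A $$ (i,j) * y $ j)) = (\<Sum>i<n. x $ i * (b * x $ i + a * y $ i))"
    by (intro sum.cong) (auto simp: ey)
  also have "(\<Sum>i<n. y $ i * (\<Sum>j<n. A $$ (i,j) * x $ j)) = (\<Sum>i<n. y $ i * (a * x $ i - b * y $ i))"
    by (intro sum.cong) (auto simp: ex)
  finally have "b * (\<Sum>i<n. (x $ i)^2 + (y $ i)^2) = 0"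
    by (simp add: algebra_simps sum.distrib sum_subtractf sum_distrib_left power2_eq_square)
  moreover obtain i0 where i0: "i0 < n" "z $ i0 \<noteq> 0" using z(1,2) by (metis eq_vecI carrier_vecD index_zero_vec)
  have "(\<Sum>i<n. (x $ i)^2 + (y $ i)^2) > 0"
  proof (rule sum_pos2[of _ i0])
    show "0 < (x $ i0)\<^sup>2 + (y $ i0)\<^sup>2"
      using i0 z(1) by (auto simp: x_def y_def complex_eq_iff sum_power2_gt_zero_iff)
  qed (use i0 in auto)
  ultimately have b0: "b = 0" by auto
  \<comment> \<open>With \<open>b = 0\<close> the real and the imaginary part both satisfy the real
    eigenvalue equation, and at least one of them is nonzero.\<close>
  define u where "u = (if x \<noteq> 0\<^sub>v n then x else y)"
  have u: "u \<in> carrier_vec n" using xy by (simp add: u_def)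
  have u0: "u \<noteq> 0\<^sub>v n"
  proof (cases "x = 0\<^sub>v n")
    case True
    then have "x $ i0 = 0" using i0 by simp
    then have "y $ i0 \<noteq> 0" using i0 z(1) by (auto simp: x_def y_def complex_eq_iff)
    then show ?thesis using True i0 by (auto simp: u_def)
  qed (simp add: u_def)
  have Au: "A *\<^sub>v u = a \<cdot>\<^sub>v u"
  proof (rule eq_vecI)
    fix i assume "i < dim_vec (a \<cdot>\<^sub>v u)"
    then have i: "i < n" using u by simp
    have "(A *\<^sub>v u) $ i = (\<Sum>j<n. A $$ (i,j) * u $ j)"
      using i u A by (simp add: scalar_prod_def atLeast0LessThan)
    also have "\<dots> = a * u $ i" using ex[OF i] ey[OF i] b0 by (simp add: u_def)
    finally show "(A *\<^sub>v u) $ i = (a \<cdot>\<^sub>v u) $ i" using i u by simp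
  qed (use A u in simp)
  define s where "s = scalar_prod u u"
  have s: "s > 0" using u u0 unfolding s_def
    by (metis conjugate_square_greater_0_vec conjugate_vec_def conjugate_real_def vec_conjugate_real)
  show ?thesis
  proof (rule that[of "(1 / sqrt s) \<cdot>\<^sub>v u" a])
    show "scalar_prod ((1 / sqrt s) \<cdot>\<^sub>v u) ((1 / sqrt s) \<cdot>\<^sub>v u) = 1"
      using u s by (simp add: s_def[symmetric])
    show "A *\<^sub>v (1 / sqrt s \<cdot>\<^sub>v u) = a \<cdot>\<^sub>v (1 / sqrt s \<cdot>\<^sub>v u)"
      using mult_mat_vec[OF A u] Au by (simp add: smult_smult_assoc mult.commute)
  qed (use u in auto)
qed

text \<open>The reflection exchanging \<open>v\<close> and the first basis vector, 1 - 2 w w^T /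
  |w|^2 with w = v - e_0. It is a symmetric involution, so transpose and inverse need not be
  distinguished.\<close>

lemma householder_matrix:
  fixes v :: "real vec"
  assumes v: "v \<in> carrier_vec n" and unit: "scalar_prod v v = 1" and n: "n > 0"
  obtains W where "W \<in> carrier_mat n n" "transpose_mat W = W" "W * W = 1\<^sub>m n" "col W 0 = v"
proof -
  define w where "w = (\<lambda>i. v $ i - (if i = 0 then 1 else 0))"
  define s where "s = (\<Sum>k<n. w k ^ 2)"
  \<comment> \<open>If \<open>v\<close> already is the first basis vector then \<open>s = 0\<close>,
    hence \<open>c = 0\<close> by the convention for division, and \<open>W\<close> is the
    identity.\<close>
  define c where "c = 2 / s"
  define W where "W = mat n n (\<lambda>(i,j). (if i = j then 1 else 0) - c * w i * w j)"
  have vv: "(\<Sum>k<n. (v $ k)^2) = 1"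
    using unit v by (simp add: scalar_prod_def atLeast0LessThan power2_eq_square)
  have "s = (\<Sum>k<n. (v $ k)^2 + (if k = 0 then 1 - 2 * v $ 0 else 0))"
    unfolding s_def w_def by (intro sum.cong) (auto simp: power2_eq_square algebra_simps)
  then have s: "s = 2 - 2 * v $ 0"
    using n by (simp add: sum.distrib vv)
  have cs: "c * c * s = 2 * c" unfolding c_def by (cases "s = 0") auto
  have W: "W \<in> carrier_mat n n" by (simp add: W_def)
  show ?thesis
  proof (rule that[OF W])
    show "transpose_mat W = W" by (rule eq_matI) (auto simp: W_def)
    show "W * W = 1\<^sub>m n"
    proof (rule eq_matI)
      fix i j assume "i < dim_row (1\<^sub>m n :: real mat)" "j < dim_col (1\<^sub>m n :: real mat)"
      then have ij: "i < n" "j < n" by auto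
      have "(W * W) $$ (i,j) = (\<Sum>k<n. ((if i = k then 1 else 0) - c * w i * w k) * ((if k = j then 1 else 0) - c * w k * w j))"
        using ij by (simp add: W_def scalar_prod_def atLeast0LessThan)
      also have "\<dots> = (\<Sum>k<n. (if i = k then (if i = j then 1 else 0) - c * w i * w j else 0)
           - (if k = j then c * w i * w j else 0) + (c * c * w i * w j) * (w k ^ 2))"
        by (intro sum.cong) (auto simp: algebra_simps power2_eq_square)
      also have "\<dots> = (if i = j then 1 else 0) - c * w i * w j - c * w i * w j + (c * c * w i * w j) * s"
        using ij by (simp add: sum.distrib sum_subtractf sum_distrib_left[symmetric] s_def)
      also have "(c * c * w i * w j) * s = (c * c * s) * w i * w j" by simp
      finally show "(W * W) $$ (i,j) = 1\<^sub>m n $$ (i,j)" using ij by (simp add: cs)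
    qed (use W in auto)
    show "col W 0 = v"
    proof (rule eq_vecI)
      fix i assume "i < dim_vec v"
      then have i: "i < n" using v by simp
      have *: "(\<Sum>k<n. w k ^ 2) = 0 \<Longrightarrow> w i = 0" using i by (subst (asm) sum_nonneg_eq_0_iff) auto
      have "c * w 0 = -1" if "s \<noteq> 0"
        using that by (simp add: c_def w_def s field_simps)
      moreover have "w i = 0" if "s = 0" using * that s_def by simp
      ultimately have "c * w 0 * w i = - w i" by (cases "s = 0") auto
      then have "col W 0 $ i = (if i = 0 then 1 else 0) + w i" using i n by (simp add: W_def mult.commute mult.left_commute)
      then show "col W 0 $ i = v $ i" by (simp add: w_def)
    qed (use W v in auto)
  qed
qed

text \<open>Deflation: a Householder matrix carries a unit eigenvector to the first basis vector,
  symmetry clears the first row along with the first column, and the induction hypothesis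
  diagonalises the remaining block.\<close>

lemma real_spectral_theorem:
  fixes A :: "real mat"
  assumes "A \<in> carrier_mat n n" "transpose_mat A = A"
  shows "\<exists>U. U \<in> carrier_mat n n \<and> transpose_mat U * U = 1\<^sub>m n \<and> diagonal_mat (transpose_mat U * A * U)"
  using assms
proof (induction n arbitrary: A)
  case 0
  then show ?case by (intro exI[of _ "1\<^sub>m 0"]) (auto simp: diagonal_mat_def)
next
  case (Suc n)
  note A = Suc.prems(1) and sym = Suc.prems(2)
  obtain e v where v: "v \<in> carrier_vec (Suc n)" "scalar_prod v v = 1" "A *\<^sub>v v = e \<cdot>\<^sub>v v"
    using real_symmetric_eigenvector[OF A sym] by blast
  obtain W where W: "W \<in> carrier_mat (Suc n) (Suc n)" "transpose_mat W = W" "W * W = 1\<^sub>m (Suc n)" "col W 0 = v"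
    using householder_matrix[OF v(1,2)] by blast
  define B where "B = W * A * W"
  have B: "B \<in> carrier_mat (Suc n) (Suc n)" using W A by (simp add: B_def)
  have Bsym: "transpose_mat B = B"
    unfolding B_def using W(1) A
    by (simp add: transpose_mult[of _ "Suc n" "Suc n" _ "Suc n"] W(2) sym assoc_mult_mat[of _ "Suc n" "Suc n" _ "Suc n" _ "Suc n"])
  have v_e: "v = W *\<^sub>v unit_vec (Suc n) 0"
    by (rule eq_vecI) (use W v in auto)
  have Wv: "W *\<^sub>v v = unit_vec (Suc n) 0"
    unfolding v_e using W assoc_mult_mat_vec[OF W(1) W(1), of "unit_vec (Suc n) 0"] by simp
  have "col B 0 = W *\<^sub>v (A *\<^sub>v (W *\<^sub>v unit_vec (Suc n) 0))"
  proof -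
    have "B = W * (A * W)" unfolding B_def by (rule assoc_mult_mat[OF W(1) A W(1)])
    then have "col B 0 = W *\<^sub>v (A *\<^sub>v col W 0)"
      using col_mult2[OF W(1), of "A * W" "Suc n" 0] col_mult2[OF A W(1), of 0] A W(1) by simp
    then show ?thesis using W(4) v_e by metis
  qed
  also have "\<dots> = e \<cdot>\<^sub>v unit_vec (Suc n) 0"
    using v_e[symmetric] v Wv W(1) by (simp add: mult_mat_vec)
  finally have colB: "col B 0 = e \<cdot>\<^sub>v unit_vec (Suc n) 0" .
  have B0: "B $$ (i, 0) = (if i = 0 then e else 0)" if "i < Suc n" for i
    using arg_cong[OF colB, of "\<lambda>u. u $ i"] that B by (simp add: unit_vec_def)
  have Bs: "B $$ (i,j) = B $$ (j,i)" if "i < Suc n" "j < Suc n" for i j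
    using arg_cong[OF Bsym, of "\<lambda>M. M $$ (i,j)"] that B by simp
  define C where "C = mat n n (\<lambda>(i,j). B $$ (Suc i, Suc j))"
  have C: "C \<in> carrier_mat n n" by (simp add: C_def)
  have Csym: "transpose_mat C = C" by (rule eq_matI) (auto simp: C_def Bs)
  have Bblock: "B = four_block_mat (mat 1 1 (\<lambda>_. e)) (0\<^sub>m 1 n) (0\<^sub>m n 1) C"
  proof (rule eq_matI)
    fix i j assume ij: "i < dim_row (four_block_mat (mat 1 1 (\<lambda>_. e)) (0\<^sub>m 1 n) (0\<^sub>m n 1) C)"
     "j < dim_col (four_block_mat (mat 1 1 (\<lambda>_. e)) (0\<^sub>m 1 n) (0\<^sub>m n 1) C)"
    then have ij: "i < Suc n" "j < Suc n" using C by auto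
    then show "B $$ (i,j) = four_block_mat (mat 1 1 (\<lambda>_. e)) (0\<^sub>m 1 n) (0\<^sub>m n 1) C $$ (i,j)"
      using C B0[of i] B0[of j] Bs[of i j]
      by (cases i; cases j) (auto simp: C_def)
  qed (use B C in auto)
  obtain V where V: "V \<in> carrier_mat n n" "transpose_mat V * V = 1\<^sub>m n" "diagonal_mat (transpose_mat V * C * V)"
    using Suc.IH[OF C Csym] by blast
  define V' where "V' = four_block_mat (1\<^sub>m 1) (0\<^sub>m 1 n) (0\<^sub>m n 1) V"
  have V': "V' \<in> carrier_mat (Suc n) (Suc n)" by (intro carrier_matI) (use V in \<open>auto simp: V'_def\<close>)
  have tV': "transpose_mat V' = four_block_mat (1\<^sub>m 1) (0\<^sub>m 1 n) (0\<^sub>m n 1) (transpose_mat V)"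
    unfolding V'_def using V by (simp add: transpose_four_block_mat[of _ 1 1 _ n _ n])
  have one: "transpose_mat V' * V' = 1\<^sub>m (Suc n)"
    unfolding tV' unfolding V'_def using V
    by (subst mult_four_block_mat[of _ 1 1 _ n _ n _ _ 1 _ n]) auto
  have diag: "transpose_mat V' * B * V' = four_block_mat (mat 1 1 (\<lambda>_. e)) (0\<^sub>m 1 n) (0\<^sub>m n 1) (transpose_mat V * C * V)"
  proof -
    have "four_block_mat (1\<^sub>m 1) (0\<^sub>m 1 n) (0\<^sub>m n 1) (transpose_mat V) * four_block_mat (mat 1 1 (\<lambda>_. e)) (0\<^sub>m 1 n) (0\<^sub>m n 1) C
        = four_block_mat (mat 1 1 (\<lambda>_. e)) (0\<^sub>m 1 n) (0\<^sub>m n 1) (transpose_mat V * C)"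
      using V C by (subst mult_four_block_mat[of _ 1 1 _ n _ n _ _ 1 _ n]) auto
    moreover have "four_block_mat (mat 1 1 (\<lambda>_. e)) (0\<^sub>m 1 n) (0\<^sub>m n 1) (transpose_mat V * C) * four_block_mat (1\<^sub>m 1) (0\<^sub>m 1 n) (0\<^sub>m n 1) V
        = four_block_mat (mat 1 1 (\<lambda>_. e)) (0\<^sub>m 1 n) (0\<^sub>m n 1) (transpose_mat V * C * V)"
      using V C by (subst mult_four_block_mat[of _ 1 1 _ n _ n _ _ 1 _ n]) auto
    ultimately show ?thesis unfolding tV' unfolding V'_def Bblock by (simp only:)
  qed
  define U where "U = W * V'"
  have U: "U \<in> carrier_mat (Suc n) (Suc n)" using W V' by (simp add: U_def)
  have tU: "transpose_mat U = transpose_mat V' * W"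
    using W V' by (simp add: U_def transpose_mult[of _ "Suc n" "Suc n" _ "Suc n"])
  note am = assoc_mult_mat[of _ "Suc n" "Suc n" _ "Suc n" _ "Suc n"]
  have tV'c: "transpose_mat V' \<in> carrier_mat (Suc n) (Suc n)" using V' by simp
  have "transpose_mat U * U = transpose_mat V' * (W * W) * V'"
    unfolding tU unfolding U_def using W(1) V' tV'c by (simp add: am)
  then have 1: "transpose_mat U * U = 1\<^sub>m (Suc n)" using W V' one by simp
  have "transpose_mat U * A * U = transpose_mat V' * B * V'"
    unfolding tU unfolding U_def B_def using W(1) V' tV'c A by (simp add: am)
  then have 2: "diagonal_mat (transpose_mat U * A * U)"
    unfolding diag using V(1,3) C unfolding diagonal_mat_def by auto
  show ?case using U 1 2 by blast
qed

definition quad :: "nat \<Rightarrow> real mat \<Rightarrow> (nat \<Rightarrow> real) \<Rightarrow> real" where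
  "quad n A v = (\<Sum>i<n. \<Sum>j<n. A $$ (i,j) * v i * v j)"

text \<open>The coordinate form of the spectral theorem used from here on: the \<open>u i\<close>
  are orthonormal eigenvectors with eigenvalues \<open>e i\<close>, so the form and the squared norm
  are weighted sums of the same squares. The last clause ties \<open>e\<close> to the multiset
  behind \<open>ordered_eigenvalue\<close>.\<close>

lemma quad_spectral:
  fixes A :: "real mat"
  assumes A: "A \<in> carrier_mat n n" and sym: "transpose_mat A = A"
  obtains e u where "\<And>i j. i < n \<Longrightarrow> j < n \<Longrightarrow> (\<Sum>k<n. u i k * u j k) = (if i = j then 1 else 0)"
    "\<And>v. quad n A v = (\<Sum>i<n. e i * (\<Sum>k<n. u i k * v k)^2)"
    "\<And>v. (\<Sum>k<n. (v k)^2) = (\<Sum>i<n. (\<Sum>k<n. u i k * v k)^2)"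
    "proots (char_poly A) = image_mset e (mset_set {..<n})"
proof -
  obtain U where U: "U \<in> carrier_mat n n" "transpose_mat U * U = 1\<^sub>m n" "diagonal_mat (transpose_mat U * A * U)"
    using real_spectral_theorem[OF assms] by blast
  define D where "D = transpose_mat U * A * U"
  have tU: "transpose_mat U \<in> carrier_mat n n" using U by simp
  have D: "D \<in> carrier_mat n n" using U A by (simp add: D_def)
  have UU: "U * transpose_mat U = 1\<^sub>m n" using mat_mult_left_right_inverse[OF tU U(1) U(2)] .
  note am = assoc_mult_mat[of _ n n _ n _ n]
  have "U * D * transpose_mat U = (U * transpose_mat U) * A * (U * transpose_mat U)"
    unfolding D_def using U(1) A tU by (simp add: am)
  then have AD: "A = U * D * transpose_mat U" using UU A by simp
  have "similar_mat_wit A D U (transpose_mat U)"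
    using A D U tU UU AD unfolding similar_mat_wit_def by (auto simp: Let_def)
  then have cp: "char_poly A = char_poly D" by (intro char_poly_similar) (auto simp: similar_mat_def)
  have ut: "upper_triangular D" using U(3) D unfolding D_def[symmetric] diagonal_mat_def upper_triangular_def by auto
  define e where "e = (\<lambda>i. D $$ (i,i))"
  define u where "u = (\<lambda>i k. U $$ (k,i))"
  have Dij: "D $$ (i,j) = (if i = j then e i else 0)" if "i < n" "j < n" for i j
    using that U(3) D unfolding D_def[symmetric] diagonal_mat_def e_def by auto
  have "proots (char_poly D) = image_mset e (mset_set {..<n})"
  proof -
    have "char_poly D = (\<Prod>i\<leftarrow>[0..<n]. [:- e i, 1:])"
      using char_poly_upper_triangular[OF D ut] D by (simp add: diag_mat_def e_def o_def)
    also have "\<dots> = (\<Prod>i<n. [:- e i, 1:])"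
      using prod.distinct_set_conv_list[of "[0..<n]" "\<lambda>i. [:- e i, 1:]"] by (simp add: lessThan_atLeast0)
    finally have "proots (char_poly D) = (\<Sum>i<n. proots [:- e i, 1:])"
      by (simp add: proots_prod)
    also have "\<dots> = (\<Sum>i<n. {# e i #})" by simp
    also have "\<dots> = image_mset e (mset_set {..<n})"
      by (induction n) (auto simp: lessThan_Suc)
    finally show ?thesis .
  qed
  then have 4: "proots (char_poly A) = image_mset e (mset_set {..<n})" using cp by simp
  have 1: "(\<Sum>k<n. u i k * u j k) = (if i = j then 1 else 0)" if "i < n" "j < n" for i j
    using arg_cong[OF U(2), of "\<lambda>M. M $$ (i,j)"] that U(1)
    by (simp add: scalar_prod_def u_def atLeast0LessThan)
  have rowo: "(\<Sum>i<n. u i k * u i l) = (if k = l then 1 else 0)" if "k < n" "l < n" for k l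
    using arg_cong[OF UU, of "\<lambda>M. M $$ (k,l)"] that U(1)
    by (simp add: scalar_prod_def u_def atLeast0LessThan)
  have Akl: "A $$ (k,l) = (\<Sum>i<n. e i * (u i k * u i l))" if "k < n" "l < n" for k l
  proof -
    have "A $$ (k,l) = (\<Sum>i<n. U $$ (k,i) * (\<Sum>j<n. D $$ (i,j) * U $$ (l,j)))"
      using that U(1) D by (subst AD) (simp add: scalar_prod_def atLeast0LessThan)
    also have "\<dots> = (\<Sum>i<n. U $$ (k,i) * e i * U $$ (l,i))"
    proof (intro sum.cong refl)
      fix i assume i: "i \<in> {..<n}"
      have "(\<Sum>j<n. D $$ (i,j) * U $$ (l,j)) = (\<Sum>j<n. if j = i then e i * U $$ (l,i) else 0)"
        using i by (intro sum.cong refl) (auto simp: Dij)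
      then show "U $$ (k,i) * (\<Sum>j<n. D $$ (i,j) * U $$ (l,j)) = U $$ (k,i) * e i * U $$ (l,i)"
        using i by simp
    qed
    finally show ?thesis by (simp add: u_def mult_ac)
  qed
  \<comment> \<open>Taken with \<open>f = e\<close> this yields the quadratic form, with
    \<open>f\<close> constantly 1 Parseval's identity.\<close>
  have gen: "(\<Sum>k<n. \<Sum>l<n. (\<Sum>i<n. f i * (u i k * u i l)) * v k * v l) = (\<Sum>i<n. f i * (\<Sum>k<n. u i k * v k)^2)" for f v
  proof -
    have "(\<Sum>k<n. \<Sum>l<n. (\<Sum>i<n. f i * (u i k * u i l)) * v k * v l)
        = (\<Sum>k<n. \<Sum>l<n. \<Sum>i<n. f i * (u i k * v k) * (u i l * v l))"
      by (simp add: sum_distrib_left sum_distrib_right mult_ac)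
    also have "\<dots> = (\<Sum>k<n. \<Sum>i<n. \<Sum>l<n. f i * (u i k * v k) * (u i l * v l))"
      by (intro sum.cong refl sum.swap)
    also have "\<dots> = (\<Sum>i<n. \<Sum>k<n. \<Sum>l<n. f i * (u i k * v k) * (u i l * v l))"
      by (rule sum.swap)
    finally show ?thesis by (simp add: power2_eq_square sum_product sum_distrib_left mult_ac)
  qed
  have 2: "quad n A v = (\<Sum>i<n. e i * (\<Sum>k<n. u i k * v k)^2)" for v
    unfolding gen[symmetric] quad_def by (intro sum.cong refl) (simp add: Akl)
  have "(\<Sum>k<n. (v k)^2) = (\<Sum>k<n. \<Sum>l<n. (\<Sum>i<n. 1 * (u i k * u i l)) * v k * v l)" for v
    by (intro sum.cong refl) (simp add: rowo if_distrib[of "\<lambda>x. x * _"] power2_eq_square cong: if_cong)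
  then have 3: "(\<Sum>k<n. (v k)^2) = (\<Sum>i<n. (\<Sum>k<n. u i k * v k)^2)" for v
    unfolding gen by simp
  show ?thesis using that[of u e] 1 2 3 4 by blast
qed

section \<open>Order statistics as counts, and variational bounds for eigenvalues\<close>

text \<open>Padding with zero rows makes the system square; row \<open>p\<close> is then zero, so
  the determinant vanishes and the kernel is nontrivial.\<close>

lemma homogeneous_system_nontrivial:
  fixes a :: "nat \<Rightarrow> nat \<Rightarrow> real"
  assumes "p < q"
  obtains c where "\<exists>l<q. c l \<noteq> 0" "\<And>i. i < p \<Longrightarrow> (\<Sum>l<q. a i l * c l) = 0"
proof -
  define N where "N = mat q q (\<lambda>(i,l). if i < p then a i l else 0)"
  have N: "N \<in> carrier_mat q q" by (simp add: N_def)
  have "N = mat\<^sub>r q q (\<lambda>i. if i = p then 0\<^sub>v q else row N i)"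
    using assms by (intro eq_matI) (auto simp: N_def)
  moreover have "Determinant.det (mat\<^sub>r q q (\<lambda>i. if i = p then 0\<^sub>v q else row N i)) = 0"
    by (rule det_row_0[OF assms]) (auto simp: N_def)
  ultimately have "Determinant.det N = 0" by simp
  then obtain z where z: "z \<in> carrier_vec q" "z \<noteq> 0\<^sub>v q" "N *\<^sub>v z = 0\<^sub>v q"
    using det_0_iff_vec_prod_zero[OF N] by blast
  show ?thesis
  proof (rule that[of "\<lambda>l. z $ l"])
    show "\<exists>l<q. z $ l \<noteq> 0" using z(1,2) by (metis eq_vecI carrier_vecD index_zero_vec)
    fix i assume i: "i < p"
    then have "(N *\<^sub>v z) $ i = 0" using z(3) assms by simp
    then show "(\<Sum>l<q. a i l * z $ l) = 0"
      using i assms z(1) by (simp add: N_def scalar_prod_def atLeast0LessThan)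
  qed
qed

text \<open>Order statistics are accessed only through counts of elements beyond a threshold. The
  underlying list is increasing, so the m-th largest element sits at position
  \<open>size X - m\<close>.\<close>

lemma kth_largest_ge_iff:
  assumes "1 \<le> m" "m \<le> size X"
  shows "t \<le> kth_largest m X \<longleftrightarrow> m \<le> size (filter_mset (\<lambda>x. t \<le> x) X)"
proof -
  define xs where "xs = sorted_list_of_multiset X"
  have s: "sorted xs" by (simp add: xs_def)
  have X: "X = mset xs" by (simp add: xs_def)
  have l: "length xs = size X" by (simp add: X)
  have k: "kth_largest m X = xs ! (size X - m)"
    using assms unfolding kth_largest_def xs_def[symmetric] by (subst rev_nth) (auto simp: l)
  have f: "size (filter_mset (\<lambda>x. t \<le> x) X) = card {i. i < length xs \<and> t \<le> xs ! i}"
  proof -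
    have "filter_mset (\<lambda>x. t \<le> x) X = mset (filter (\<lambda>x. t \<le> x) xs)" by (simp add: X)
    then show ?thesis by (metis length_filter_conv_card size_mset)
  qed
  show ?thesis
  proof
    assume "t \<le> kth_largest m X"
    then have "{size X - m..<size X} \<subseteq> {i. i < length xs \<and> t \<le> xs ! i}"
      using s sorted_nth_mono[OF s] by (auto simp: k l intro: order_trans)
    from card_mono[OF _ this] show "m \<le> size (filter_mset (\<lambda>x. t \<le> x) X)"
      unfolding f using assms by simp
  next
    assume m: "m \<le> size (filter_mset (\<lambda>x. t \<le> x) X)"
    show "t \<le> kth_largest m X"
    proof (rule ccontr)
      assume n: "\<not> t \<le> kth_largest m X"
      have "{i. i < length xs \<and> t \<le> xs ! i} \<subseteq> {size X - m<..<size X}"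
      proof
        fix i assume i: "i \<in> {i. i < length xs \<and> t \<le> xs ! i}"
        have "\<not> i \<le> size X - m"
          using sorted_nth_mono[OF s, of i "size X - m"] n i assms by (auto simp: k l)
        then show "i \<in> {size X - m<..<size X}" using i l by auto
      qed
      from card_mono[OF _ this] m show False unfolding f using assms by simp
    qed
  qed
qed

lemma kth_largest_le_iff:
  assumes "1 \<le> m" "m \<le> size X"
  shows "kth_largest m X \<le> t \<longleftrightarrow> size (filter_mset (\<lambda>x. t < x) X) < m"
proof -
  define xs where "xs = sorted_list_of_multiset X"
  have s: "sorted xs" by (simp add: xs_def)
  have X: "X = mset xs" by (simp add: xs_def)
  have l: "length xs = size X" by (simp add: X)
  have k: "kth_largest m X = xs ! (size X - m)"
    using assms unfolding kth_largest_def xs_def[symmetric] by (subst rev_nth) (auto simp: l)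
  have f: "size (filter_mset (\<lambda>x. t < x) X) = card {i. i < length xs \<and> t < xs ! i}"
  proof -
    have "filter_mset (\<lambda>x. t < x) X = mset (filter (\<lambda>x. t < x) xs)" by (simp add: X)
    then show ?thesis by (metis length_filter_conv_card size_mset)
  qed
  show ?thesis
  proof
    assume n: "kth_largest m X \<le> t"
    have "{i. i < length xs \<and> t < xs ! i} \<subseteq> {size X - m<..<size X}"
    proof
      fix i assume i: "i \<in> {i. i < length xs \<and> t < xs ! i}"
      have "\<not> i \<le> size X - m"
        using sorted_nth_mono[OF s, of i "size X - m"] n i assms by (auto simp: k l)
      then show "i \<in> {size X - m<..<size X}" using i l by auto
    qed
    from card_mono[OF _ this] show "size (filter_mset (\<lambda>x. t < x) X) < m" unfolding f using assms by simp
  next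
    assume m: "size (filter_mset (\<lambda>x. t < x) X) < m"
    show "kth_largest m X \<le> t"
    proof (rule ccontr)
      assume "\<not> kth_largest m X \<le> t"
      then have "{size X - m..<size X} \<subseteq> {i. i < length xs \<and> t < xs ! i}"
        by (auto simp: k l not_le intro: less_le_trans[OF _ sorted_nth_mono[OF s]])
      from card_mono[OF _ this] show False using m unfolding f using assms by simp
    qed
  qed
qed

lemma size_filter_image_mset_set:
  "size (filter_mset P (image_mset f (mset_set {..<n::nat}))) = card {i. i < n \<and> P (f i)}"
  by (simp add: filter_mset_image_mset lessThan_def)

lemma order_statistic_le_iff:
  assumes "1 \<le> m" "m \<le> n"
  shows "order_statistic n m \<xi> \<le> t \<longleftrightarrow> card {i. i < n \<and> t < \<xi> i} < m"
  unfolding order_statistic_def using assms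
  by (simp add: kth_largest_le_iff size_filter_image_mset_set)

lemma quad_combination_nonzero:
  fixes u :: "nat \<Rightarrow> nat \<Rightarrow> real"
  assumes u: "\<And>i j. i < n \<Longrightarrow> j < n \<Longrightarrow> (\<Sum>k<n. u i k * u j k) = (if i = j then 1 else 0)"
   and f: "inj_on f {..<m}" "f ` {..<m} \<subseteq> {..<n}" and i: "i < n"
  shows "(\<Sum>k<n. u i k * (\<Sum>l<m. c l * u (f l) k)) = (\<Sum>l<m. if f l = i then c l else 0)"
proof -
  have "(\<Sum>k<n. u i k * (\<Sum>l<m. c l * u (f l) k)) = (\<Sum>l<m. c l * (\<Sum>k<n. u i k * u (f l) k))"
    unfolding sum_distrib_left by (subst sum.swap) (simp add: mult_ac)
  also have "\<dots> = (\<Sum>l<m. if f l = i then c l else 0)"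
    using f i by (intro sum.cong refl) (subst u; auto)
  finally show ?thesis .
qed

text \<open>The max-min half of Courant-Fischer. If fewer than \<open>m\<close> eigenvalues reached
  \<open>t\<close>, some nontrivial combination of the \<open>m\<close> vectors \<open>w l\<close>
  would be orthogonal to all their eigenvectors, and there the form is strictly below
  \<open>t\<close> times the squared norm. Positivity of the norm in the hypothesis encodes linear
  independence.\<close>

lemma ordered_eigenvalue_ge:
  assumes A: "A \<in> carrier_mat n n" and sym: "transpose_mat A = A" and m: "1 \<le> m" "m \<le> n"
    and w: "\<And>c. \<exists>l<m. c l \<noteq> 0 \<Longrightarrow> (\<Sum>k<n. (\<Sum>l<m. c l * w l k)^2) > 0 \<and>
       t * (\<Sum>k<n. (\<Sum>l<m. c l * w l k)^2) \<le> quad n A (\<lambda>k. \<Sum>l<m. c l * w l k)"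
  shows "t \<le> ordered_eigenvalue m A"
proof -
  obtain u e where u: "\<And>i j. i < n \<Longrightarrow> j < n \<Longrightarrow> (\<Sum>k<n. u i k * u j k) = (if i = j then 1 else 0)"
    and q: "\<And>v. quad n A v = (\<Sum>i<n. e i * (\<Sum>k<n. u i k * v k)^2)"
    and nrm: "\<And>v. (\<Sum>k<n. (v k)^2) = (\<Sum>i<n. (\<Sum>k<n. u i k * v k)^2)"
    and pr: "proots (char_poly A) = image_mset e (mset_set {..<n})"
    by (rule quad_spectral[OF A sym], rule that)
  let ?I = "{i. i < n \<and> t \<le> e i}"
  have "m \<le> card ?I"
  proof (rule ccontr)
    assume "\<not> m \<le> card ?I"
    then have less: "card ?I < m" by simp
    have fin: "finite ?I" by simp
    obtain f where f: "bij_betw f {..<card ?I} ?I"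
      using ex_bij_betw_nat_finite[OF fin] by (auto simp: atLeast0LessThan)
    obtain c where c: "\<exists>l<m. c l \<noteq> 0" "\<And>i. i < card ?I \<Longrightarrow> (\<Sum>l<m. (\<Sum>k<n. u (f i) k * w l k) * c l) = 0"
      using homogeneous_system_nontrivial[OF less, of "\<lambda>i l. \<Sum>k<n. u (f i) k * w l k"] by blast
    define v where "v = (\<lambda>k. \<Sum>l<m. c l * w l k)"
    have z: "(\<Sum>k<n. u i k * v k) = 0" if "i \<in> ?I" for i
    proof -
      obtain j where j: "j < card ?I" "i = f j" using f \<open>i \<in> ?I\<close> by (auto simp: bij_betw_def)
      have "(\<Sum>k<n. u i k * v k) = (\<Sum>l<m. (\<Sum>k<n. u (f j) k * w l k) * c l)"
        unfolding v_def sum_distrib_left sum_distrib_right j(2) by (subst sum.swap) (simp add: mult_ac)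
      then show ?thesis using c(2)[OF j(1)] by simp
    qed
    have pos: "(\<Sum>k<n. (v k)^2) > 0" and ge: "t * (\<Sum>k<n. (v k)^2) \<le> quad n A v"
      using w[OF c(1)] by (auto simp: v_def)
    have "\<exists>i<n. (\<Sum>k<n. u i k * v k) \<noteq> 0"
    proof (rule ccontr)
      assume "\<not> ?thesis"
      then show False using pos unfolding nrm[of v] by simp
    qed
    then obtain i0 where i0: "i0 < n" "(\<Sum>k<n. u i0 k * v k) \<noteq> 0" by blast
    \<comment> \<open>Coordinates along eigenvalues at least \<open>t\<close> vanish, and some
      coordinate \<open>i0\<close> is nonzero; the latter makes the inequality strict.\<close>
    have "quad n A v < t * (\<Sum>k<n. (v k)^2)"
      unfolding q[of v] nrm[of v] sum_distrib_left
    proof (rule sum_strict_mono_ex1)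
      show "\<forall>x\<in>{..<n}. e x * (\<Sum>k<n. u x k * v k)\<^sup>2 \<le> t * (\<Sum>k<n. u x k * v k)\<^sup>2"
      proof
        fix x assume "x \<in> {..<n}"
        then show "e x * (\<Sum>k<n. u x k * v k)\<^sup>2 \<le> t * (\<Sum>k<n. u x k * v k)\<^sup>2"
          using z[of x] by (cases "t \<le> e x") (auto intro!: mult_right_mono)
      qed
      have "\<not> t \<le> e i0" using z[of i0] i0 by auto
      then show "\<exists>a\<in>{..<n}. e a * (\<Sum>k<n. u a k * v k)\<^sup>2 < t * (\<Sum>k<n. u a k * v k)\<^sup>2"
        using i0 by (intro bexI[of _ i0] mult_strict_right_mono) auto
    qed simp
    with ge show False by simp
  qed
  then show ?thesis unfolding ordered_eigenvalue_def pr
    using m by (simp add: kth_largest_ge_iff size_filter_image_mset_set)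
qed

text \<open>The span of \<open>m\<close> orthonormal eigenvectors with eigenvalues at least
  \<open>t\<close>. It is the test space when the ordered eigenvalues of two forms are
  compared.\<close>

lemma ordered_eigenvalue_witness:
  assumes A: "A \<in> carrier_mat n n" and sym: "transpose_mat A = A" and m: "1 \<le> m" "m \<le> n"
    and t: "t \<le> ordered_eigenvalue m A"
  obtains w where "\<And>c. (\<Sum>k<n. (\<Sum>l<m. c l * w l k)^2) = (\<Sum>l<m. (c l)^2)"
    "\<And>c. t * (\<Sum>l<m. (c l)^2) \<le> quad n A (\<lambda>k. \<Sum>l<m. c l * w l k)"
proof -
  obtain u e where u: "\<And>i j. i < n \<Longrightarrow> j < n \<Longrightarrow> (\<Sum>k<n. u i k * u j k) = (if i = j then 1 else 0)"
    and q: "\<And>v. quad n A v = (\<Sum>i<n. e i * (\<Sum>k<n. u i k * v k)^2)"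
    and nrm: "\<And>v. (\<Sum>k<n. (v k)^2) = (\<Sum>i<n. (\<Sum>k<n. u i k * v k)^2)"
    and pr: "proots (char_poly A) = image_mset e (mset_set {..<n})"
    by (rule quad_spectral[OF A sym], rule that)
  let ?I = "{i. i < n \<and> t \<le> e i}"
  have "m \<le> card ?I"
    using t m unfolding ordered_eigenvalue_def pr by (simp add: kth_largest_ge_iff size_filter_image_mset_set)
  then obtain J where J: "J \<subseteq> ?I" "card J = m" by (meson obtain_subset_with_card_n)
  have "finite J" using J(1) by (rule finite_subset) simp
  then obtain f where f: "bij_betw f {..<m} J"
    using ex_bij_betw_nat_finite[of J] J(2) by (auto simp: atLeast0LessThan)
  have inj: "inj_on f {..<m}" and im: "f ` {..<m} \<subseteq> {..<n}" "f ` {..<m} = J"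
    using f J by (auto simp: bij_betw_def)
  have comb: "(\<Sum>i<n. g i * (\<Sum>k<n. u i k * (\<Sum>l<m. c l * u (f l) k))^2) = (\<Sum>l<m. g (f l) * (c l)^2)" for g c
  proof -
    have inner: "(\<Sum>l<m. if f l = f l' then c l else 0) = c l'" if "l' < m" for l'
    proof -
      have "(\<Sum>l<m. if f l = f l' then c l else 0) = (\<Sum>l<m. if l = l' then c l else 0)"
        using inj that by (intro sum.cong refl) (auto simp: inj_on_def)
      then show ?thesis using that by simp
    qed
    have "(\<Sum>i<n. g i * (\<Sum>k<n. u i k * (\<Sum>l<m. c l * u (f l) k))^2) = (\<Sum>i<n. g i * (\<Sum>l<m. if f l = i then c l else 0)^2)"
      by (intro sum.cong refl) (subst quad_combination_nonzero[OF u inj im(1)]; simp)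
    also have "\<dots> = (\<Sum>i\<in>J. g i * (\<Sum>l<m. if f l = i then c l else 0)^2)"
      using im by (intro sum.mono_neutral_right) (auto intro!: sum.neutral)
    also have "\<dots> = (\<Sum>l'<m. g (f l') * (\<Sum>l<m. if f l = f l' then c l else 0)^2)"
      unfolding im(2)[symmetric] by (subst sum.reindex[OF inj]) simp
    also have "\<dots> = (\<Sum>l<m. g (f l) * (c l)^2)" by (intro sum.cong refl) (simp add: inner)
    finally show ?thesis .
  qed
  show ?thesis
  proof (rule that[of "\<lambda>l. u (f l)"])
    fix c :: "nat \<Rightarrow> real"
    show "(\<Sum>k<n. (\<Sum>l<m. c l * u (f l) k)\<^sup>2) = (\<Sum>l<m. (c l)\<^sup>2)"
      using comb[of "\<lambda>_. 1" c] unfolding nrm[of "\<lambda>k. \<Sum>l<m. c l * u (f l) k"] by simp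
    show "t * (\<Sum>l<m. (c l)\<^sup>2) \<le> quad n A (\<lambda>k. \<Sum>l<m. c l * u (f l) k)"
      unfolding q comb unfolding sum_distrib_left using im J(1)
      by (intro sum_mono mult_right_mono) auto
  qed
qed

text \<open>An m-dimensional space on which the form is at least \<open>s > t\<close> times the
  squared norm contains a nonzero vector vanishing at the fewer than \<open>m\<close> coordinates
  with \<open>e k > t\<close>. On such a vector the diagonal majorant is at most \<open>t\<close>
  times the squared norm.\<close>

lemma ordered_eigenvalue_le:
  assumes A: "A \<in> carrier_mat n n" and sym: "transpose_mat A = A" and m: "1 \<le> m" "m \<le> n"
    and q: "\<And>v. quad n A v \<le> (\<Sum>k<n. e k * (v k)^2)"
    and card: "card {k. k < n \<and> t < e k} < m"
  shows "ordered_eigenvalue m A \<le> t"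
proof (rule ccontr)
  define s where "s = ordered_eigenvalue m A"
  assume "\<not> ?thesis"
  then have s: "t < s" by (simp add: s_def)
  obtain w where w: "\<And>c. (\<Sum>k<n. (\<Sum>l<m. c l * w l k)^2) = (\<Sum>l<m. (c l)^2)"
    "\<And>c. s * (\<Sum>l<m. (c l)^2) \<le> quad n A (\<lambda>k. \<Sum>l<m. c l * w l k)"
    using ordered_eigenvalue_witness[OF A sym m, of s] by (auto simp: s_def)
  let ?I = "{k. k < n \<and> t < e k}"
  have fin: "finite ?I" by simp
  obtain f where f: "bij_betw f {..<card ?I} ?I"
    using ex_bij_betw_nat_finite[OF fin] by (auto simp: atLeast0LessThan)
  obtain c where c: "\<exists>l<m. c l \<noteq> 0" "\<And>i. i < card ?I \<Longrightarrow> (\<Sum>l<m. w l (f i) * c l) = 0"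
    using homogeneous_system_nontrivial[OF card, of "\<lambda>i l. w l (f i)"] by blast
  define v where "v = (\<lambda>k. \<Sum>l<m. c l * w l k)"
  have z: "v k = 0" if "k \<in> ?I" for k
  proof -
    have "k \<in> f ` {..<card ?I}" using f that by (auto simp: bij_betw_def)
    then obtain j where "j < card ?I" "k = f j" by auto
    then show ?thesis using c(2)[of j] by (simp add: v_def mult.commute)
  qed
  obtain l0 where l0: "l0 < m" "c l0 \<noteq> 0" using c by blast
  have "(\<Sum>l<m. (c l)^2) > 0" by (rule sum_pos2[of _ l0]) (use l0 in auto)
  then have "t * (\<Sum>l<m. (c l)^2) < s * (\<Sum>l<m. (c l)^2)" using s by simp
  also have "\<dots> \<le> quad n A v" using w(2)[of c] by (simp add: v_def)
  also have "\<dots> \<le> (\<Sum>k<n. e k * (v k)^2)" by (rule q)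
  also have "\<dots> \<le> (\<Sum>k<n. t * (v k)^2)"
  proof (rule sum_mono)
    fix k assume "k \<in> {..<n}"
    then show "e k * (v k)\<^sup>2 \<le> t * (v k)\<^sup>2"
      using z[of k] by (cases "t < e k") (auto intro!: mult_right_mono)
  qed
  also have "\<dots> = t * (\<Sum>l<m. (c l)^2)" using w(1)[of c] by (simp add: v_def sum_distrib_left[symmetric])
  finally show False by simp
qed

text \<open>The witness space of \<open>A\<close> also serves for \<open>B\<close>, up to the
  operator norm of the difference. The entrywise sum is a crude bound for that norm, sufficient
  because only continuity of the eigenvalues is derived from it.\<close>

lemma ordered_eigenvalue_lipschitz_aux:
  assumes A: "A \<in> carrier_mat n n" "transpose_mat A = A" and B: "B \<in> carrier_mat n n" "transpose_mat B = B"
    and m: "1 \<le> m" "m \<le> n"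
  shows "ordered_eigenvalue m A - (\<Sum>i<n. \<Sum>j<n. \<bar>A $$ (i,j) - B $$ (i,j)\<bar>) \<le> ordered_eigenvalue m B"
proof -
  define s where "s = ordered_eigenvalue m A"
  define d where "d = (\<Sum>i<n. \<Sum>j<n. \<bar>A $$ (i,j) - B $$ (i,j)\<bar>)"
  obtain w where w: "\<And>c. (\<Sum>k<n. (\<Sum>l<m. c l * w l k)^2) = (\<Sum>l<m. (c l)^2)"
    "\<And>c. s * (\<Sum>l<m. (c l)^2) \<le> quad n A (\<lambda>k. \<Sum>l<m. c l * w l k)"
    using ordered_eigenvalue_witness[OF A m, of s] by (auto simp: s_def)
  have dif: "quad n A v - quad n B v \<le> d * (\<Sum>k<n. (v k)^2)" for v
  proof -
    have vle: "\<bar>v i * v j\<bar> \<le> (\<Sum>k<n. (v k)^2)" if "i < n" "j < n" for i j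
    proof -
      have i: "(v i)^2 \<le> (\<Sum>k<n. (v k)^2)" and j: "(v j)^2 \<le> (\<Sum>k<n. (v k)^2)"
        using that by (auto intro!: member_le_sum)
      have "2 * \<bar>v i * v j\<bar> \<le> (v i)^2 + (v j)^2"
        using sum_squares_bound[of "\<bar>v i\<bar>" "\<bar>v j\<bar>"] by (simp add: abs_mult)
      then have "2 * \<bar>v i * v j\<bar> \<le> 2 * (\<Sum>k<n. (v k)^2)" using i j by linarith
      then show ?thesis by simp
    qed
    have "quad n A v - quad n B v = (\<Sum>i<n. \<Sum>j<n. (A $$ (i,j) - B $$ (i,j)) * (v i * v j))"
      unfolding quad_def left_diff_distrib sum_subtractf by (simp only: mult.assoc)
    also have "\<dots> \<le> (\<Sum>i<n. \<Sum>j<n. \<bar>A $$ (i,j) - B $$ (i,j)\<bar> * (\<Sum>k<n. (v k)^2))"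
    proof (intro sum_mono)
      fix i j assume "i \<in> {..<n}" "j \<in> {..<n}"
      then have "i < n" "j < n" by auto
      have "(A $$ (i,j) - B $$ (i,j)) * (v i * v j) \<le> \<bar>(A $$ (i,j) - B $$ (i,j)) * (v i * v j)\<bar>"
        by (rule abs_ge_self)
      also have "\<dots> = \<bar>A $$ (i,j) - B $$ (i,j)\<bar> * \<bar>v i * v j\<bar>" by (rule abs_mult)
      also have "\<dots> \<le> \<bar>A $$ (i,j) - B $$ (i,j)\<bar> * (\<Sum>k<n. (v k)^2)"
        by (intro mult_left_mono vle \<open>i < n\<close> \<open>j < n\<close>) simp
      finally show "(A $$ (i,j) - B $$ (i,j)) * (v i * v j) \<le> \<bar>A $$ (i,j) - B $$ (i,j)\<bar> * (\<Sum>k<n. (v k)^2)" .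
    qed
    finally show ?thesis by (simp add: d_def sum_distrib_right)
  qed
  have "s - d \<le> ordered_eigenvalue m B"
  proof (rule ordered_eigenvalue_ge[OF B m, where w = w])
    fix c :: "nat \<Rightarrow> real" assume "\<exists>l<m. c l \<noteq> 0"
    then obtain l0 where l0: "l0 < m" "c l0 \<noteq> 0" by blast
    have "(\<Sum>l<m. (c l)^2) > 0" by (rule sum_pos2[of _ l0]) (use l0 in auto)
    moreover have "(s - d) * (\<Sum>l<m. (c l)^2) \<le> quad n B (\<lambda>k. \<Sum>l<m. c l * w l k)"
      using dif[of "\<lambda>k. \<Sum>l<m. c l * w l k"] w(2)[of c] w(1)[of c] by (simp add: algebra_simps)
    ultimately show "0 < (\<Sum>k<n. (\<Sum>l<m. c l * w l k)\<^sup>2) \<and>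
         (s - d) * (\<Sum>k<n. (\<Sum>l<m. c l * w l k)\<^sup>2) \<le> quad n B (\<lambda>k. \<Sum>l<m. c l * w l k)"
      by (simp add: w(1))
  qed
  then show ?thesis by (simp add: s_def d_def)
qed

lemma ordered_eigenvalue_lipschitz:
  assumes "A \<in> carrier_mat n n" "transpose_mat A = A" "B \<in> carrier_mat n n" "transpose_mat B = B"
    and "1 \<le> m" "m \<le> n"
  shows "\<bar>ordered_eigenvalue m A - ordered_eigenvalue m B\<bar> \<le> (\<Sum>i<n. \<Sum>j<n. \<bar>A $$ (i,j) - B $$ (i,j)\<bar>)"
  using ordered_eigenvalue_lipschitz_aux[OF assms] ordered_eigenvalue_lipschitz_aux[OF assms(3,4,1,2,5,6)]
  by (simp add: abs_minus_commute abs_le_iff)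

section \<open>Quadratic forms\<close>

definition qform :: "nat \<Rightarrow> (nat \<Rightarrow> nat \<Rightarrow> real) \<Rightarrow> (nat \<Rightarrow> real) \<Rightarrow> real" where
  "qform n G v = (\<Sum>i<n. \<Sum>j<n. G i j * v i * v j)"

definition bform :: "nat \<Rightarrow> (nat \<Rightarrow> nat \<Rightarrow> real) \<Rightarrow> (nat \<Rightarrow> real) \<Rightarrow> (nat \<Rightarrow> real) \<Rightarrow> real" where
  "bform n G x y = (\<Sum>i<n. \<Sum>j<n. G i j * x i * y j)"

lemma bform_sym:
  assumes "\<And>i j. G i j = G j i"
  shows "bform n G x y = bform n G y x"
proof -
  have "bform n G x y = (\<Sum>j<n. \<Sum>i<n. G i j * x i * y j)"
    unfolding bform_def by (rule sum.swap)
  also have "\<dots> = bform n G y x"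
    unfolding bform_def by (intro sum.cong refl) (subst assms, simp add: mult_ac)
  finally show ?thesis .
qed

lemma qform_eq_bform: "qform n G v = bform n G v v"
  by (simp add: qform_def bform_def)

lemma bform_add_left: "bform n G (\<lambda>i. x i + y i) z = bform n G x z + bform n G y z"
  by (simp add: bform_def algebra_simps sum.distrib)

lemma bform_add_right: "bform n G z (\<lambda>i. x i + y i) = bform n G z x + bform n G z y"
  by (simp add: bform_def algebra_simps sum.distrib)

lemma bform_scale_left: "bform n G (\<lambda>i. c * x i) z = c * bform n G x z"
  by (simp add: bform_def algebra_simps sum_distrib_left)

lemma bform_scale_right: "bform n G z (\<lambda>i. c * x i) = c * bform n G z x"
  by (simp add: bform_def algebra_simps sum_distrib_left)

lemma qform_add:
  assumes "\<And>i j. G i j = G j i"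
  shows "qform n G (\<lambda>i. x i + y i) = qform n G x + 2 * bform n G x y + qform n G y"
  using bform_sym[of G n y x, OF assms]
  by (simp add: qform_eq_bform bform_add_left bform_add_right)

lemma qform_scale: "qform n G (\<lambda>i. c * x i) = c^2 * qform n G x"
  by (simp add: qform_eq_bform bform_scale_left bform_scale_right power2_eq_square)

lemma qform_diff:
  assumes "\<And>i j. G i j = G j i"
  shows "qform n G (\<lambda>i. x i - y i) = qform n G x - 2 * bform n G x y + qform n G y"
  using qform_add[of G n x "\<lambda>i. (-1) * y i", OF assms] bform_scale_right[of n G x "-1" y] qform_scale[of n G "-1" y]
  by simp

text \<open>Polarisation combined with the parallelogram law. The free scale \<open>s\<close>
  balances the two norms, and its sign allows bounds from both sides.\<close>

lemma qform_bound_imp_bform_bound: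
  assumes sym: "\<And>i j. G i j = G j i"
    and q: "\<And>v. \<forall>i. v i \<noteq> 0 \<longrightarrow> i \<in> U \<Longrightarrow> \<bar>qform n G v\<bar> \<le> t * (\<Sum>i<n. (v i)^2)"
    and x: "\<forall>i. x i \<noteq> 0 \<longrightarrow> i \<in> U" and y: "\<forall>i. y i \<noteq> 0 \<longrightarrow> i \<in> U"
  shows "2 * s * bform n G x y \<le> t * (s^2 * (\<Sum>i<n. (x i)^2) + (\<Sum>i<n. (y i)^2))"
proof -
  have 1: "qform n G (\<lambda>i. s * x i + y i) \<le> t * (\<Sum>i<n. (s * x i + y i)^2)"
    by (rule order_trans[OF abs_ge_self q]) (use x y in force)
  have 2: "- qform n G (\<lambda>i. s * x i - y i) \<le> t * (\<Sum>i<n. (s * x i - y i)^2)"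
    by (rule order_trans[OF abs_ge_minus_self q]) (use x y in force)
  have "qform n G (\<lambda>i. s * x i + y i) - qform n G (\<lambda>i. s * x i - y i) = 4 * s * bform n G x y"
    by (simp add: qform_add[of G, OF sym] qform_diff[of G, OF sym] qform_scale bform_scale_left)
  moreover have "(\<Sum>i<n. (s * x i + y i)^2) + (\<Sum>i<n. (s * x i - y i)^2) = 2 * (s^2 * (\<Sum>i<n. (x i)^2) + (\<Sum>i<n. (y i)^2))"
    unfolding sum.distrib[symmetric] sum_distrib_left
    by (intro sum.cong refl) (simp add: power2_eq_square algebra_simps)
  ultimately have "4 * s * bform n G x y \<le> t * (2 * (s^2 * (\<Sum>i<n. (x i)^2) + (\<Sum>i<n. (y i)^2)))"
    using 1 2 by (metis (no_types, lifting) add_mono diff_conv_add_uminus distrib_left)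
  then show ?thesis by (simp add: algebra_simps)
qed

text \<open>A bound on the form over \<open>U\<close> bounds the operator compressed to
  \<open>U\<close>: test the bilinear form against the restriction of G x to \<open>U\<close>, with
  the scale \<open>s = t\<close>.\<close>

lemma qform_bound_imp_image_bound:
  assumes sym: "\<And>i j. G i j = G j i" and t: "t > 0"
    and q: "\<And>v. \<forall>i. v i \<noteq> 0 \<longrightarrow> i \<in> U \<Longrightarrow> \<bar>qform n G v\<bar> \<le> t * (\<Sum>i<n. (v i)^2)"
    and x: "\<forall>i. x i \<noteq> 0 \<longrightarrow> i \<in> U" and U: "U \<subseteq> {..<n}"
  shows "(\<Sum>j\<in>U. (\<Sum>i<n. G i j * x i)^2) \<le> t^2 * (\<Sum>i<n. (x i)^2)"
proof -
  define y where "y = (\<lambda>j. if j \<in> U then \<Sum>i<n. G i j * x i else 0)"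
  have Y: "(\<Sum>j<n. (y j)^2) = (\<Sum>j\<in>U. (\<Sum>i<n. G i j * x i)^2)"
    using U by (intro sum.mono_neutral_cong_right) (auto simp: y_def)
  have "bform n G x y = (\<Sum>j<n. \<Sum>i<n. G i j * x i * y j)"
    unfolding bform_def by (rule sum.swap)
  also have "\<dots> = (\<Sum>j<n. (y j)^2)"
    by (intro sum.cong refl) (auto simp: y_def sum_distrib_right[symmetric] power2_eq_square)
  finally have B: "bform n G x y = (\<Sum>j<n. (y j)^2)" .
  have "2 * t * bform n G x y \<le> t * (t^2 * (\<Sum>i<n. (x i)^2) + (\<Sum>i<n. (y i)^2))"
    by (rule qform_bound_imp_bform_bound[where G=G and U=U, OF sym q x]) (auto simp: y_def)
  then have "t * (2 * bform n G x y) \<le> t * (t^2 * (\<Sum>i<n. (x i)^2) + (\<Sum>i<n. (y i)^2))"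
    by (simp add: mult_ac)
  then have "2 * bform n G x y \<le> t^2 * (\<Sum>i<n. (x i)^2) + (\<Sum>i<n. (y i)^2)"
    using t by simp
  then show ?thesis unfolding B Y[symmetric] by simp
qed

text \<open>Passing from the net to all vectors costs a factor 2: truncating towards zero keeps the support,
  does not increase the norm, and moves a unit vector by at most 1/4.\<close>

lemma qform_bound_from_lattice:
  fixes s :: real
  assumes sym: "\<And>i j. G i j = G j i" and U: "U \<subseteq> {..<n}" and s: "s > 0" "real (card U) \<le> s"
    and z: "\<And>z :: nat \<Rightarrow> int. \<forall>i. z i \<noteq> 0 \<longrightarrow> i \<in> U \<Longrightarrow> (\<Sum>i<n. (z i)^2) \<le> 16 * s \<Longrightarrow>
        \<bar>qform n G (\<lambda>i. real_of_int (z i))\<bar> \<le> t * (16 * s)"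
    and v: "\<forall>i. v i \<noteq> 0 \<longrightarrow> i \<in> U"
  shows "\<bar>qform n G v\<bar> \<le> 2 * t * (\<Sum>i<n. (v i)^2)"
proof -
  define V where "V = {v. (\<forall>i. v i \<noteq> 0 \<longrightarrow> i \<in> U) \<and> (\<Sum>i<n. (v i)^2) \<le> (1::real)}"
  define F where "F = (\<lambda>v. \<bar>qform n G v\<bar>) ` V"
  \<comment> \<open>The optimal constant over unit vectors supported in \<open>U\<close>. The
    argument below shows that it improves itself, so the supremum only has to be finite, not
    attained.\<close>
  define \<Theta> where "\<Theta> = Sup F"
  have zero: "(\<lambda>_. 0) \<in> V" by (simp add: V_def)
  have Fne: "F \<noteq> {}" using zero by (auto simp: F_def)
  have bdd: "bdd_above F" unfolding F_def
  proof (rule bdd_aboveI2)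
    fix v assume v: "v \<in> V"
    have le1: "\<bar>v i\<bar> \<le> 1" if "i < n" for i
    proof -
      have "(v i)^2 \<le> (\<Sum>i<n. (v i)^2)" using that by (intro member_le_sum) auto
      also have "\<dots> \<le> 1" using v by (simp add: V_def)
      finally show ?thesis by (simp add: abs_square_le_1)
    qed
    have "\<bar>qform n G v\<bar> \<le> (\<Sum>i<n. \<bar>\<Sum>j<n. G i j * v i * v j\<bar>)"
      unfolding qform_def by (rule sum_abs)
    also have "\<dots> \<le> (\<Sum>i<n. \<Sum>j<n. \<bar>G i j * v i * v j\<bar>)" by (intro sum_mono sum_abs)
    also have "\<dots> \<le> (\<Sum>i<n. \<Sum>j<n. \<bar>G i j\<bar>)"
    proof (intro sum_mono)
      fix i j assume "i \<in> {..<n}" "j \<in> {..<n}"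
      then have "\<bar>v i\<bar> * \<bar>v j\<bar> \<le> 1 * 1" by (intro mult_mono le1) auto
      then have "\<bar>G i j\<bar> * (\<bar>v i\<bar> * \<bar>v j\<bar>) \<le> \<bar>G i j\<bar> * 1" by (intro mult_left_mono) auto
      then show "\<bar>G i j * v i * v j\<bar> \<le> \<bar>G i j\<bar>" by (simp add: abs_mult mult_ac)
    qed
    finally show "\<bar>qform n G v\<bar> \<le> (\<Sum>i<n. \<Sum>j<n. \<bar>G i j\<bar>)" .
  qed
  have up: "\<bar>qform n G v\<bar> \<le> \<Theta>" if "v \<in> V" for v
    unfolding \<Theta>_def using bdd that by (intro cSup_upper) (auto simp: F_def)
  have \<Theta>0: "\<Theta> \<ge> 0" using up[OF zero] by simp
  have qb: "\<bar>qform n G v\<bar> \<le> \<Theta> * (\<Sum>i<n. (v i)^2)" if v: "\<forall>i. v i \<noteq> 0 \<longrightarrow> i \<in> U" for v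
  proof (cases "(\<Sum>i<n. (v i)^2) = 0")
    case True
    then have "\<And>i. i < n \<Longrightarrow> v i = 0" by (subst (asm) sum_nonneg_eq_0_iff) auto
    then show ?thesis by (simp add: qform_def)
  next
    case False
    define N where "N = (\<Sum>i<n. (v i)^2)"
    have N: "N > 0" using False sum_nonneg[of "{..<n}" "\<lambda>i. (v i)^2"] by (simp add: N_def)
    have "(\<lambda>i. 1 / sqrt N * v i) \<in> V"
      using v N by (auto simp: V_def power_mult_distrib power_divide sum_divide_distrib[symmetric] N_def[symmetric])
    from up[OF this] have "\<bar>qform n G v\<bar> / N \<le> \<Theta>"
      using N unfolding qform_scale[of n G "1 / sqrt N" v] by (simp add: power_divide abs_mult)
    then show ?thesis using N by (simp add: field_simps N_def[symmetric])
  qed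
  \<comment> \<open>A grid of mesh \<open>1 / r\<close>: rounding at most \<open>s\<close>
    coordinates costs squared distance at most s / r^2 = 1/16.\<close>
  define r where "r = 4 * sqrt s"
  have r: "r > 0" "r^2 = 16 * s" using s by (auto simp: r_def power_mult_distrib)
  have "\<Theta> \<le> t + \<Theta> / 2" unfolding \<Theta>_def
  proof (rule cSup_least[OF Fne], fold \<Theta>_def)
    fix f assume "f \<in> F"
    then obtain v where v: "v \<in> V" "f = \<bar>qform n G v\<bar>" by (auto simp: F_def)
    define z where "z = (\<lambda>i. if v i \<ge> 0 then \<lfloor>r * v i\<rfloor> else \<lceil>r * v i\<rceil>)"
    define w where "w = (\<lambda>i. real_of_int (z i) / r)"
    have zU: "\<forall>i. z i \<noteq> 0 \<longrightarrow> i \<in> U"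
    proof (intro allI impI)
      fix i assume "z i \<noteq> 0"
      then have "v i \<noteq> 0" by (auto simp: z_def)
      then show "i \<in> U" using v by (auto simp: V_def)
    qed
    have zabs: "\<bar>real_of_int (z i)\<bar> \<le> \<bar>r * v i\<bar>" for i
    proof (cases "v i \<ge> 0")
      case True
      then have "0 \<le> r * v i" using r by simp
      then show ?thesis using True by (simp add: z_def)
    next
      case False
      then have "r * v i \<le> 0" using r by (simp add: mult_le_0_iff)
      moreover from this have "\<lceil>r * v i\<rceil> \<le> 0" by (simp add: ceiling_le_iff)
      moreover have "z i = \<lceil>r * v i\<rceil>" using False by (simp add: z_def)
      ultimately show ?thesis using le_of_int_ceiling[of "r * v i"] by linarith
    qed
    have zdiff: "\<bar>r * v i - real_of_int (z i)\<bar> \<le> 1" for i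
      unfolding z_def by (cases "v i \<ge> 0") (simp_all, linarith+)
    have wabs: "\<bar>w i\<bar> \<le> \<bar>v i\<bar>" for i
      using zabs[of i] r by (simp add: w_def abs_mult field_simps)
    have wdiff: "\<bar>v i - w i\<bar> \<le> 1 / r" for i
    proof -
      have "v i - w i = (r * v i - real_of_int (z i)) / r"
        using r by (simp add: w_def diff_divide_distrib)
      then have "\<bar>v i - w i\<bar> = \<bar>r * v i - real_of_int (z i)\<bar> / r"
        using r by (simp add: abs_divide)
      then show ?thesis using zdiff[of i] r by (simp add: divide_right_mono)
    qed
    have w2: "(\<Sum>i<n. (w i)^2) \<le> (\<Sum>i<n. (v i)^2)"
      using wabs by (intro sum_mono) (simp add: abs_le_square_iff)
    have v1: "(\<Sum>i<n. (v i)^2) \<le> 1" using v by (simp add: V_def)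
    have wU: "\<forall>i. w i \<noteq> 0 \<longrightarrow> i \<in> U" using zU by (auto simp: w_def)
    have vU: "\<forall>i. v i \<noteq> 0 \<longrightarrow> i \<in> U" using v by (auto simp: V_def)
    have "real_of_int (\<Sum>i<n. (z i)^2) = (\<Sum>i<n. (r * w i)^2)" using r by (simp add: w_def)
    also have "\<dots> = r^2 * (\<Sum>i<n. (w i)^2)" by (simp add: power_mult_distrib sum_distrib_left)
    also have "\<dots> \<le> r^2 * 1" using w2 v1 by (intro mult_left_mono) auto
    finally have "(\<Sum>i<n. (z i)^2) \<le> 16 * s" using r by simp
    from z[OF zU this] have "\<bar>qform n G (\<lambda>i. r * w i)\<bar> \<le> t * r^2" using r by (simp add: w_def)
    then have "r^2 * \<bar>qform n G w\<bar> \<le> r^2 * t" using r(1) by (simp add: qform_scale abs_mult mult.commute)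
    then have qw: "\<bar>qform n G w\<bar> \<le> t" using r(1) by simp
    have "(\<Sum>i<n. (v i - w i)^2) = (\<Sum>i\<in>U. (v i - w i)^2)"
      using U vU wU by (intro sum.mono_neutral_right) (auto, metis)
    also have "\<dots> \<le> (\<Sum>i\<in>U. (1/r)^2)"
      using wdiff r by (intro sum_mono) (simp add: abs_le_square_iff[symmetric])
    also have "\<dots> = real (card U) / (16 * s)" using r by (simp add: power_divide)
    also have "\<dots> \<le> 1 / 16" using s by (simp add: field_simps)
    finally have d16: "(\<Sum>i<n. (v i - w i)^2) \<le> 1/16" .
    have "(\<Sum>i<n. (v i + w i)^2) \<le> (\<Sum>i<n. 2 * (v i)^2 + 2 * (w i)^2)"
    proof (intro sum_mono)
      fix i
      have "(v i + w i)^2 + (v i - w i)^2 = 2 * (v i)^2 + 2 * (w i)^2"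
        by (simp add: power2_eq_square algebra_simps)
      then show "(v i + w i)^2 \<le> 2 * (v i)^2 + 2 * (w i)^2"
        using zero_le_power2[of "v i - w i"] by linarith
    qed
    also have "\<dots> \<le> 4" using w2 v1 by (simp add: sum.distrib sum_distrib_left[symmetric])
    finally have s4: "(\<Sum>i<n. (v i + w i)^2) \<le> 4" .
    \<comment> \<open>The scale 1/8 makes both terms equal to 1/16, since |v + w| is at most 2 and
      |v - w| at most 1/4.\<close>
    have key: "\<bar>bform n G (\<lambda>i. v i + w i) (\<lambda>i. v i - w i)\<bar> \<le> \<Theta> / 2"
    proof -
      have aU: "\<forall>i. v i + w i \<noteq> 0 \<longrightarrow> i \<in> U" "\<forall>i. v i - w i \<noteq> 0 \<longrightarrow> i \<in> U" using vU wU by force+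
      have "2 * c * bform n G (\<lambda>i. v i + w i) (\<lambda>i. v i - w i) \<le> \<Theta> * (1/8)" if "c^2 = (1/8)^2" for c
      proof -
        have "2 * c * bform n G (\<lambda>i. v i + w i) (\<lambda>i. v i - w i) \<le> \<Theta> * (c^2 * (\<Sum>i<n. (v i + w i)^2) + (\<Sum>i<n. (v i - w i)^2))"
          by (rule qform_bound_imp_bform_bound[where G=G and U=U, OF sym qb aU])
        also have "\<dots> \<le> \<Theta> * (1/64 * 4 + 1/16)"
          unfolding that using s4 d16 \<Theta>0 by (intro mult_left_mono add_mono) (auto simp: power_divide)
        finally show ?thesis by simp
      qed
      from this[of "1/8"] this[of "-1/8"] show ?thesis by (simp add: abs_le_iff power2_eq_square)
    qed
    \<comment> \<open>By symmetry of G the difference of the forms at \<open>v\<close> and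
      \<open>w\<close> factors as the bilinear form of v + w and v - w.\<close>
    have "bform n G (\<lambda>i. v i + w i) (\<lambda>i. v i + (-1) * w i) = qform n G v - qform n G w"
      using bform_sym[of G n v w, OF sym]
      unfolding bform_add_left bform_add_right bform_scale_right qform_eq_bform by simp
    then have "qform n G v = qform n G w + bform n G (\<lambda>i. v i + w i) (\<lambda>i. v i - w i)" by simp
    then show "f \<le> t + \<Theta> / 2" using qw key v(2) by linarith
  qed
  then have "\<Theta> \<le> 2 * t" by simp
  then have "\<Theta> * (\<Sum>i<n. (v i)^2) \<le> 2 * t * (\<Sum>i<n. (v i)^2)" by (intro mult_right_mono sum_nonneg) auto
  with qb[OF v] show ?thesis by linarith
qed

lemma sum_sum_mean:
  fixes f :: "'a \<Rightarrow> real"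
  shows "(\<Sum>i\<in>T. \<Sum>j\<in>T. (f i + f j) / 2) = real (card T) * sum f T"
proof -
  have "(\<Sum>i\<in>T. \<Sum>j\<in>T. (f i + f j) / 2) = (\<Sum>i\<in>T. (real (card T) * f i + sum f T) / 2)"
    by (intro sum.cong refl) (simp add: sum_divide_distrib[symmetric] sum.distrib)
  also have "\<dots> = (real (card T) * sum f T + real (card T) * sum f T) / 2"
    unfolding sum_divide_distrib[symmetric] sum.distrib sum_distrib_left[symmetric] by simp
  finally show ?thesis by simp
qed

text \<open>The Gram matrix of the rows in \<open>T\<close> is compared with the identity. Bounding
  each |x_i x_i'| by the mean of the two squares amounts to a row-sum bound, so the off-diagonal
  part costs \<open>card T\<close> times \<delta>.\<close>

lemma sum_mult_square_bound:
  fixes G :: "nat \<Rightarrow> nat \<Rightarrow> real"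
  assumes T: "T \<subseteq> {..<n}" and x: "\<forall>i. x i \<noteq> 0 \<longrightarrow> i \<in> T"
    and diag: "\<And>i. i \<in> T \<Longrightarrow> \<bar>(\<Sum>j<n. (G i j)^2) - 1\<bar> \<le> \<epsilon>"
    and off: "\<And>i i'. i \<in> T \<Longrightarrow> i' \<in> T \<Longrightarrow> i \<noteq> i' \<Longrightarrow> \<bar>\<Sum>j<n. G i j * G i' j\<bar> \<le> \<delta>" and \<delta>: "\<delta> \<ge> 0"
  shows "\<bar>(\<Sum>j<n. (\<Sum>i<n. G i j * x i)^2) - (\<Sum>i<n. (x i)^2)\<bar> \<le> (\<epsilon> + real (card T) * \<delta>) * (\<Sum>i<n. (x i)^2)"
proof -
  have fin: "finite T" using T finite_subset by blast
  have X: "(\<Sum>i<n. (x i)^2) = (\<Sum>i\<in>T. (x i)^2)"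
    using T x by (intro sum.mono_neutral_right) auto
  have "(\<Sum>j<n. (\<Sum>i<n. G i j * x i)^2) = (\<Sum>j<n. (\<Sum>i\<in>T. G i j * x i)^2)"
    using T x by (intro sum.cong refl arg_cong[of _ _ "\<lambda>u. u^2"] sum.mono_neutral_right) auto
  also have "\<dots> = (\<Sum>j<n. \<Sum>i\<in>T. \<Sum>i'\<in>T. x i * x i' * (G i j * G i' j))"
    by (simp add: power2_eq_square sum_product mult_ac)
  also have "\<dots> = (\<Sum>i\<in>T. \<Sum>j<n. \<Sum>i'\<in>T. x i * x i' * (G i j * G i' j))" by (rule sum.swap)
  also have "\<dots> = (\<Sum>i\<in>T. \<Sum>i'\<in>T. \<Sum>j<n. x i * x i' * (G i j * G i' j))"
    by (intro sum.cong refl sum.swap)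
  also have "\<dots> = (\<Sum>i\<in>T. \<Sum>i'\<in>T. x i * x i' * (\<Sum>j<n. G i j * G i' j))"
    by (simp add: sum_distrib_left)
  finally have E: "(\<Sum>j<n. (\<Sum>i<n. G i j * x i)^2) = (\<Sum>i\<in>T. \<Sum>i'\<in>T. x i * x i' * (\<Sum>j<n. G i j * G i' j))" .
  have "(\<Sum>i\<in>T. (x i)^2) = (\<Sum>i\<in>T. \<Sum>i'\<in>T. x i * x i' * (if i = i' then 1 else 0))"
    using fin by (simp add: power2_eq_square if_distrib[of "\<lambda>u. _ * u"] cong: if_cong)
  then have "\<bar>(\<Sum>j<n. (\<Sum>i<n. G i j * x i)^2) - (\<Sum>i<n. (x i)^2)\<bar>
     = \<bar>\<Sum>i\<in>T. \<Sum>i'\<in>T. x i * x i' * ((\<Sum>j<n. G i j * G i' j) - (if i = i' then 1 else 0))\<bar>"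
    unfolding E X by (simp add: right_diff_distrib sum_subtractf)
  also have "\<dots> \<le> (\<Sum>i\<in>T. \<Sum>i'\<in>T. \<bar>x i * x i' * ((\<Sum>j<n. G i j * G i' j) - (if i = i' then 1 else 0))\<bar>)"
    by (intro order_trans[OF sum_abs] sum_mono sum_abs)
  also have "\<dots> \<le> (\<Sum>i\<in>T. \<Sum>i'\<in>T. (if i = i' then \<epsilon> * (x i)^2 else 0) + \<delta> * (((x i)^2 + (x i')^2) / 2))"
  proof (intro sum_mono)
    fix i i' assume i: "i \<in> T" "i' \<in> T"
    have xx: "\<bar>x i * x i'\<bar> \<le> ((x i)^2 + (x i')^2) / 2"
      using sum_squares_bound[of "\<bar>x i\<bar>" "\<bar>x i'\<bar>"] by (simp add: abs_mult)
    show "\<bar>x i * x i' * ((\<Sum>j<n. G i j * G i' j) - (if i = i' then 1 else 0))\<bar>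
        \<le> (if i = i' then \<epsilon> * (x i)^2 else 0) + \<delta> * (((x i)^2 + (x i')^2) / 2)"
    proof (cases "i = i'")
      case True
      have "\<bar>(\<Sum>j<n. G i j * G i j) - 1\<bar> * (x i)^2 \<le> \<epsilon> * (x i)^2"
        using diag[OF i(1)] by (intro mult_right_mono) (auto simp: power2_eq_square)
      moreover have "0 \<le> \<delta> * (((x i)^2 + (x i')^2) / 2)" using \<delta> by simp
      ultimately show ?thesis using True by (simp add: abs_mult power2_eq_square mult.commute)
    next
      case False
      have "\<bar>x i * x i'\<bar> * \<bar>\<Sum>j<n. G i j * G i' j\<bar> \<le> (((x i)^2 + (x i')^2) / 2) * \<delta>"
        using off[OF i False] xx \<delta> by (intro mult_mono) auto
      then show ?thesis using False by (simp add: abs_mult mult.commute)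
    qed
  qed
  also have "\<dots> = \<epsilon> * (\<Sum>i\<in>T. (x i)^2) + \<delta> * (\<Sum>i\<in>T. \<Sum>i'\<in>T. ((x i)^2 + (x i')^2) / 2)"
    using fin by (simp add: sum.distrib sum_distrib_left)
  also have "(\<Sum>i\<in>T. \<Sum>i'\<in>T. ((x i)^2 + (x i')^2) / 2) = real (card T) * (\<Sum>i\<in>T. (x i)^2)"
    by (rule sum_sum_mean)
  finally show ?thesis unfolding X by (simp add: algebra_simps)
qed

lemma qform_small_support:
  assumes T: "T \<subseteq> {..<n}" and x: "\<forall>i. x i \<noteq> 0 \<longrightarrow> i \<in> T"
    and G: "\<And>i j. i < n \<Longrightarrow> j < n \<Longrightarrow> \<bar>G i j\<bar> \<le> M"
  shows "\<bar>qform n G x\<bar> \<le> real (card T) * M * (\<Sum>i<n. (x i)^2)"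
proof -
  have fin: "finite T" using T finite_subset by blast
  have X: "(\<Sum>i<n. (x i)^2) = (\<Sum>i\<in>T. (x i)^2)"
    using T x by (intro sum.mono_neutral_right) auto
  have x0: "x i = 0" if "i \<notin> T" for i using x that by blast
  have "qform n G x = (\<Sum>i\<in>T. \<Sum>j<n. G i j * x i * x j)"
    unfolding qform_def using T by (intro sum.mono_neutral_right) (auto simp: x0)
  also have "\<dots> = (\<Sum>i\<in>T. \<Sum>j\<in>T. G i j * x i * x j)"
    using T by (intro sum.cong refl sum.mono_neutral_right) (auto simp: x0)
  finally have "\<bar>qform n G x\<bar> \<le> (\<Sum>i\<in>T. \<Sum>j\<in>T. \<bar>G i j * x i * x j\<bar>)"
    by (auto intro!: order_trans[OF sum_abs] sum_mono)
  also have "\<dots> \<le> (\<Sum>i\<in>T. \<Sum>j\<in>T. M * (((x i)^2 + (x j)^2) / 2))"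
  proof (intro sum_mono)
    fix i j assume i: "i \<in> T" "j \<in> T"
    have xx: "\<bar>x i * x j\<bar> \<le> ((x i)^2 + (x j)^2) / 2"
      using sum_squares_bound[of "\<bar>x i\<bar>" "\<bar>x j\<bar>"] by (simp add: abs_mult)
    have "\<bar>G i j\<bar> \<le> M" using G i T by auto
    then have "\<bar>G i j\<bar> * \<bar>x i * x j\<bar> \<le> M * (((x i)^2 + (x j)^2) / 2)"
      using xx by (intro mult_mono) auto
    then show "\<bar>G i j * x i * x j\<bar> \<le> M * (((x i)^2 + (x j)^2) / 2)" by (simp add: abs_mult mult.assoc)
  qed
  also have "\<dots> = M * (\<Sum>i\<in>T. \<Sum>j\<in>T. ((x i)^2 + (x j)^2) / 2)"
    by (simp add: sum_distrib_left)
  also have "(\<Sum>i\<in>T. \<Sum>j\<in>T. ((x i)^2 + (x j)^2) / 2) = real (card T) * (\<Sum>i\<in>T. (x i)^2)"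
    by (rule sum_sum_mean)
  finally show ?thesis unfolding X by (simp add: algebra_simps)
qed

section \<open>Eigenvalues of the Laplacian\<close>

text \<open>The diagonal of A cancels in D_A - A and is dropped here, and consequently from
  \<open>degree_sum\<close> as well. The value 0 outside the index range makes symmetry hold for all
  indices, as the lemmas on \<open>qform\<close> require.\<close>

definition offdiag :: "real mat \<Rightarrow> nat \<Rightarrow> nat \<Rightarrow> real" where
  "offdiag A i j = (if i = j \<or> i \<ge> dim_row A \<or> j \<ge> dim_row A then 0 else A $$ (i,j))"

definition degree_sum :: "real mat \<Rightarrow> nat \<Rightarrow> real" where
  "degree_sum A i = (\<Sum>j<dim_row A. offdiag A i j)"

lemma offdiag_sym:
  assumes "A \<in> carrier_mat n n" "transpose_mat A = A"
  shows "offdiag A i j = offdiag A j i"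
proof (cases "i < n \<and> j < n")
  case True
  then have "transpose_mat A $$ (i,j) = A $$ (j,i)" using assms(1) by (intro index_transpose_mat) auto
  then show ?thesis using assms(2) by (auto simp: offdiag_def)
qed (use assms in \<open>auto simp: offdiag_def\<close>)

lemma laplacian_carrier: "A \<in> carrier_mat n n \<Longrightarrow> laplacian A \<in> carrier_mat n n"
  by (auto simp: laplacian_def)

lemma laplacian_index:
  assumes "A \<in> carrier_mat n n" "i < n" "j < n"
  shows "laplacian A $$ (i,j) = (if i = j then degree_sum A i else 0) - offdiag A i j"
proof (cases "i = j")
  case True
  have "(\<Sum>k<n. A $$ (i,k)) = (\<Sum>k<n. (if k = i then A $$ (i,i) else 0) + offdiag A i k)"
    using assms by (intro sum.cong refl) (auto simp: offdiag_def)
  also have "\<dots> = A $$ (i,i) + degree_sum A i"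
    using assms by (simp add: sum.distrib degree_sum_def)
  finally show ?thesis using assms True by (simp add: laplacian_def mat_diag_def offdiag_def)
qed (use assms in \<open>auto simp: laplacian_def mat_diag_def offdiag_def\<close>)

lemma laplacian_sym:
  assumes "A \<in> carrier_mat n n" "transpose_mat A = A"
  shows "transpose_mat (laplacian A) = laplacian A"
proof (rule eq_matI)
  fix i j assume "i < dim_row (laplacian A)" "j < dim_col (laplacian A)"
  then have ij: "i < n" "j < n" using laplacian_carrier[OF assms(1)] by auto
  then show "transpose_mat (laplacian A) $$ (i,j) = laplacian A $$ (i,j)"
    using laplacian_carrier[OF assms(1)] offdiag_sym[OF assms, of i j] by (auto simp: laplacian_index[OF assms(1)])
qed (use laplacian_carrier[OF assms(1)] in auto)

lemma quad_laplacian: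
  assumes "A \<in> carrier_mat n n"
  shows "quad n (laplacian A) v = (\<Sum>i<n. degree_sum A i * (v i)^2) - qform n (offdiag A) v"
proof -
  have "quad n (laplacian A) v = (\<Sum>i<n. \<Sum>j<n. (if i = j then degree_sum A i * (v i)^2 else 0) - offdiag A i j * v i * v j)"
    unfolding quad_def
    by (intro sum.cong refl) (simp add: laplacian_index[OF assms] left_diff_distrib power2_eq_square)
  then show ?thesis by (simp add: sum_subtractf qform_def)
qed

section \<open>Deterministic comparison of the Laplacian form with the degrees\<close>

lemma bform_eq_image: "bform n G x y = (\<Sum>j<n. (\<Sum>i<n. G i j * x i) * y j)"
  unfolding bform_def by (subst sum.swap) (simp add: sum_distrib_right)

text \<open>Split \<open>v\<close> into the part \<open>x\<close> on the large degrees and the rest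
  \<open>y\<close>. The cross term is the sum of 2 z_j y_j with z = G x; at each \<open>j\<close> it
  is completed to a square with coefficient \<mu> - g - d_j, where \<open>g\<close> pays for the
  form of \<open>y\<close>. What is left is z_j^2 divided by this gap. Off \<open>R\<close> the gap
  is at least \<gamma>, and the total of all z_j^2 is bounded by r |x|^2; on \<open>R\<close> it is
  merely at least \<beta>, but there sparsity bounds the sum of z_j^2 by \<tau>^2 |x|^2.\<close>

lemma laplacian_form_upper:
  fixes d :: "nat \<Rightarrow> real" and n :: nat and \<theta> K :: real
  defines "T \<equiv> {i. i < n \<and> \<theta> < d i}" and "R \<equiv> {i. i < n \<and> K < d i}"
  assumes sym: "\<And>i j. G i j = G j i" and K: "K \<le> \<theta>"
    and full: "\<And>v. \<bar>qform n G v\<bar> \<le> g * (\<Sum>i<n. (v i)^2)"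
    and sparse: "\<And>v. \<forall>i. v i \<noteq> 0 \<longrightarrow> i \<in> R \<Longrightarrow> \<bar>qform n G v\<bar> \<le> \<tau> * (\<Sum>i<n. (v i)^2)" and \<tau>: "\<tau> > 0"
    and rows: "\<And>x. \<forall>i. x i \<noteq> 0 \<longrightarrow> i \<in> T \<Longrightarrow> (\<Sum>j<n. (\<Sum>i<n. G i j * x i)^2) \<le> r * (\<Sum>i<n. (x i)^2)"
    and small: "\<And>x. \<forall>i. x i \<noteq> 0 \<longrightarrow> i \<in> T \<Longrightarrow> \<bar>qform n G x\<bar> \<le> \<kappa> * (\<Sum>i<n. (x i)^2)"
    and \<beta>: "\<beta> > 0" "\<beta> \<le> \<mu> - g - \<theta>" and \<gamma>: "\<gamma> > 0" "\<gamma> \<le> \<mu> - g - K"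
  shows "(\<Sum>i<n. d i * (v i)^2) - qform n G v
     \<le> (\<Sum>i<n. (if \<theta> < d i then d i + \<kappa> + r / \<gamma> + \<tau>^2 / \<beta> else \<mu>) * (v i)^2)"
proof -
  define x y where "x = (\<lambda>i. if i \<in> T then v i else 0)" and "y = (\<lambda>i. if i \<in> T then 0 else v i)"
  define z where "z = (\<lambda>j. \<Sum>i<n. G i j * x i)"
  define X where "X = (\<Sum>i<n. (x i)^2)"
  have TR: "T \<subseteq> R" "R \<subseteq> {..<n}" using K by (auto simp: T_def R_def)
  have xT: "\<forall>i. x i \<noteq> 0 \<longrightarrow> i \<in> T" by (simp add: x_def)
  then have xR: "\<forall>i. x i \<noteq> 0 \<longrightarrow> i \<in> R" using TR by blast
  have "v = (\<lambda>i. x i + y i)" by (auto simp: x_def y_def)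
  then have qv: "qform n G v = qform n G x + 2 * bform n G x y + qform n G y"
    using qform_add[of G n x y, OF sym] by simp
  have zR: "(\<Sum>j\<in>R. (z j)^2) \<le> \<tau>^2 * X"
    unfolding z_def X_def by (rule qform_bound_imp_image_bound[where G = G and U = R, OF sym \<tau> sparse xR TR(2)])
  have zn: "(\<Sum>j<n. (z j)^2) \<le> r * X" using rows[OF xT] by (simp add: z_def X_def)
  have per: "d j * (y j)^2 + g * (y j)^2 - 2 * (z j * y j) \<le> (if j \<in> R then (z j)^2 / \<beta> else 0) + (z j)^2 / \<gamma> + (if \<theta> < d j then 0 else \<mu> * (y j)^2)"
    if j: "j < n" for j
  proof (cases "\<theta> < d j")
    case True
    then have "y j = 0" using j by (simp add: y_def T_def)
    then show ?thesis using True \<beta> \<gamma> by simp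
  next
    case False
    define c where "c = \<mu> - g - d j"
    have c: "c > 0" "c \<ge> \<beta>" "j \<notin> R \<Longrightarrow> c \<ge> \<gamma>" using False \<beta> \<gamma> j by (auto simp: c_def R_def)
    have "0 \<le> (z j + c * y j)^2 / c" using c by simp
    also have "\<dots> = (z j)^2 / c + 2 * (z j * y j) + c * (y j)^2"
      using c by (simp add: power2_eq_square field_simps)
    finally have 1: "- 2 * (z j * y j) \<le> (z j)^2 / c + c * (y j)^2" by simp
    have "(z j)^2 / c \<le> (if j \<in> R then (z j)^2 / \<beta> else 0) + (z j)^2 / \<gamma>"
    proof (cases "j \<in> R")
      case True
      have "(z j)^2 / c \<le> (z j)^2 / \<beta>" using c \<beta> by (intro divide_left_mono) auto
      moreover have "(z j)^2 / \<gamma> \<ge> 0" using \<gamma> by simp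
      ultimately show ?thesis using True by simp
    next
      case False
      then show ?thesis using c \<gamma> by (auto intro!: divide_left_mono)
    qed
    moreover have "d j * (y j)^2 + g * (y j)^2 + c * (y j)^2 = \<mu> * (y j)^2" by (simp add: c_def algebra_simps)
    ultimately show ?thesis using 1 False by simp
  qed
  have "(\<Sum>j<n. d j * (y j)^2 + g * (y j)^2 - 2 * (z j * y j))
      \<le> (\<Sum>j<n. (if j \<in> R then (z j)^2 / \<beta> else 0) + (z j)^2 / \<gamma> + (if \<theta> < d j then 0 else \<mu> * (y j)^2))"
    using per by (intro sum_mono) auto
  also have "\<dots> = (\<Sum>j\<in>R. (z j)^2) / \<beta> + (\<Sum>j<n. (z j)^2) / \<gamma> + (\<Sum>j<n. if \<theta> < d j then 0 else \<mu> * (y j)^2)"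
  proof -
    have "(\<Sum>j<n. if j \<in> R then (z j)^2 / \<beta> else 0) = (\<Sum>j\<in>R. (z j)^2) / \<beta>"
      unfolding sum_divide_distrib using TR(2) by (intro sum.mono_neutral_cong_right) auto
    then show ?thesis by (simp add: sum.distrib sum_divide_distrib)
  qed
  also have "\<dots> \<le> \<tau>^2 * X / \<beta> + r * X / \<gamma> + (\<Sum>j<n. if \<theta> < d j then 0 else \<mu> * (y j)^2)"
    using zR zn \<beta> \<gamma> by (intro add_mono divide_right_mono) auto
  finally have 1: "(\<Sum>j<n. d j * (y j)^2 + g * (y j)^2 - 2 * (z j * y j))
     \<le> (r / \<gamma> + \<tau>^2 / \<beta>) * X + (\<Sum>j<n. if \<theta> < d j then 0 else \<mu> * (y j)^2)"
    by (simp add: algebra_simps)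
  have "(\<Sum>i<n. d i * (v i)^2) = (\<Sum>i<n. d i * (x i)^2) + (\<Sum>i<n. d i * (y i)^2)"
    unfolding sum.distrib[symmetric] by (intro sum.cong refl) (auto simp: x_def y_def)
  moreover have "- qform n G x \<le> \<kappa> * X" using small[OF xT] by (simp add: X_def)
  moreover have "- qform n G y \<le> (\<Sum>j<n. g * (y j)^2)" using full[of y] by (simp add: sum_distrib_left)
  moreover have "bform n G x y = (\<Sum>j<n. z j * y j)" by (simp add: bform_eq_image z_def)
  moreover have "(\<Sum>j<n. d j * (y j)^2 + g * (y j)^2 - 2 * (z j * y j))
     = (\<Sum>j<n. d j * (y j)^2) + (\<Sum>j<n. g * (y j)^2) - 2 * (\<Sum>j<n. z j * y j)"
    by (simp add: sum.distrib sum_subtractf sum_distrib_left)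
  ultimately have "(\<Sum>i<n. d i * (v i)^2) - qform n G v \<le> (\<Sum>i<n. d i * (x i)^2) + \<kappa> * X + (r / \<gamma> + \<tau>^2 / \<beta>) * X + (\<Sum>j<n. if \<theta> < d j then 0 else \<mu> * (y j)^2)"
    using 1 qv by linarith
  also have "\<dots> = (\<Sum>i<n. (if \<theta> < d i then d i + \<kappa> + r / \<gamma> + \<tau>^2 / \<beta> else \<mu>) * (v i)^2)"
    unfolding X_def sum_distrib_left sum.distrib[symmetric]
    by (intro sum.cong refl) (auto simp: x_def y_def T_def algebra_simps)
  finally show ?thesis .
qed

text \<open>The test vector is \<open>x\<close> with the first-order correction - G x / a outside
  \<open>U\<close>. With Z the sum of squares of G x outside \<open>U\<close>, the cross term gains
  2 Z / a, while norm, diagonal and form of the correction cost (K + g + t) Z / a^2; for t close to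
  \<open>a\<close> the net gain is about Z / a. Very negative d_j would make the correction
  expensive, so their coordinates are left out; large positive ones only help.\<close>

lemma laplacian_form_lower:
  fixes d :: "nat \<Rightarrow> real" and n :: nat and I :: "nat set" and K :: real
  defines "U \<equiv> I \<union> {j. j < n \<and> d j < - K}"
  assumes sym: "\<And>i j. G i j = G j i" and I: "I \<subseteq> {..<n}" and c: "\<And>i. i \<in> I \<Longrightarrow> c \<le> d i"
    and full: "\<And>v. \<bar>qform n G v\<bar> \<le> g * (\<Sum>i<n. (v i)^2)"
    and sparse: "\<And>v. \<forall>i. v i \<noteq> 0 \<longrightarrow> i \<in> U \<Longrightarrow> \<bar>qform n G v\<bar> \<le> \<tau> * (\<Sum>i<n. (v i)^2)" and \<tau>: "\<tau> > 0"
    and rows: "\<And>x. \<forall>i. x i \<noteq> 0 \<longrightarrow> i \<in> I \<Longrightarrow> r * (\<Sum>i<n. (x i)^2) \<le> (\<Sum>j<n. (\<Sum>i<n. G i j * x i)^2)"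
    and small: "\<And>x. \<forall>i. x i \<noteq> 0 \<longrightarrow> i \<in> I \<Longrightarrow> \<bar>qform n G x\<bar> \<le> \<kappa> * (\<Sum>i<n. (x i)^2)"
    and a: "a > 0" and t1: "(K + g + t) / a^2 \<le> 2 / a"
    and t2: "t - c + \<kappa> \<le> (r - \<tau>^2) * (2 / a - (K + g + t) / a^2)"
    and x: "\<forall>i. x i \<noteq> 0 \<longrightarrow> i \<in> I"
    and v: "v = (\<lambda>j. if j \<in> I then x j else if j \<in> U then 0 else - (\<Sum>i<n. G i j * x i) / a)"
  shows "t * (\<Sum>i<n. (v i)^2) \<le> (\<Sum>i<n. d i * (v i)^2) - qform n G v" "(\<Sum>i<n. (x i)^2) \<le> (\<Sum>i<n. (v i)^2)"
proof -
  define z where "z = (\<lambda>j. \<Sum>i<n. G i j * x i)"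
  define y where "y = (\<lambda>j. if j \<in> U then 0 else - z j / a)"
  define X where "X = (\<Sum>i<n. (x i)^2)"
  define Z where "Z = (\<Sum>j<n. if j \<in> U then 0 else (z j)^2)"
  have U: "U \<subseteq> {..<n}" "I \<subseteq> U" using I by (auto simp: U_def)
  have x0: "x i = 0" if "i \<notin> I" for i using x that by blast
  have xU: "\<forall>i. x i \<noteq> 0 \<longrightarrow> i \<in> U" using x U by blast
  have vxy: "v = (\<lambda>j. x j + y j)"
    unfolding v y_def z_def using U(2) by (intro ext) (auto simp: x0)
  have v2: "(v j)^2 = (x j)^2 + (y j)^2" for j
    unfolding vxy using x0[of j] U(2) by (cases "j \<in> I") (auto simp: y_def)
  have zR: "(\<Sum>j\<in>U. (z j)^2) \<le> \<tau>^2 * X"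
    unfolding z_def X_def by (rule qform_bound_imp_image_bound[where G = G and U = U, OF sym \<tau> sparse xU U(1)])
  have "(\<Sum>j<n. (z j)^2) = (\<Sum>j<n. if j \<in> U then (z j)^2 else 0) + Z"
    unfolding Z_def sum.distrib[symmetric] by (intro sum.cong) auto
  also have "(\<Sum>j<n. if j \<in> U then (z j)^2 else 0) = (\<Sum>j\<in>U. (z j)^2)"
    using U(1) by (intro sum.mono_neutral_cong_right) auto
  finally have Zge: "Z \<ge> (r - \<tau>^2) * X"
    using zR rows[OF x] by (simp add: z_def X_def algebra_simps)
  have X0: "X \<ge> 0" by (simp add: X_def sum_nonneg)
  have Y: "(\<Sum>j<n. (y j)^2) = Z / a^2"
    unfolding Z_def sum_divide_distrib by (intro sum.cong refl) (simp add: y_def power_divide)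
  have B: "bform n G x y = - Z / a"
  proof -
    have "bform n G x y = (\<Sum>j<n. z j * y j)" by (simp add: bform_eq_image z_def)
    also have "\<dots> = - Z / a"
      unfolding Z_def sum_divide_distrib sum_negf[symmetric]
      by (intro sum.cong refl) (simp add: y_def power2_eq_square)
    finally show ?thesis .
  qed
  have "(\<Sum>i<n. d i * (v i)^2) = (\<Sum>i<n. d i * (x i)^2) + (\<Sum>i<n. d i * (y i)^2)"
    by (simp add: v2 distrib_left sum.distrib)
  moreover have "c * X \<le> (\<Sum>i<n. d i * (x i)^2)"
    unfolding X_def sum_distrib_left
  proof (intro sum_mono)
    fix i show "c * (x i)^2 \<le> d i * (x i)^2"
      using c[of i] x0[of i] by (cases "i \<in> I") (auto intro!: mult_right_mono)
  qed
  moreover have "- K * (Z / a^2) \<le> (\<Sum>i<n. d i * (y i)^2)"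
    unfolding Y[symmetric] sum_distrib_left
  proof (intro sum_mono)
    fix i assume "i \<in> {..<n}"
    then show "- K * (y i)^2 \<le> d i * (y i)^2"
      using mult_right_mono[of "- K" "d i" "(y i)^2"] by (cases "i \<in> U") (auto simp: y_def U_def)
  qed
  moreover have "qform n G x \<le> \<kappa> * X" using small[OF x] by (simp add: X_def)
  moreover have "qform n G y \<le> g * (Z / a^2)" using full[of y] by (simp add: Y)
  moreover have "qform n G v = qform n G x + 2 * bform n G x y + qform n G y"
    unfolding vxy using qform_add[of G n x y, OF sym] by simp
  ultimately have 1: "(\<Sum>i<n. d i * (v i)^2) - qform n G v \<ge> c * X - K * (Z / a^2) - \<kappa> * X + 2 * (Z / a) - g * (Z / a^2)"
    using B by simp
  have "(t - c + \<kappa>) * X \<le> (r - \<tau>^2) * (2 / a - (K + g + t) / a^2) * X"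
    using t2 X0 by (rule mult_right_mono)
  also have "\<dots> = (r - \<tau>^2) * X * (2 / a - (K + g + t) / a^2)" by simp
  \<comment> \<open>By \<open>t1\<close> the bracket is nonnegative, so the lower bound for
    \<open>Z\<close> may be replaced by \<open>Z\<close> itself.\<close>
  also have "\<dots> \<le> Z * (2 / a - (K + g + t) / a^2)"
    using Zge t1 by (intro mult_right_mono) auto
  also have "\<dots> = 2 * (Z / a) - (K + g + t) * (Z / a^2)" by (simp add: right_diff_distrib mult.commute)
  finally have "t * (X + Z / a^2) \<le> c * X - K * (Z / a^2) - \<kappa> * X + 2 * (Z / a) - g * (Z / a^2)"
    by (simp add: algebra_simps add_divide_distrib)
  moreover have S: "(\<Sum>i<n. (v i)^2) = X + Z / a^2" by (simp add: v2 sum.distrib X_def Y)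
  ultimately show "t * (\<Sum>i<n. (v i)^2) \<le> (\<Sum>i<n. d i * (v i)^2) - qform n G v" using 1 by simp
  have "Z \<ge> 0" unfolding Z_def by (intro sum_nonneg) auto
  then show "(\<Sum>i<n. (x i)^2) \<le> (\<Sum>i<n. (v i)^2)" using S X_def a by simp
qed

text \<open>In the diagonal majorant, coordinates with degree at most \<theta> carry the value \<mu>
  \<le> t and never count as exceedances; the others carry their degree plus the second-order
  correction, which is moved into the threshold.\<close>

lemma laplacian_eigenvalue_upper:
  fixes A :: "real mat"
  defines "G \<equiv> offdiag A" and "d \<equiv> degree_sum A"
  assumes A: "A \<in> carrier_mat n n" "transpose_mat A = A" and K: "K \<le> \<theta>"
    and full: "\<And>v. \<bar>qform n G v\<bar> \<le> g * (\<Sum>i<n. (v i)^2)"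
    and sparse: "\<And>v. \<forall>i. v i \<noteq> 0 \<longrightarrow> i < n \<and> K < d i \<Longrightarrow> \<bar>qform n G v\<bar> \<le> \<tau> * (\<Sum>i<n. (v i)^2)" and \<tau>: "\<tau> > 0"
    and rows: "\<And>x. \<forall>i. x i \<noteq> 0 \<longrightarrow> i < n \<and> \<theta> < d i \<Longrightarrow> (\<Sum>j<n. (\<Sum>i<n. G i j * x i)^2) \<le> r * (\<Sum>i<n. (x i)^2)"
    and small: "\<And>x. \<forall>i. x i \<noteq> 0 \<longrightarrow> i < n \<and> \<theta> < d i \<Longrightarrow> \<bar>qform n G x\<bar> \<le> \<kappa> * (\<Sum>i<n. (x i)^2)"
    and \<beta>: "\<beta> > 0" "\<beta> \<le> \<mu> - g - \<theta>" and \<gamma>: "\<gamma> > 0" "\<gamma> \<le> \<mu> - g - K" and \<mu>: "\<mu> \<le> t"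
    and m: "1 \<le> m" "m \<le> n" and card: "card {i. i < n \<and> t - (\<kappa> + r / \<gamma> + \<tau>^2 / \<beta>) < d i} < m"
  shows "ordered_eigenvalue m (laplacian A) \<le> t"
proof (rule ordered_eigenvalue_le[OF laplacian_carrier[OF A(1)] laplacian_sym[OF A] m])
  have sym: "G i j = G j i" for i j unfolding G_def by (rule offdiag_sym[OF A])
  show "quad n (laplacian A) v \<le> (\<Sum>i<n. (if \<theta> < d i then d i + \<kappa> + r / \<gamma> + \<tau>^2 / \<beta> else \<mu>) * (v i)^2)" for v
    unfolding quad_laplacian[OF A(1)] G_def[symmetric] d_def[symmetric]
    by (rule laplacian_form_upper[where g = g, OF sym K full sparse \<tau> rows small \<beta> \<gamma>]) auto
  have "{k. k < n \<and> t < (if \<theta> < d k then d k + \<kappa> + r / \<gamma> + \<tau>^2 / \<beta> else \<mu>)} \<subseteq> {i. i < n \<and> t - (\<kappa> + r / \<gamma> + \<tau>^2 / \<beta>) < d i}"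
    using \<mu> by (auto split: if_splits)
  then have "card {k. k < n \<and> t < (if \<theta> < d k then d k + \<kappa> + r / \<gamma> + \<tau>^2 / \<beta> else \<mu>)} \<le> card {i. i < n \<and> t - (\<kappa> + r / \<gamma> + \<tau>^2 / \<beta>) < d i}"
    by (intro card_mono) auto
  with card show "card {k. k < n \<and> t < (if \<theta> < d k then d k + \<kappa> + r / \<gamma> + \<tau>^2 / \<beta> else \<mu>)} < m" by simp
qed

text \<open>The correction is linear in \<open>x\<close>, so a combination of the vectors
  \<open>w l\<close>, each built from a single index of \<open>I\<close>, is again a test vector of
  the required shape. It agrees with \<open>x\<close> on \<open>I\<close>, which yields linear
  independence.\<close>

lemma laplacian_eigenvalue_lower:
  fixes A :: "real mat"
  defines "G \<equiv> offdiag A" and "d \<equiv> degree_sum A"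
  assumes A: "A \<in> carrier_mat n n" "transpose_mat A = A"
    and I: "I \<subseteq> {..<n}" "card I = m" and c: "\<And>i. i \<in> I \<Longrightarrow> c \<le> d i"
    and full: "\<And>v. \<bar>qform n G v\<bar> \<le> g * (\<Sum>i<n. (v i)^2)"
    and sparse: "\<And>v. \<forall>i. v i \<noteq> 0 \<longrightarrow> i \<in> I \<union> {j. j < n \<and> d j < - K} \<Longrightarrow> \<bar>qform n G v\<bar> \<le> \<tau> * (\<Sum>i<n. (v i)^2)" and \<tau>: "\<tau> > 0"
    and rows: "\<And>x. \<forall>i. x i \<noteq> 0 \<longrightarrow> i \<in> I \<Longrightarrow> r * (\<Sum>i<n. (x i)^2) \<le> (\<Sum>j<n. (\<Sum>i<n. G i j * x i)^2)"
    and small: "\<And>x. \<forall>i. x i \<noteq> 0 \<longrightarrow> i \<in> I \<Longrightarrow> \<bar>qform n G x\<bar> \<le> \<kappa> * (\<Sum>i<n. (x i)^2)"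
    and a: "a > 0" and t1: "(K + g + t) / a^2 \<le> 2 / a"
    and t2: "t - c + \<kappa> \<le> (r - \<tau>^2) * (2 / a - (K + g + t) / a^2)"
    and m: "1 \<le> m" "m \<le> n"
  shows "t \<le> ordered_eigenvalue m (laplacian A)"
proof -
  have sym: "G i j = G j i" for i j unfolding G_def by (rule offdiag_sym[OF A])
  have "finite I" using I(1) finite_subset by blast
  then obtain f where f: "bij_betw f {..<m} I"
    using ex_bij_betw_nat_finite[of I] I(2) by (auto simp: atLeast0LessThan)
  have inj: "inj_on f {..<m}" and im: "f ` {..<m} = I" using f by (auto simp: bij_betw_def)
  define U where "U = I \<union> {j. j < n \<and> d j < - K}"
  define w where "w = (\<lambda>l j. if j \<in> I then (if j = f l then 1 else 0) else if j \<in> U then 0 else - G (f l) j / a)"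
  show ?thesis
  proof (rule ordered_eigenvalue_ge[OF laplacian_carrier[OF A(1)] laplacian_sym[OF A] m, where w = w])
    fix b :: "nat \<Rightarrow> real" assume b: "\<exists>l<m. b l \<noteq> 0"
    define x where "x = (\<lambda>j. \<Sum>l<m. if j = f l then b l else 0)"
    have xI: "\<forall>i. x i \<noteq> 0 \<longrightarrow> i \<in> I"
    proof (intro allI impI, rule ccontr)
      fix i assume "x i \<noteq> 0" "i \<notin> I"
      moreover have "x i = 0" unfolding x_def using \<open>i \<notin> I\<close> im by (intro sum.neutral) auto
      ultimately show False by simp
    qed
    have Gx: "(\<Sum>i<n. G i j * x i) = (\<Sum>l<m. b l * G (f l) j)" for j
    proof -
      have "(\<Sum>i<n. G i j * x i) = (\<Sum>l<m. \<Sum>i<n. if i = f l then b l * G i j else 0)"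
        unfolding x_def sum_distrib_left by (subst sum.swap) (intro sum.cong refl, auto)
      also have "\<dots> = (\<Sum>l<m. b l * G (f l) j)"
      proof (intro sum.cong refl)
        fix l assume "l \<in> {..<m}"
        then have "f l < n" using im I(1) by auto
        then show "(\<Sum>i<n. if i = f l then b l * G i j else 0) = b l * G (f l) j" by simp
      qed
      finally show ?thesis .
    qed
    define v where "v = (\<lambda>j. if j \<in> I then x j else if j \<in> U then 0 else - (\<Sum>i<n. G i j * x i) / a)"
    have vw: "(\<Sum>l<m. b l * w l j) = v j" for j
    proof -
      show "(\<Sum>l<m. b l * w l j) = v j"
        unfolding v_def Gx unfolding w_def x_def
        by (auto simp: sum_divide_distrib sum_negf[symmetric] intro!: sum.cong)
    qed
    note L = laplacian_form_lower[where G = G and d = d and K = K and g = g and \<tau> = \<tau> and v = v,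
        OF sym I(1) c full sparse \<tau> rows small a t1 t2 xI v_def[unfolded U_def]]
    obtain l0 where l0: "l0 < m" "b l0 \<noteq> 0" using b by blast
    have "x (f l0) = (\<Sum>l<m. if l = l0 then b l else 0)"
      unfolding x_def using inj l0 by (intro sum.cong refl) (auto simp: inj_on_def)
    then have "x (f l0) \<noteq> 0" using l0 by simp
    moreover have "f l0 < n" using l0 im I(1) by auto
    ultimately have "(\<Sum>i<n. (x i)^2) > 0" by (intro sum_pos2[of _ "f l0"]) auto
    moreover have "(\<Sum>i<n. (x i)^2) \<le> (\<Sum>i<n. (v i)^2)" by (rule L(2)) auto
    moreover have "t * (\<Sum>i<n. (v i)^2) \<le> (\<Sum>i<n. d i * (v i)^2) - qform n G v" by (rule L(1)) auto
    ultimately show "0 < (\<Sum>k<n. (\<Sum>l<m. b l * w l k)\<^sup>2) \<and>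
         t * (\<Sum>k<n. (\<Sum>l<m. b l * w l k)\<^sup>2) \<le> quad n (laplacian A) (\<lambda>k. \<Sum>l<m. b l * w l k)"
      unfolding vw quad_laplacian[OF A(1)] G_def d_def by simp
  qed
qed

section \<open>Convergence from factorial moments\<close>

text \<open>Moebius transform on the lattice of subsets; for finite \<open>S\<close> the two signs
  combine to (-1) to the power \<open>card (S - T)\<close>.\<close>

definition mobius :: "('a set \<Rightarrow> real) \<Rightarrow> 'a set \<Rightarrow> real" where
  "mobius f S = (-1) ^ card S * (\<Sum>T\<in>Pow S. (-1) ^ card T * f T)"

lemma mobius_inversion:
  assumes "finite S"
  shows "f S = (\<Sum>T\<in>Pow S. mobius f T)"
  unfolding mobius_def
  by (rule inclusion_exclusion_symmetric[of "\<lambda>S. \<Sum>T\<in>Pow S. (-1) ^ card T * f T", OF refl assms])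

lemma mobius_bound:
  assumes "finite S" and f: "\<And>T. \<bar>f T\<bar> \<le> 1"
  shows "\<bar>mobius f S\<bar> \<le> 2 ^ card S"
proof -
  have "\<bar>mobius f S\<bar> \<le> (\<Sum>T\<in>Pow S. \<bar>(-1) ^ card T * f T\<bar>)"
    unfolding mobius_def using sum_abs[of "\<lambda>T. (-1) ^ card T * f T" "Pow S"] by (simp add: abs_mult power_abs)
  also have "\<dots> \<le> (\<Sum>T\<in>Pow S. 1)"
    by (intro sum_mono) (simp add: abs_mult power_abs f)
  finally show ?thesis using assms(1) by (simp add: card_Pow)
qed

lemma mobius_cong: "(\<And>T. T \<subseteq> S \<Longrightarrow> f T = g T) \<Longrightarrow> mobius f S = mobius g S"
  unfolding mobius_def by (intro arg_cong2[where f = "(*)"] refl sum.cong) auto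

lemma mobius_bij:
  assumes h: "bij_betw h I J"
  shows "mobius f J = mobius (\<lambda>T. f (h ` T)) I"
proof -
  have inj: "inj_on h I" and J: "J = h ` I" using h by (auto simp: bij_betw_def)
  have card: "card (h ` T) = card T" if "T \<subseteq> I" for T
    using inj that by (intro card_image) (auto intro: inj_on_subset)
  have "(\<Sum>T\<in>Pow J. (-1) ^ card T * f T) = (\<Sum>T\<in>Pow I. (-1) ^ card (h ` T) * f (h ` T))"
    using bij_betw_Pow[OF h] by (rule sum.reindex_bij_betw[symmetric])
  also have "\<dots> = (\<Sum>T\<in>Pow I. (-1) ^ card T * f (h ` T))"
    by (intro sum.cong refl) (simp add: card)
  finally show ?thesis unfolding mobius_def using card[of I] J by simp
qed

text \<open>Choosing \<open>q\<close> elements and then \<open>r\<close> of these reaches every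
  r-subset at least once.\<close>

lemma binomial_le_binomial_mult:
  assumes "r \<le> q" "q \<le> z"
  shows "z choose r \<le> (z choose q) * (q choose r)"
proof -
  have "(z choose q) * (q choose r) = (z choose r) * ((z - r) choose (q - r))"
    using assms by (simp add: choose_mult)
  moreover have "(z - r) choose (q - r) \<ge> 1"
    using assms by (simp add: Suc_le_eq)
  ultimately show ?thesis by (metis mult.right_neutral mult_le_mono2)
qed

text \<open>The truncated expansion is exact when \<open>card Z \<le> R\<close>; otherwise every term is absorbed in the
  single binomial coefficient \<open>card Z choose (R + 1)\<close>, so no alternating-sign argument is needed.\<close>

lemma mobius_truncation:
  assumes Z: "finite Z" and f: "\<And>T. \<bar>f T\<bar> \<le> 1"
  shows "\<bar>f Z - (\<Sum>r\<le>R. \<Sum>J | J \<subseteq> Z \<and> card J = r. mobius f J)\<bar> \<le> 2 * 3 ^ (R + 1) * real (card Z choose (R + 1))"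
proof -
  have fin: "finite {J. J \<subseteq> Z \<and> card J = r}" for r
    by (rule finite_subset[of _ "Pow Z"]) (use Z in auto)
  show ?thesis
  proof (cases "card Z \<le> R")
    case True
    have "(\<Sum>r\<le>R. \<Sum>J | J \<subseteq> Z \<and> card J = r. mobius f J) = (\<Sum>J\<in>(\<Union>r\<in>{..R}. {J. J \<subseteq> Z \<and> card J = r}). mobius f J)"
      using fin by (intro sum.UNION_disjoint[symmetric]) auto
    also have "(\<Union>r\<in>{..R}. {J. J \<subseteq> Z \<and> card J = r}) = Pow Z"
      using True card_mono[OF Z] by (auto intro: order_trans)
    finally show ?thesis using mobius_inversion[OF Z, of f] by simp
  next
    case False
    define q where "q = R + 1"
    have q: "q \<le> card Z" using False by (simp add: q_def)
    have "\<bar>\<Sum>r\<le>R. \<Sum>J | J \<subseteq> Z \<and> card J = r. mobius f J\<bar> \<le> (\<Sum>r\<le>R. \<Sum>J | J \<subseteq> Z \<and> card J = r. \<bar>mobius f J\<bar>)"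
      by (intro order_trans[OF sum_abs] sum_mono sum_abs)
    also have "\<dots> \<le> (\<Sum>r\<le>R. \<Sum>J | J \<subseteq> Z \<and> card J = r. 2 ^ r)"
      using Z by (intro sum_mono) (auto intro!: order_trans[OF mobius_bound[OF _ f]] intro: finite_subset)
    also have "\<dots> = (\<Sum>r\<le>R. real (card Z choose r) * 2 ^ r)"
      using Z by (simp add: n_subsets)
    also have "\<dots> \<le> (\<Sum>r\<le>R. real (card Z choose q) * (real (q choose r) * 2 ^ r))"
    proof (intro sum_mono)
      fix r assume "r \<in> {..R}"
      then have "card Z choose r \<le> (card Z choose q) * (q choose r)"
        using q by (intro binomial_le_binomial_mult) (auto simp: q_def)
      then have "real (card Z choose r) \<le> real (card Z choose q) * real (q choose r)"
        by (metis of_nat_le_iff of_nat_mult)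
      then show "real (card Z choose r) * 2 ^ r \<le> real (card Z choose q) * (real (q choose r) * 2 ^ r)"
        by (simp add: mult.assoc[symmetric] mult_right_mono)
    qed
    also have "\<dots> \<le> (\<Sum>r\<le>q. real (card Z choose q) * (real (q choose r) * 2 ^ r))"
      by (intro sum_mono2) (auto simp: q_def)
    also have "\<dots> = real (card Z choose q) * (2 + 1) ^ q"
      unfolding sum_distrib_left[symmetric] by (subst binomial_ring) simp
    finally have 1: "\<bar>\<Sum>r\<le>R. \<Sum>J | J \<subseteq> Z \<and> card J = r. mobius f J\<bar> \<le> real (card Z choose q) * 3 ^ q" by simp
    have "1 \<le> card Z choose q" using q by (simp add: Suc_le_eq)
    then have "1 * 1 \<le> real (card Z choose q) * 3 ^ q"
      by (intro mult_mono) auto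
    then have "\<bar>f Z\<bar> \<le> real (card Z choose q) * 3 ^ q" using f[of Z] by simp
    with 1 show ?thesis unfolding q_def[symmetric] by (simp add: mult_ac)
  qed
qed

lemma binomial_over_power_tendsto:
  "(\<lambda>n. real (n choose r) / real n ^ r) \<longlonglongrightarrow> 1 / fact r"
proof -
  have "(\<lambda>n. (\<Prod>i<r. (real n - real i) / real n) / fact r) \<longlonglongrightarrow> (\<Prod>i<r. 1) / fact r"
  proof (intro tendsto_divide tendsto_prod tendsto_const)
    show "(\<lambda>n. (real n - real i) / real n) \<longlonglongrightarrow> 1" for i by real_asymp
  qed simp
  moreover have "(\<Prod>i<r. (real n - real i) / real n) / fact r = real (n choose r) / real n ^ r" for n
    by (simp add: binomial_gbinomial gbinomial_prod_rev prod_dividef atLeast0LessThan mult_ac)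
  ultimately show ?thesis by simp
qed

lemma binomial_over_power_le: "real (n choose r) / real n ^ r \<le> 1"
proof -
  have "n choose r \<le> n ^ r" using binomial_le_pow[of r n] by (cases "r \<le> n") (auto simp: binomial_eq_0)
  then have "real (n choose r) \<le> real n ^ r" by (metis of_nat_le_iff of_nat_power)
  then show ?thesis by (cases "n = 0"; cases "r = 0") (auto simp: divide_le_eq binomial_eq_0)
qed

section \<open>Factorial moments of labelled configurations\<close>

text \<open>This is the sum of the weight \<open>h\<close> over all r-subsets of the indices whose
  label under \<open>c\<close> lies in \<open>L\<close>. Spreading it over all labellings
  \<open>b\<close> makes it a fixed linear combination of indicators of joint label events, so that
  expectations involve only joint probabilities.\<close>

definition config_sum :: "nat \<Rightarrow> 'l set \<Rightarrow> nat \<Rightarrow> ((nat \<Rightarrow> 'l) \<Rightarrow> nat set \<Rightarrow> real) \<Rightarrow> (nat \<Rightarrow> 'l) \<Rightarrow> real" where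
  "config_sum n L r h c = (\<Sum>J | J \<subseteq> {..<n} \<and> card J = r. \<Sum>b\<in>PiE J (\<lambda>_. L). h b J * of_bool (\<forall>j\<in>J. c j = b j))"

lemma config_sum_eq:
  assumes L: "finite L"
  shows "config_sum n L r h c = (\<Sum>J | J \<subseteq> {j. j < n \<and> c j \<in> L} \<and> card J = r. h (restrict c J) J)"
proof -
  have inner: "(\<Sum>b\<in>PiE J (\<lambda>_. L). h b J * of_bool (\<forall>j\<in>J. c j = b j)) = (if c ` J \<subseteq> L then h (restrict c J) J else 0)"
    if J: "J \<subseteq> {..<n}" for J
  proof -
    have fin: "finite (PiE J (\<lambda>_. L))" using J finite_subset[of J "{..<n}"] L by (intro finite_PiE) auto
    have "(\<Sum>b\<in>PiE J (\<lambda>_. L). h b J * of_bool (\<forall>j\<in>J. c j = b j)) = (\<Sum>b\<in>PiE J (\<lambda>_. L). if b = restrict c J then h b J else 0)"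
    proof (intro sum.cong refl)
      fix b assume b: "b \<in> PiE J (\<lambda>_. L)"
      have "(\<forall>j\<in>J. c j = b j) \<longleftrightarrow> b = restrict c J"
        using b by (auto simp: fun_eq_iff PiE_def extensional_def)
      then show "h b J * of_bool (\<forall>j\<in>J. c j = b j) = (if b = restrict c J then h b J else 0)" by simp
    qed
    also have "\<dots> = (if restrict c J \<in> PiE J (\<lambda>_. L) then h (restrict c J) J else 0)"
      using fin by (simp add: sum.delta')
    also have "restrict c J \<in> PiE J (\<lambda>_. L) \<longleftrightarrow> c ` J \<subseteq> L" by (auto simp: PiE_def Pi_def)
    finally show ?thesis .
  qed
  have "config_sum n L r h c = (\<Sum>J | J \<subseteq> {..<n} \<and> card J = r. if c ` J \<subseteq> L then h (restrict c J) J else 0)"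
    unfolding config_sum_def by (intro sum.cong refl) (auto simp: inner)
  also have "\<dots> = (\<Sum>J | J \<subseteq> {j. j < n \<and> c j \<in> L} \<and> card J = r. h (restrict c J) J)"
  proof (rule sum.mono_neutral_cong_right)
    show "finite {J. J \<subseteq> {..<n} \<and> card J = r}" by (rule finite_subset[of _ "Pow {..<n}"]) auto
  qed auto
  finally show ?thesis .
qed

lemma sum_PiE_reindex:
  assumes h: "bij_betw h I J" and F: "\<And>b b'. (\<And>i. i \<in> I \<Longrightarrow> b i = b' i) \<Longrightarrow> F b = F b'"
  shows "(\<Sum>b\<in>PiE J (\<lambda>_. L). F (\<lambda>i. b (h i))) = (\<Sum>b\<in>PiE I (\<lambda>_. L). F b)"
proof (rule sum.reindex_bij_witness[where i = "\<lambda>b. restrict (\<lambda>j. b (the_inv_into I h j)) J" and j = "\<lambda>b. restrict (\<lambda>i. b (h i)) I"])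
  have inj: "inj_on h I" and J: "J = h ` I" using h by (auto simp: bij_betw_def)
  fix b assume b: "b \<in> PiE J (\<lambda>_. L)"
  show "restrict (\<lambda>i. b (h i)) I \<in> PiE I (\<lambda>_. L)" using b J by (auto simp: PiE_def)
  show "F (restrict (\<lambda>i. b (h i)) I) = F (\<lambda>i. b (h i))" by (rule F) simp
  show "restrict (\<lambda>j. restrict (\<lambda>i. b (h i)) I (the_inv_into I h j)) J = b"
  proof
    fix j
    show "restrict (\<lambda>j. restrict (\<lambda>i. b (h i)) I (the_inv_into I h j)) J j = b j"
      using b J inj by (cases "j \<in> J") (auto simp: the_inv_into_f_f PiE_def extensional_def)
  qed
next
  have inj: "inj_on h I" and J: "J = h ` I" using h by (auto simp: bij_betw_def)
  fix b assume b: "b \<in> PiE I (\<lambda>_. L)"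
  show "restrict (\<lambda>j. b (the_inv_into I h j)) J \<in> PiE J (\<lambda>_. L)"
    using b J inj by (auto simp: PiE_def the_inv_into_f_f)
  show "restrict (\<lambda>i. restrict (\<lambda>j. b (the_inv_into I h j)) J (h i)) I = b"
  proof
    fix i
    show "restrict (\<lambda>i. restrict (\<lambda>j. b (the_inv_into I h j)) J (h i)) I i = b i"
      using b J inj by (cases "i \<in> I") (auto simp: the_inv_into_f_f PiE_def extensional_def)
  qed
qed

text \<open>About n^r / r! subsets contribute, each with probability of order n^-r, which is why the
  moment hypothesis is uniform in \<open>J\<close>. The invariance assumptions on \<open>h\<close>
  make the limiting contribution the same for all \<open>J\<close>, and the factor 1 / r! is the
  limit of the binomial coefficient over n^r.\<close>

lemma expectation_config_sum_tendsto:
  fixes P :: "nat \<Rightarrow> 'a measure" and c :: "nat \<Rightarrow> 'a \<Rightarrow> nat \<Rightarrow> 'l"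
  assumes ps: "\<And>n. n \<ge> 1 \<Longrightarrow> prob_space (P n)" and L: "finite L"
    and meas: "\<And>n j b. n \<ge> 1 \<Longrightarrow> j < n \<Longrightarrow> b \<in> L \<Longrightarrow> {\<omega> \<in> space (P n). c n \<omega> j = b} \<in> sets (P n)"
    and moments: "\<And>r \<epsilon>. \<epsilon> > 0 \<Longrightarrow> eventually (\<lambda>n. \<forall>J b. J \<subseteq> {..<n} \<longrightarrow> card J = r \<longrightarrow> b \<in> PiE J (\<lambda>_. L) \<longrightarrow>
        \<bar>real n ^ r * measure (P n) {\<omega> \<in> space (P n). \<forall>j\<in>J. c n \<omega> j = b j} - (\<Prod>j\<in>J. \<tau> (b j))\<bar> \<le> \<epsilon>) sequentially"
    and hbound: "\<And>J b. finite J \<Longrightarrow> \<bar>h b J\<bar> \<le> B (card J)"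
    and hbij: "\<And>f I J b. bij_betw f I J \<Longrightarrow> finite I \<Longrightarrow> h b J = h (\<lambda>i. b (f i)) I"
    and hloc: "\<And>b b' I. (\<And>i. i \<in> I \<Longrightarrow> b i = b' i) \<Longrightarrow> h b I = h b' I"
  shows "(\<lambda>n. \<integral>\<omega>. config_sum n L r h (c n \<omega>) \<partial>P n) \<longlonglongrightarrow> (\<Sum>b\<in>PiE {..<r} (\<lambda>_. L). h b {..<r} * (\<Prod>j<r. \<tau> (b j))) / fact r"
    and "n \<ge> 1 \<Longrightarrow> integrable (P n) (\<lambda>\<omega>. config_sum n L r h (c n \<omega>))"
proof -
  define Ev where "Ev = (\<lambda>n J b. {\<omega> \<in> space (P n). \<forall>j\<in>J. c n \<omega> j = b j})"
  define Js where "Js = (\<lambda>n. {J. J \<subseteq> {..<n::nat} \<and> card J = r})"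
  have finJs: "finite (Js n)" for n unfolding Js_def by (rule finite_subset[of _ "Pow {..<n}"]) auto
  have finJ: "finite J" if "J \<in> Js n" for J n using that finite_subset[of J "{..<n}"] by (auto simp: Js_def)
  have Evm: "Ev n J b \<in> sets (P n)" if n: "n \<ge> 1" and J: "J \<in> Js n" and b: "b \<in> PiE J (\<lambda>_. L)" for n J b
  proof -
    interpret prob_space "P n" by (rule ps[OF n])
    show ?thesis unfolding Ev_def
      by (rule sets.sets_Collect_finite_All) (use finJ[OF J] meas[OF n] J b in \<open>auto simp: Js_def PiE_def Pi_def\<close>)
  qed
  have cs: "config_sum n L r h (c n \<omega>) = (\<Sum>J\<in>Js n. \<Sum>b\<in>PiE J (\<lambda>_. L). h b J * indicator (Ev n J b) \<omega>)"
    if "\<omega> \<in> space (P n)" for n \<omega>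
    unfolding config_sum_def Js_def using that by (intro sum.cong refl) (auto simp: Ev_def indicator_def)
  have int1: "integrable (P n) (\<lambda>\<omega>. \<Sum>J\<in>Js n. \<Sum>b\<in>PiE J (\<lambda>_. L). h b J * indicator (Ev n J b) \<omega>)" if n: "n \<ge> 1" for n
  proof -
    interpret prob_space "P n" by (rule ps[OF n])
    show ?thesis
      by (intro Bochner_Integration.integrable_sum integrable_mult_right integrable_real_indicator) (auto simp: Evm[OF n] less_top[symmetric])
  qed
  then show "integrable (P n) (\<lambda>\<omega>. config_sum n L r h (c n \<omega>))" if "n \<ge> 1"
    using that by (subst Bochner_Integration.integrable_cong[OF refl cs]) auto
  have E: "(\<integral>\<omega>. config_sum n L r h (c n \<omega>) \<partial>P n) = (\<Sum>J\<in>Js n. \<Sum>b\<in>PiE J (\<lambda>_. L). h b J * measure (P n) (Ev n J b))"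
    if n: "n \<ge> 1" for n
  proof -
    interpret prob_space "P n" by (rule ps[OF n])
    have "(\<integral>\<omega>. config_sum n L r h (c n \<omega>) \<partial>P n) = (\<integral>\<omega>. (\<Sum>J\<in>Js n. \<Sum>b\<in>PiE J (\<lambda>_. L). h b J * indicator (Ev n J b) \<omega>) \<partial>P n)"
      by (rule Bochner_Integration.integral_cong[OF refl cs])
    also have "\<dots> = (\<Sum>J\<in>Js n. \<integral>\<omega>. (\<Sum>b\<in>PiE J (\<lambda>_. L). h b J * indicator (Ev n J b) \<omega>) \<partial>P n)"
      by (intro Bochner_Integration.integral_sum Bochner_Integration.integrable_sum integrable_mult_right integrable_real_indicator)
        (auto simp: Evm[OF n] less_top[symmetric])
    also have "\<dots> = (\<Sum>J\<in>Js n. \<Sum>b\<in>PiE J (\<lambda>_. L). \<integral>\<omega>. h b J * indicator (Ev n J b) \<omega> \<partial>P n)"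
      by (intro sum.cong refl Bochner_Integration.integral_sum integrable_mult_right integrable_real_indicator)
        (auto simp: Evm[OF n] less_top[symmetric])
    also have "\<dots> = (\<Sum>J\<in>Js n. \<Sum>b\<in>PiE J (\<lambda>_. L). h b J * measure (P n) (Ev n J b))"
      by (intro sum.cong refl) (simp add: Evm[OF n] sets.Int_space_eq2)
    finally show ?thesis .
  qed
  define G where "G = (\<Sum>b\<in>PiE {..<r} (\<lambda>_. L). h b {..<r} * (\<Prod>j<r. \<tau> (b j)))"
  have GJ: "(\<Sum>b\<in>PiE J (\<lambda>_. L). h b J * (\<Prod>j\<in>J. \<tau> (b j))) = G" if J: "J \<in> Js n" for J n
  proof -
    obtain f where f: "bij_betw f {..<r} J"
      using ex_bij_betw_nat_finite[OF finJ[OF J]] J by (auto simp: atLeast0LessThan Js_def)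
    have "(\<Sum>b\<in>PiE J (\<lambda>_. L). h b J * (\<Prod>j\<in>J. \<tau> (b j))) = (\<Sum>b\<in>PiE J (\<lambda>_. L). h (\<lambda>i. b (f i)) {..<r} * (\<Prod>i<r. \<tau> (b (f i))))"
      using f by (intro sum.cong refl arg_cong2[where f = "(*)"] hbij prod.reindex_bij_betw[symmetric]) auto
    also have "\<dots> = G" unfolding G_def
    proof (rule sum_PiE_reindex[OF f, of "\<lambda>b. h b {..<r} * (\<Prod>j<r. \<tau> (b j))"])
      fix b b' :: "nat \<Rightarrow> 'l" assume bb: "\<And>i. i \<in> {..<r} \<Longrightarrow> b i = b' i"
      then show "h b {..<r} * (\<Prod>j<r. \<tau> (b j)) = h b' {..<r} * (\<Prod>j<r. \<tau> (b' j))"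
        using hloc[of "{..<r}" b b'] by simp
    qed
    finally show ?thesis .
  qed
  define C where "C = real (card L ^ r) * (\<bar>B r\<bar> + 1)"
  have C0: "C \<ge> 0" by (simp add: C_def)
  have cardPi: "card (PiE J (\<lambda>_. L)) = card L ^ r" if J: "J \<in> Js n" for J n
    using finJ[OF J] J by (subst card_PiE) (auto simp: Js_def)
  have close: "eventually (\<lambda>n. \<bar>(\<integral>\<omega>. config_sum n L r h (c n \<omega>) \<partial>P n) - real (n choose r) / real n ^ r * G\<bar> \<le> C * \<epsilon>) sequentially"
    if \<epsilon>: "\<epsilon> > 0" for \<epsilon>
    using moments[OF \<epsilon>, of r] eventually_ge_at_top[of 1]
  proof eventually_elim
    case (elim n)
    have np: "real n ^ r > 0" using elim(2) by simp
    have "real (n choose r) * G = (\<Sum>J\<in>Js n. G)" by (simp add: Js_def n_subsets)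
    also have "\<dots> = (\<Sum>J\<in>Js n. \<Sum>b\<in>PiE J (\<lambda>_. L). h b J * (\<Prod>j\<in>J. \<tau> (b j)))"
      by (intro sum.cong refl) (simp add: GJ)
    finally have "(\<integral>\<omega>. config_sum n L r h (c n \<omega>) \<partial>P n) - real (n choose r) / real n ^ r * G
      = (\<Sum>J\<in>Js n. \<Sum>b\<in>PiE J (\<lambda>_. L). h b J * (measure (P n) (Ev n J b) - (\<Prod>j\<in>J. \<tau> (b j)) / real n ^ r))"
      unfolding E[OF elim(2)]
      by (simp add: right_diff_distrib sum_subtractf sum_divide_distrib[symmetric])
    also have "\<bar>\<dots>\<bar> \<le> (\<Sum>J\<in>Js n. \<Sum>b\<in>PiE J (\<lambda>_. L). \<bar>h b J * (measure (P n) (Ev n J b) - (\<Prod>j\<in>J. \<tau> (b j)) / real n ^ r)\<bar>)"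
      by (intro order_trans[OF sum_abs] sum_mono sum_abs)
    also have "\<dots> \<le> (\<Sum>J\<in>Js n. \<Sum>b\<in>PiE J (\<lambda>_. L). (\<bar>B r\<bar> + 1) * (\<epsilon> / real n ^ r))"
    proof (intro sum_mono)
      fix J b assume J: "J \<in> Js n" and b: "b \<in> PiE J (\<lambda>_. L)"
      have "\<bar>real n ^ r * measure (P n) (Ev n J b) - (\<Prod>j\<in>J. \<tau> (b j))\<bar> \<le> \<epsilon>"
        using elim(1) J b by (auto simp: Js_def Ev_def)
      then have "\<bar>(real n ^ r * measure (P n) (Ev n J b) - (\<Prod>j\<in>J. \<tau> (b j))) / real n ^ r\<bar> \<le> \<epsilon> / real n ^ r"
        using np by (simp add: abs_divide divide_right_mono)
      moreover have "(real n ^ r * measure (P n) (Ev n J b) - (\<Prod>j\<in>J. \<tau> (b j))) / real n ^ r = measure (P n) (Ev n J b) - (\<Prod>j\<in>J. \<tau> (b j)) / real n ^ r"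
        using np by (simp add: diff_divide_distrib)
      ultimately have 1: "\<bar>measure (P n) (Ev n J b) - (\<Prod>j\<in>J. \<tau> (b j)) / real n ^ r\<bar> \<le> \<epsilon> / real n ^ r" by simp
      have "\<bar>h b J\<bar> \<le> \<bar>B r\<bar> + 1" using hbound[OF finJ[OF J], of b] J by (auto simp: Js_def)
      then show "\<bar>h b J * (measure (P n) (Ev n J b) - (\<Prod>j\<in>J. \<tau> (b j)) / real n ^ r)\<bar> \<le> (\<bar>B r\<bar> + 1) * (\<epsilon> / real n ^ r)"
        unfolding abs_mult using 1 by (intro mult_mono) auto
    qed
    also have "\<dots> = (\<Sum>J\<in>Js n. C * (\<epsilon> / real n ^ r))"
      by (intro sum.cong refl) (simp add: cardPi C_def)
    also have "\<dots> = real (n choose r) / real n ^ r * (C * \<epsilon>)"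
      by (simp add: Js_def n_subsets)
    also have "\<dots> \<le> 1 * (C * \<epsilon>)"
      using C0 \<epsilon> by (intro mult_right_mono binomial_over_power_le) auto
    finally show ?case by simp
  qed
  have diff0: "(\<lambda>n. (\<integral>\<omega>. config_sum n L r h (c n \<omega>) \<partial>P n) - real (n choose r) / real n ^ r * G) \<longlonglongrightarrow> 0"
  proof (rule tendstoI)
    fix e :: real assume e: "e > 0"
    have "eventually (\<lambda>n. \<bar>(\<integral>\<omega>. config_sum n L r h (c n \<omega>) \<partial>P n) - real (n choose r) / real n ^ r * G\<bar> \<le> C * (e / (C + 1))) sequentially"
      using e C0 by (intro close) auto
    then show "eventually (\<lambda>n. dist ((\<integral>\<omega>. config_sum n L r h (c n \<omega>) \<partial>P n) - real (n choose r) / real n ^ r * G) 0 < e) sequentially"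
    proof eventually_elim
      case (elim n)
      have "C * (e / (C + 1)) < e" using e C0 by (simp add: field_simps)
      then show ?case using elim by simp
    qed
  qed
  have "(\<lambda>n. real (n choose r) / real n ^ r * G) \<longlonglongrightarrow> 1 / fact r * G"
    by (intro tendsto_mult binomial_over_power_tendsto tendsto_const)
  from tendsto_add[OF diff0 this] show "(\<lambda>n. \<integral>\<omega>. config_sum n L r h (c n \<omega>) \<partial>P n) \<longlonglongrightarrow> (\<Sum>b\<in>PiE {..<r} (\<lambda>_. L). h b {..<r} * (\<Prod>j<r. \<tau> (b j))) / fact r"
    by (simp add: G_def)
qed

text \<open>A method of moments that constructs no limiting process: the indicator of
  \<open>H\<close> is expanded over subsets by Moebius inversion and truncated at order
  \<open>R\<close>. For fixed \<open>R\<close> the expectations converge. The truncation error is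
  controlled by the factorial moment of order R + 1, whose limit, up to the factorial, is the power
  R + 1 of the total weight; the factorial beats the factor 3^(R+1).\<close>

theorem factorial_moment_convergence:
  fixes P :: "nat \<Rightarrow> 'a measure" and c :: "nat \<Rightarrow> 'a \<Rightarrow> nat \<Rightarrow> 'l" and H :: "(nat \<Rightarrow> 'l) \<Rightarrow> nat set \<Rightarrow> bool"
  assumes ps: "\<And>n. n \<ge> 1 \<Longrightarrow> prob_space (P n)" and L: "finite L"
    and meas: "\<And>n j b. n \<ge> 1 \<Longrightarrow> j < n \<Longrightarrow> b \<in> L \<Longrightarrow> {\<omega> \<in> space (P n). c n \<omega> j = b} \<in> sets (P n)"
    and moments: "\<And>r \<epsilon>. \<epsilon> > 0 \<Longrightarrow> eventually (\<lambda>n. \<forall>J b. J \<subseteq> {..<n} \<longrightarrow> card J = r \<longrightarrow> b \<in> PiE J (\<lambda>_. L) \<longrightarrow>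
        \<bar>real n ^ r * measure (P n) {\<omega> \<in> space (P n). \<forall>j\<in>J. c n \<omega> j = b j} - (\<Prod>j\<in>J. \<tau> (b j))\<bar> \<le> \<epsilon>) sequentially"
    and \<tau>: "\<And>b. b \<in> L \<Longrightarrow> \<tau> b \<ge> 0"
    and Hbij: "\<And>f I J b. bij_betw f I J \<Longrightarrow> finite I \<Longrightarrow> H b J \<longleftrightarrow> H (\<lambda>i. b (f i)) I"
    and Hloc: "\<And>b b' I. (\<And>i. i \<in> I \<Longrightarrow> b i = b' i) \<Longrightarrow> H b I \<longleftrightarrow> H b' I"
    and Hmeas: "\<And>n. n \<ge> 1 \<Longrightarrow> {\<omega> \<in> space (P n). H (c n \<omega>) {j. j < n \<and> c n \<omega> j \<in> L}} \<in> sets (P n)"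
  shows "(\<lambda>n. measure (P n) {\<omega> \<in> space (P n). H (c n \<omega>) {j. j < n \<and> c n \<omega> j \<in> L}}) \<longlonglongrightarrow>
     (\<Sum>r. (\<Sum>b\<in>PiE {..<r} (\<lambda>_. L). mobius (\<lambda>K. of_bool (H b K)) {..<r} * (\<Prod>j<r. \<tau> (b j))) / fact r)"
proof -
  define g where "g = (\<lambda>b. mobius (\<lambda>K. of_bool (H b K)))"
  have gb: "\<bar>g b J\<bar> \<le> 2 ^ card J" if "finite J" for b J
    unfolding g_def by (rule mobius_bound[OF that]) auto
  have gloc: "g b I = g b' I" if "\<And>i. i \<in> I \<Longrightarrow> b i = b' i" for b b' I
    unfolding g_def using that by (intro mobius_cong arg_cong[of _ _ of_bool] Hloc) auto
  have gbij: "g b J = g (\<lambda>i. b (f i)) I" if f: "bij_betw f I J" and I: "finite I" for f I J b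
    unfolding g_def mobius_bij[OF f]
  proof (intro mobius_cong arg_cong[of _ _ of_bool])
    fix T assume T: "T \<subseteq> I"
    have "bij_betw f T (f ` T)" using f T by (auto simp: bij_betw_def intro: inj_on_subset)
    then show "H b (f ` T) \<longleftrightarrow> H (\<lambda>i. b (f i)) T" using Hbij finite_subset[OF T I] by blast
  qed
  define T where "T = sum \<tau> L"
  have T0: "T \<ge> 0" unfolding T_def by (intro sum_nonneg \<tau>)
  define S where "S = (\<lambda>r. (\<Sum>b\<in>PiE {..<r} (\<lambda>_. L). g b {..<r} * (\<Prod>j<r. \<tau> (b j))) / fact r)"
  have prodT: "(\<Sum>b\<in>PiE {..<r} (\<lambda>_. L). (\<Prod>j<r. \<tau> (b j))) = T ^ r" for r
    unfolding T_def using prod_sum_PiE[of "{..<r}" "\<lambda>_. L" "\<lambda>_ l. \<tau> l"] L by simp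
  have Sb: "\<bar>S r\<bar> \<le> (2 * T) ^ r / fact r" for r
  proof -
    have "\<bar>\<Sum>b\<in>PiE {..<r} (\<lambda>_. L). g b {..<r} * (\<Prod>j<r. \<tau> (b j))\<bar> \<le> (\<Sum>b\<in>PiE {..<r} (\<lambda>_. L). 2 ^ r * (\<Prod>j<r. \<tau> (b j)))"
    proof (rule order_trans[OF sum_abs], intro sum_mono)
      fix b assume b: "b \<in> PiE {..<r} (\<lambda>_. L)"
      have "(\<Prod>j<r. \<tau> (b j)) \<ge> 0" using b by (intro prod_nonneg) (auto intro!: \<tau>)
      then show "\<bar>g b {..<r} * (\<Prod>j<r. \<tau> (b j))\<bar> \<le> 2 ^ r * (\<Prod>j<r. \<tau> (b j))"
        using gb[of "{..<r}" b] by (simp add: abs_mult mult_right_mono)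
    qed
    also have "\<dots> = (2 * T) ^ r" by (simp add: sum_distrib_left[symmetric] prodT power_mult_distrib)
    finally show ?thesis unfolding S_def by (simp add: divide_right_mono)
  qed
  have expsum: "summable (\<lambda>r. y ^ r / fact r)" for y :: real
    using summable_exp[of y] by (simp add: divide_inverse mult.commute)
  have Ssum: "summable S" by (rule summable_comparison_test'[OF expsum[of "2 * T"], of 0]) (simp only: real_norm_def Sb)
  define p where "p = (\<lambda>n. measure (P n) {\<omega> \<in> space (P n). H (c n \<omega>) {j. j < n \<and> c n \<omega> j \<in> L}})"
  define E where "E = (\<lambda>n r. \<integral>\<omega>. config_sum n L r g (c n \<omega>) \<partial>P n)"
  \<comment> \<open>With unit weight the configuration sum is a binomial coefficient of the number
    of labelled indices, so \<open>E1 n r\<close> is its factorial moment of order \<open>r\<close>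
    divided by r!.\<close>
  define E1 where "E1 = (\<lambda>n r. \<integral>\<omega>. config_sum n L r (\<lambda>_ _. 1) (c n \<omega>) \<partial>P n)"
  have Elim: "(\<lambda>n. E n r) \<longlonglongrightarrow> S r" for r
    unfolding E_def S_def
    by (rule expectation_config_sum_tendsto(1)[where P = P and L = L and c = c and \<tau> = \<tau> and h = g and B = "\<lambda>k. 2 ^ k", OF ps L meas moments gb gbij gloc]) auto
  have Eint: "integrable (P n) (\<lambda>\<omega>. config_sum n L r g (c n \<omega>))" if "n \<ge> 1" for n r
    by (rule expectation_config_sum_tendsto(2)[where P = P and L = L and c = c and \<tau> = \<tau> and h = g and B = "\<lambda>k. 2 ^ k", OF ps L meas moments gb gbij gloc]) (use that in auto)
  have E1lim: "(\<lambda>n. E1 n r) \<longlonglongrightarrow> T ^ r / fact r" for r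
    unfolding E1_def prodT[symmetric]
    using expectation_config_sum_tendsto(1)[where P = P and L = L and c = c and \<tau> = \<tau> and h = "\<lambda>_ _. 1" and B = "\<lambda>_. 1" and r = r, OF ps L meas moments] by simp
  have E1int: "integrable (P n) (\<lambda>\<omega>. config_sum n L r (\<lambda>_ _. 1) (c n \<omega>))" if "n \<ge> 1" for n r
    using expectation_config_sum_tendsto(2)[where P = P and L = L and c = c and \<tau> = \<tau> and h = "\<lambda>_ _. 1" and B = "\<lambda>_. 1" and r = r and n = n, OF ps L meas moments] that by simp
  have trunc: "\<bar>p n - (\<Sum>r\<le>R. E n r)\<bar> \<le> 2 * 3 ^ (R + 1) * E1 n (R + 1)" if n: "n \<ge> 1" for n R
  proof -
    interpret prob_space "P n" by (rule ps[OF n])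
    define V where "V = {\<omega> \<in> space (P n). H (c n \<omega>) {j. j < n \<and> c n \<omega> j \<in> L}}"
    have V: "V \<in> sets (P n)" unfolding V_def by (rule Hmeas[OF n])
    have pV: "p n = (\<integral>\<omega>. indicator V \<omega> \<partial>P n)" using V by (simp add: p_def V_def[symmetric])
    have sumint: "(\<Sum>r\<le>R. E n r) = (\<integral>\<omega>. (\<Sum>r\<le>R. config_sum n L r g (c n \<omega>)) \<partial>P n)"
      unfolding E_def using Eint[OF n] by (intro Bochner_Integration.integral_sum[symmetric])
    have iV: "integrable (P n) (indicator V :: _ \<Rightarrow> real)" using V by (simp add: less_top[symmetric])
    have iS: "integrable (P n) (\<lambda>\<omega>. (\<Sum>r\<le>R. config_sum n L r g (c n \<omega>)))"
      using Eint[OF n] by (intro Bochner_Integration.integrable_sum)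
    have "p n - (\<Sum>r\<le>R. E n r) = (\<integral>\<omega>. indicator V \<omega> - (\<Sum>r\<le>R. config_sum n L r g (c n \<omega>)) \<partial>P n)"
      unfolding pV sumint by (rule Bochner_Integration.integral_diff[symmetric, OF iV iS])
    also have "\<bar>\<dots>\<bar> \<le> (\<integral>\<omega>. \<bar>indicator V \<omega> - (\<Sum>r\<le>R. config_sum n L r g (c n \<omega>))\<bar> \<partial>P n)"
      by (rule integral_abs_bound)
    also have "\<dots> \<le> (\<integral>\<omega>. 2 * 3 ^ (R + 1) * config_sum n L (R + 1) (\<lambda>_ _. 1) (c n \<omega>) \<partial>P n)"
    proof (rule integral_mono)
      show "integrable (P n) (\<lambda>\<omega>. \<bar>indicator V \<omega> - (\<Sum>r\<le>R. config_sum n L r g (c n \<omega>))\<bar>)"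
        by (intro integrable_abs Bochner_Integration.integrable_diff iV iS)
      show "integrable (P n) (\<lambda>\<omega>. 2 * 3 ^ (R + 1) * config_sum n L (R + 1) (\<lambda>_ _. 1) (c n \<omega>))"
        using E1int[OF n] by (intro integrable_mult_right)
      fix \<omega> assume w: "\<omega> \<in> space (P n)"
      define Z where "Z = {j. j < n \<and> c n \<omega> j \<in> L}"
      have Z: "finite Z" by (simp add: Z_def)
      have 1: "indicator V \<omega> = (of_bool (H (c n \<omega>) Z) :: real)" using w by (simp add: V_def Z_def)
      have 2: "(\<Sum>r\<le>R. config_sum n L r g (c n \<omega>)) = (\<Sum>r\<le>R. \<Sum>J | J \<subseteq> Z \<and> card J = r. mobius (\<lambda>K. of_bool (H (c n \<omega>) K)) J)"
        unfolding config_sum_eq[OF L] Z_def[symmetric]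
        by (intro sum.cong refl, subst gloc[of _ _ "c n \<omega>"], simp, simp add: g_def)
      have 3: "config_sum n L (R + 1) (\<lambda>_ _. 1) (c n \<omega>) = real (card Z choose (R + 1))"
        unfolding config_sum_eq[OF L] Z_def[symmetric] using n_subsets[OF Z, of "R + 1"] by simp
      show "\<bar>indicator V \<omega> - (\<Sum>r\<le>R. config_sum n L r g (c n \<omega>))\<bar> \<le> 2 * 3 ^ (R + 1) * config_sum n L (R + 1) (\<lambda>_ _. 1) (c n \<omega>)"
        unfolding 1 2 3 by (rule mobius_truncation[OF Z]) auto
    qed
    also have "\<dots> = 2 * 3 ^ (R + 1) * E1 n (R + 1)" unfolding E1_def by simp
    finally show ?thesis .
  qed
  have "p \<longlonglongrightarrow> suminf S"
  proof (rule tendstoI)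
    fix e :: real assume e: "e > 0"
    \<comment> \<open>The order of truncation is fixed by means of the limiting error, before
      \<open>n\<close> grows.\<close>
    have "(\<lambda>R. 2 * ((3 * T) ^ (R + 1) / fact (R + 1))) \<longlonglongrightarrow> 2 * 0"
      by (intro tendsto_mult tendsto_const LIMSEQ_Suc[unfolded Suc_eq_plus1] summable_LIMSEQ_zero expsum)
    then have "eventually (\<lambda>R. 2 * ((3 * T) ^ (R + 1) / fact (R + 1)) < e / 3) sequentially"
      using e by (auto dest!: order_tendstoD(2)[where a = "e / 3"])
    moreover have "eventually (\<lambda>R. dist (\<Sum>r\<le>R. S r) (suminf S) < e / 3) sequentially"
      using summable_LIMSEQ'[OF Ssum] e by (auto dest!: tendstoD[where e = "e / 3"])
    ultimately have "eventually (\<lambda>R. 2 * ((3 * T) ^ (R + 1) / fact (R + 1)) < e / 3 \<and> dist (\<Sum>r\<le>R. S r) (suminf S) < e / 3) sequentially"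
      by (rule eventually_conj)
    from eventually_happens'[OF sequentially_bot this]
    obtain R where R: "2 * ((3 * T) ^ (R + 1) / fact (R + 1)) < e / 3" "dist (\<Sum>r\<le>R. S r) (suminf S) < e / 3"
      by blast
    have "(\<lambda>n. 2 * 3 ^ (R + 1) * E1 n (R + 1)) \<longlonglongrightarrow> 2 * 3 ^ (R + 1) * (T ^ (R + 1) / fact (R + 1))"
      by (intro tendsto_mult tendsto_const E1lim)
    then have ev1: "eventually (\<lambda>n. 2 * 3 ^ (R + 1) * E1 n (R + 1) < e / 3) sequentially"
      by (rule order_tendstoD(2)) (use R(1) in \<open>simp add: power_mult_distrib mult_ac\<close>)
    have "(\<lambda>n. \<Sum>r\<le>R. E n r) \<longlonglongrightarrow> (\<Sum>r\<le>R. S r)" by (intro tendsto_sum Elim)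
    then have ev2: "eventually (\<lambda>n. dist (\<Sum>r\<le>R. E n r) (\<Sum>r\<le>R. S r) < e / 3) sequentially"
      using e by (intro tendstoD) auto
    show "eventually (\<lambda>n. dist (p n) (suminf S) < e) sequentially"
      using ev1 ev2 eventually_ge_at_top[of 1]
    proof eventually_elim
      case (elim n)
      show ?case using trunc[OF elim(3), of R] elim R(2) unfolding dist_real_def by linarith
    qed
  qed
  then show ?thesis unfolding p_def S_def g_def .
qed

section \<open>Gaussian concentration\<close>

lemma (in prob_space) exponential_markov:
  assumes "integrable M (\<lambda>\<omega>. exp (f \<omega>))" "expectation (\<lambda>\<omega>. exp (f \<omega>)) \<le> exp B"
  shows "prob {\<omega> \<in> space M. t \<le> f \<omega>} \<le> exp (B - t)"
proof -
  have "prob {\<omega> \<in> space M. exp (f \<omega>) \<ge> exp t} \<le> expectation (\<lambda>\<omega>. exp (f \<omega>)) / exp t"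
    by (rule integral_Markov_inequality_measure[OF assms(1), where A = "{}"]) auto
  also have "\<dots> \<le> exp B / exp t" using assms(2) by (intro divide_right_mono) auto
  finally show ?thesis by (simp add: exp_diff)
qed

text \<open>Exponential tilting: multiplying a Gaussian density by an exponential shifts its mean,
  up to a constant that is the value of the transform.\<close>

lemma (in prob_space) normal_mgf:
  assumes \<sigma>: "\<sigma> > 0" and X: "distributed M lborel X (normal_density 0 \<sigma>)"
  shows "integrable M (\<lambda>\<omega>. exp (c * X \<omega>))" "expectation (\<lambda>\<omega>. exp (c * X \<omega>)) = exp (c\<^sup>2 * \<sigma>\<^sup>2 / 2)"
proof -
  have eq: "normal_density 0 \<sigma> x * exp (c * x) = exp (c\<^sup>2 * \<sigma>\<^sup>2 / 2) * normal_density (c * \<sigma>\<^sup>2) \<sigma> x" for x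
  proof -
    have "- (x - 0)\<^sup>2 / (2 * \<sigma>\<^sup>2) + c * x = c\<^sup>2 * \<sigma>\<^sup>2 / 2 + - (x - c * \<sigma>\<^sup>2)\<^sup>2 / (2 * \<sigma>\<^sup>2)"
      using \<sigma> by (simp add: field_simps power2_eq_square)
    then have "exp (- (x - 0)\<^sup>2 / (2 * \<sigma>\<^sup>2)) * exp (c * x) = exp (c\<^sup>2 * \<sigma>\<^sup>2 / 2) * exp (- (x - c * \<sigma>\<^sup>2)\<^sup>2 / (2 * \<sigma>\<^sup>2))"
      by (simp only: exp_add[symmetric])
    then show ?thesis unfolding normal_density_def by simp
  qed
  have int: "integrable lborel (\<lambda>x. normal_density 0 \<sigma> x * exp (c * x))"
    unfolding eq using \<sigma> by simp
  show "integrable M (\<lambda>\<omega>. exp (c * X \<omega>))"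
    using distributed_integrable[OF X, of "\<lambda>x. exp (c * x)"] int by simp
  have "expectation (\<lambda>\<omega>. exp (c * X \<omega>)) = (\<integral>x. normal_density 0 \<sigma> x * exp (c * x) \<partial>lborel)"
    using distributed_integral[OF X, of "\<lambda>x. exp (c * x)"] by simp
  also have "\<dots> = exp (c\<^sup>2 * \<sigma>\<^sup>2 / 2)" unfolding eq using \<sigma> by simp
  finally show "expectation (\<lambda>\<omega>. exp (c * X \<omega>)) = exp (c\<^sup>2 * \<sigma>\<^sup>2 / 2)" .
qed

lemma (in prob_space) indep_exp_sum:
  fixes X :: "'b \<Rightarrow> 'a \<Rightarrow> real" and f :: "'b \<Rightarrow> real \<Rightarrow> real"
  assumes "finite I" and ind: "indep_vars (\<lambda>_. borel) X I"
    and int: "\<And>i. i \<in> I \<Longrightarrow> integrable M (\<lambda>\<omega>. exp (f i (X i \<omega>)))" and f: "\<And>i. f i \<in> borel_measurable borel"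
  shows "integrable M (\<lambda>\<omega>. exp (\<Sum>i\<in>I. f i (X i \<omega>)))"
    "expectation (\<lambda>\<omega>. exp (\<Sum>i\<in>I. f i (X i \<omega>))) = (\<Prod>i\<in>I. expectation (\<lambda>\<omega>. exp (f i (X i \<omega>))))"
proof -
  have ind': "indep_vars (\<lambda>_. borel) (\<lambda>i \<omega>. exp (f i (X i \<omega>))) I"
    using f by (intro indep_vars_compose2[OF ind]) measurable
  show "integrable M (\<lambda>\<omega>. exp (\<Sum>i\<in>I. f i (X i \<omega>)))"
    using indep_vars_integrable[where X = "\<lambda>i \<omega>. exp (f i (X i \<omega>))", OF assms(1) ind' int] assms(1) by (simp add: exp_sum)
  show "expectation (\<lambda>\<omega>. exp (\<Sum>i\<in>I. f i (X i \<omega>))) = (\<Prod>i\<in>I. expectation (\<lambda>\<omega>. exp (f i (X i \<omega>))))"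
    using indep_vars_lebesgue_integral[where X = "\<lambda>i \<omega>. exp (f i (X i \<omega>))", OF assms(1) ind' int] assms(1) by (simp add: exp_sum)
qed

text \<open>Chernoff's bound at the optimal parameter t / V. An upper bound \<open>V\<close> for the
  variance is enough, so callers may round it.\<close>

lemma (in prob_space) gaussian_sum_tail:
  assumes I: "finite I" and ind: "indep_vars (\<lambda>_. borel) X I"
    and \<sigma>: "\<And>i. i \<in> I \<Longrightarrow> \<sigma> i > 0" and X: "\<And>i. i \<in> I \<Longrightarrow> distributed M lborel (X i) (normal_density 0 (\<sigma> i))"
    and V: "(\<Sum>i\<in>I. (c i)\<^sup>2 * (\<sigma> i)\<^sup>2) \<le> V" "V > 0" and t: "t \<ge> 0"
  shows "prob {\<omega> \<in> space M. t \<le> (\<Sum>i\<in>I. c i * X i \<omega>)} \<le> exp (- t\<^sup>2 / (2 * V))"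
proof -
  define s where "s = t / V"
  have int: "integrable M (\<lambda>\<omega>. exp (s * c i * X i \<omega>))" if "i \<in> I" for i
    by (rule normal_mgf(1)[OF \<sigma>[OF that] X[OF that]])
  have e: "(\<Sum>i\<in>I. s * c i * X i \<omega>) = s * (\<Sum>i\<in>I. c i * X i \<omega>)" for \<omega>
    by (simp add: sum_distrib_left mult.assoc)
  have "expectation (\<lambda>\<omega>. exp (s * (\<Sum>i\<in>I. c i * X i \<omega>))) = (\<Prod>i\<in>I. exp ((s * c i)\<^sup>2 * (\<sigma> i)\<^sup>2 / 2))"
    unfolding e[symmetric] using indep_exp_sum(2)[OF I ind, of "\<lambda>i x. s * c i * x"] int
    by (simp add: normal_mgf(2)[OF \<sigma> X])
  also have "\<dots> = exp (s\<^sup>2 / 2 * (\<Sum>i\<in>I. (c i)\<^sup>2 * (\<sigma> i)\<^sup>2))"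
    using I by (simp add: exp_sum[symmetric] sum_distrib_left power_mult_distrib mult_ac)
  also have "\<dots> \<le> exp (s\<^sup>2 / 2 * V)" using V by (simp add: mult_left_mono)
  finally have "prob {\<omega> \<in> space M. s * t \<le> s * (\<Sum>i\<in>I. c i * X i \<omega>)} \<le> exp (s\<^sup>2 / 2 * V - s * t)"
    using indep_exp_sum(1)[OF I ind, of "\<lambda>i x. s * c i * x"] int
    by (intro exponential_markov) (auto simp: e)
  also have "s\<^sup>2 / 2 * V - s * t = - t\<^sup>2 / (2 * V)"
    using V(2) by (simp add: s_def field_simps power2_eq_square)
  finally have le: "prob {\<omega> \<in> space M. s * t \<le> s * (\<Sum>i\<in>I. c i * X i \<omega>)} \<le> exp (- t\<^sup>2 / (2 * V))" .
  show ?thesis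
  \<comment> \<open>At \<open>t = 0\<close> the parameter \<open>s\<close> is 0 and cannot be
    cancelled, but the claimed bound is then 1.\<close>
  proof (cases "t = 0")
    case True
    then show ?thesis by (simp add: prob_le_1)
  next
    case False
    then have "s > 0" using t V(2) by (simp add: s_def)
    then show ?thesis using le by simp
  qed
qed

lemma (in prob_space) gaussian_sum_tail_abs:
  assumes I: "finite I" and ind: "indep_vars (\<lambda>_. borel) X I"
    and \<sigma>: "\<And>i. i \<in> I \<Longrightarrow> \<sigma> i > 0" and X: "\<And>i. i \<in> I \<Longrightarrow> distributed M lborel (X i) (normal_density 0 (\<sigma> i))"
    and V: "(\<Sum>i\<in>I. (c i)\<^sup>2 * (\<sigma> i)\<^sup>2) \<le> V" "V > 0" and t: "t \<ge> 0"
  shows "prob {\<omega> \<in> space M. t \<le> \<bar>\<Sum>i\<in>I. c i * X i \<omega>\<bar>} \<le> 2 * exp (- t\<^sup>2 / (2 * V))"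
proof -
  have rv: "X i \<in> borel_measurable M" if "i \<in> I" for i
    using X[OF that] by (simp add: distributed_def)
  have [measurable]: "(\<lambda>\<omega>. \<Sum>i\<in>I. d i * X i \<omega>) \<in> borel_measurable M" for d :: "'b \<Rightarrow> real"
    by (intro borel_measurable_sum borel_measurable_times rv) auto
  have "prob {\<omega> \<in> space M. t \<le> \<bar>\<Sum>i\<in>I. c i * X i \<omega>\<bar>} \<le> prob ({\<omega> \<in> space M. t \<le> (\<Sum>i\<in>I. c i * X i \<omega>)} \<union> {\<omega> \<in> space M. t \<le> (\<Sum>i\<in>I. (- c i) * X i \<omega>)})"
    by (intro finite_measure_mono) (auto simp: sum_negf abs_real_def split: if_splits)
  also have "\<dots> \<le> prob {\<omega> \<in> space M. t \<le> (\<Sum>i\<in>I. c i * X i \<omega>)} + prob {\<omega> \<in> space M. t \<le> (\<Sum>i\<in>I. (- c i) * X i \<omega>)}"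
    by (intro measure_Un_le) measurable
  also have "\<dots> \<le> exp (- t\<^sup>2 / (2 * V)) + exp (- t\<^sup>2 / (2 * V))"
    using V by (intro add_mono gaussian_sum_tail[OF I ind \<sigma> X _ V(2) t]) auto
  finally show ?thesis by simp
qed

text \<open>Tilting by the exponential of a square rescales the variance to \<sigma>^2 / (1 - 2 u),
  which is where u < 1/2 enters.\<close>

lemma (in prob_space) normal_square_mgf:
  assumes \<sigma>: "\<sigma> > 0" and X: "distributed M lborel X (normal_density 0 \<sigma>)" and u: "u < 1/2"
  shows "integrable M (\<lambda>\<omega>. exp (u * ((X \<omega>)\<^sup>2 / \<sigma>\<^sup>2 - 1)))"
    "expectation (\<lambda>\<omega>. exp (u * ((X \<omega>)\<^sup>2 / \<sigma>\<^sup>2 - 1))) = exp (- u) / sqrt (1 - 2 * u)"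
proof -
  define r where "r = 1 - 2 * u"
  have r: "r > 0" using u by (simp add: r_def)
  define \<sigma>' where "\<sigma>' = \<sigma> / sqrt r"
  have \<sigma>': "\<sigma>' > 0" "\<sigma>'\<^sup>2 = \<sigma>\<^sup>2 / r" using \<sigma> r by (auto simp: \<sigma>'_def power_divide)
  have eq: "normal_density 0 \<sigma> x * exp (u * (x\<^sup>2 / \<sigma>\<^sup>2 - 1)) = exp (- u) / sqrt r * normal_density 0 \<sigma>' x" for x
  proof -
    have "- (x - 0)\<^sup>2 / (2 * \<sigma>\<^sup>2) + u * (x\<^sup>2 / \<sigma>\<^sup>2 - 1) = - u + - (x - 0)\<^sup>2 / (2 * \<sigma>'\<^sup>2)"
      unfolding \<sigma>'(2) using \<sigma> r by (simp add: r_def field_simps)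
    then have 1: "exp (- (x - 0)\<^sup>2 / (2 * \<sigma>\<^sup>2)) * exp (u * (x\<^sup>2 / \<sigma>\<^sup>2 - 1)) = exp (- u) * exp (- (x - 0)\<^sup>2 / (2 * \<sigma>'\<^sup>2))"
      by (simp only: exp_add[symmetric])
    have 2: "sqrt (2 * pi * \<sigma>'\<^sup>2) = sqrt (2 * pi * \<sigma>\<^sup>2) / sqrt r"
      unfolding \<sigma>'(2) by (simp add: real_sqrt_divide real_sqrt_mult)
    have "normal_density 0 \<sigma> x * exp (u * (x\<^sup>2 / \<sigma>\<^sup>2 - 1)) = 1 / sqrt (2 * pi * \<sigma>\<^sup>2) * (exp (- (x - 0)\<^sup>2 / (2 * \<sigma>\<^sup>2)) * exp (u * (x\<^sup>2 / \<sigma>\<^sup>2 - 1)))"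
      unfolding normal_density_def by simp
    also have "\<dots> = exp (- u) / sqrt r * normal_density 0 \<sigma>' x"
      unfolding 1 unfolding normal_density_def 2 using r by simp
    finally show ?thesis .
  qed
  have int: "integrable lborel (\<lambda>x. normal_density 0 \<sigma> x * exp (u * (x\<^sup>2 / \<sigma>\<^sup>2 - 1)))"
    unfolding eq using \<sigma>' by simp
  show "integrable M (\<lambda>\<omega>. exp (u * ((X \<omega>)\<^sup>2 / \<sigma>\<^sup>2 - 1)))"
    using distributed_integrable[OF X, of "\<lambda>x. exp (u * (x\<^sup>2 / \<sigma>\<^sup>2 - 1))"] int by simp
  have "expectation (\<lambda>\<omega>. exp (u * ((X \<omega>)\<^sup>2 / \<sigma>\<^sup>2 - 1))) = (\<integral>x. normal_density 0 \<sigma> x * exp (u * (x\<^sup>2 / \<sigma>\<^sup>2 - 1)) \<partial>lborel)"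
    using distributed_integral[OF X, of "\<lambda>x. exp (u * (x\<^sup>2 / \<sigma>\<^sup>2 - 1))"] by simp
  also have "\<dots> = exp (- u) / sqrt r" unfolding eq using \<sigma>' by simp
  finally show "expectation (\<lambda>\<omega>. exp (u * ((X \<omega>)\<^sup>2 / \<sigma>\<^sup>2 - 1))) = exp (- u) / sqrt (1 - 2 * u)" by (simp add: r_def)
qed

text \<open>With x = -2 u, the remainder of ln (1 + x) beyond its linear term is at most 2 x^2 = 8
  u^2 for |x| \<le> 1/2, and the square root halves it.\<close>

lemma chi_square_mgf_bound:
  fixes u :: real
  assumes "\<bar>u\<bar> \<le> 1/4"
  shows "exp (- u) / sqrt (1 - 2 * u) \<le> exp (4 * u\<^sup>2)"
proof -
  have p: "1 - 2 * u > 0" using assms by linarith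
  have "\<bar>ln (1 + (- 2 * u)) - (- 2 * u)\<bar> \<le> 2 * (- 2 * u)\<^sup>2"
    using assms by (intro abs_ln_one_plus_x_minus_x_bound) auto
  then have "- u - ln (1 - 2 * u) / 2 \<le> 4 * u\<^sup>2" by (simp add: power2_eq_square abs_le_iff)
  then have "exp (- u - ln (1 - 2 * u) / 2) \<le> exp (4 * u\<^sup>2)" by simp
  moreover have "exp (- u - ln (1 - 2 * u) / 2) = exp (- u) / sqrt (1 - 2 * u)"
    using p by (simp add: exp_diff ln_sqrt[symmetric])
  ultimately show ?thesis by simp
qed

lemma (in prob_space) chi_square_one_sided:
  assumes I: "finite I" and ind: "indep_vars (\<lambda>_. borel) X I" and \<sigma>: "\<sigma> > 0"
    and X: "\<And>i. i \<in> I \<Longrightarrow> distributed M lborel (X i) (normal_density 0 \<sigma>)"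
    and u: "\<bar>u\<bar> \<le> 1/4"
  shows "prob {\<omega> \<in> space M. t \<le> u * ((\<Sum>i\<in>I. (X i \<omega>)\<^sup>2) / \<sigma>\<^sup>2 - real (card I))} \<le> exp (real (card I) * (4 * u\<^sup>2) - t)"
proof -
  have u2: "u < 1/2" using u by linarith
  have e: "(\<Sum>i\<in>I. u * ((X i \<omega>)\<^sup>2 / \<sigma>\<^sup>2 - 1)) = u * ((\<Sum>i\<in>I. (X i \<omega>)\<^sup>2) / \<sigma>\<^sup>2 - real (card I))" for \<omega>
    by (simp add: sum_distrib_left[symmetric] sum_subtractf sum_divide_distrib)
  have int: "integrable M (\<lambda>\<omega>. exp (u * ((X i \<omega>)\<^sup>2 / \<sigma>\<^sup>2 - 1)))" if "i \<in> I" for i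
    by (rule normal_square_mgf(1)[OF \<sigma> X[OF that] u2])
  have "expectation (\<lambda>\<omega>. exp (u * ((\<Sum>i\<in>I. (X i \<omega>)\<^sup>2) / \<sigma>\<^sup>2 - real (card I)))) = (\<Prod>i\<in>I. exp (- u) / sqrt (1 - 2 * u))"
    unfolding e[symmetric] using indep_exp_sum(2)[OF I ind, of "\<lambda>i x. u * (x\<^sup>2 / \<sigma>\<^sup>2 - 1)"] int
    by (simp add: normal_square_mgf(2)[OF \<sigma> X u2])
  also have "\<dots> \<le> (\<Prod>i\<in>I. exp (4 * u\<^sup>2))"
    using chi_square_mgf_bound[OF u] u2 by (intro prod_mono) auto
  also have "\<dots> = exp (real (card I) * (4 * u\<^sup>2))" by (simp add: exp_of_nat_mult)
  finally show ?thesis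
    using indep_exp_sum(1)[OF I ind, of "\<lambda>i x. u * (x\<^sup>2 / \<sigma>\<^sup>2 - 1)"] int
    by (intro exponential_markov) (auto simp: e)
qed

lemma (in prob_space) chi_square_concentration:
  assumes I: "finite I" and ind: "indep_vars (\<lambda>_. borel) X I" and \<sigma>: "\<sigma> > 0"
    and X: "\<And>i. i \<in> I \<Longrightarrow> distributed M lborel (X i) (normal_density 0 \<sigma>)"
    and t: "0 < t" "t \<le> 1"
  shows "prob {\<omega> \<in> space M. t * real (card I) \<le> \<bar>(\<Sum>i\<in>I. (X i \<omega>)\<^sup>2) / \<sigma>\<^sup>2 - real (card I)\<bar>} \<le> 2 * exp (- real (card I) * t\<^sup>2 / 16)"
proof -
  define m where "m = real (card I)"
  define Y where "Y = (\<lambda>\<omega>. (\<Sum>i\<in>I. (X i \<omega>)\<^sup>2) / \<sigma>\<^sup>2 - m)"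
  have rv: "X i \<in> borel_measurable M" if "i \<in> I" for i
    using X[OF that] by (simp add: distributed_def)
  have [measurable]: "Y \<in> borel_measurable M"
    unfolding Y_def by (intro borel_measurable_diff borel_measurable_divide borel_measurable_sum borel_measurable_power rv) auto
  \<comment> \<open>Minimises 4 s^2 - s t, with minimal value - t^2 / 16; \<open>t \<le> 1\<close>
    keeps it within the range of the moment bound.\<close>
  define s where "s = t / 8"
  have s: "s > 0" "\<bar>s\<bar> \<le> 1/4" "\<bar>- s\<bar> \<le> 1/4" using t by (auto simp: s_def)
  have b: "prob {\<omega> \<in> space M. s * (t * m) \<le> u * Y \<omega>} \<le> exp (- m * t\<^sup>2 / 16)" if "u = s \<or> u = - s" for u
  proof -
    have "prob {\<omega> \<in> space M. s * (t * m) \<le> u * Y \<omega>} \<le> exp (m * (4 * u\<^sup>2) - s * (t * m))"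
      unfolding Y_def m_def using that s by (intro chi_square_one_sided[OF I ind \<sigma> X]) auto
    also have "u\<^sup>2 = s\<^sup>2" using that by auto
    also have "m * (4 * s\<^sup>2) - s * (t * m) = - m * t\<^sup>2 / 16"
      by (simp add: s_def power2_eq_square)
    finally show ?thesis .
  qed
  have "prob {\<omega> \<in> space M. t * m \<le> \<bar>Y \<omega>\<bar>} \<le> prob ({\<omega> \<in> space M. s * (t * m) \<le> s * Y \<omega>} \<union> {\<omega> \<in> space M. s * (t * m) \<le> (- s) * Y \<omega>})"
  proof (intro finite_measure_mono subsetI)
    fix \<omega> assume "\<omega> \<in> {\<omega> \<in> space M. t * m \<le> \<bar>Y \<omega>\<bar>}"
    then have w: "\<omega> \<in> space M" and "t * m \<le> Y \<omega> \<or> t * m \<le> - Y \<omega>" by auto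
    then have "s * (t * m) \<le> s * Y \<omega> \<or> s * (t * m) \<le> s * (- Y \<omega>)"
      unfolding mult_le_cancel_left_pos[OF s(1)] by blast
    then show "\<omega> \<in> {\<omega> \<in> space M. s * (t * m) \<le> s * Y \<omega>} \<union> {\<omega> \<in> space M. s * (t * m) \<le> (- s) * Y \<omega>}"
      using w by auto
  qed measurable
  also have "\<dots> \<le> prob {\<omega> \<in> space M. s * (t * m) \<le> s * Y \<omega>} + prob {\<omega> \<in> space M. s * (t * m) \<le> (- s) * Y \<omega>}"
    by (intro measure_Un_le) measurable
  also have "\<dots> \<le> exp (- m * t\<^sup>2 / 16) + exp (- m * t\<^sup>2 / 16)" by (intro add_mono b) auto
  finally show ?thesis unfolding Y_def m_def by simp
qed

section \<open>Counting lattice points in a ball\<close>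

text \<open>A generating function bound: a point of the ball has weight \<rho>^(|z|^2), at least
  \<rho>^B, and the total weight factorises over the coordinates. If \<open>B\<close> is a small
  multiple of \<open>n\<close>, a small \<rho> makes the exponential rate as small as
  desired.\<close>

lemma lattice_points_count:
  fixes \<rho> B :: real and n :: nat
  assumes \<rho>: "0 < \<rho>" "\<rho> \<le> 1/2" and B: "B \<ge> 0"
  defines "S \<equiv> {z \<in> PiE {..<n} (\<lambda>_. UNIV :: int set). real_of_int (\<Sum>i<n. (z i)\<^sup>2) \<le> B}"
  shows "finite S" "real (card S) \<le> exp (4 * \<rho> * real n) * \<rho> powr (- B)"
proof -
  define N where "N = nat \<lceil>B\<rceil>"
  define K where "K = {- int N..int N}"
  have SK: "S \<subseteq> PiE {..<n} (\<lambda>_. K)"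
  proof
    fix z assume z: "z \<in> S"
    have "z i \<in> K" if i: "i < n" for i
    proof -
      have "(z i)\<^sup>2 \<le> (\<Sum>i<n. (z i)\<^sup>2)" using i by (intro member_le_sum) auto
      then have "real_of_int ((z i)\<^sup>2) \<le> real_of_int (\<Sum>i<n. (z i)\<^sup>2)" by (simp only: of_int_le_iff)
      also have "\<dots> \<le> B" using z unfolding S_def by blast
      finally have "real_of_int ((z i)\<^sup>2) \<le> B" .
      then have "real_of_int ((z i)\<^sup>2) \<le> real_of_int \<lceil>B\<rceil>" using le_of_int_ceiling[of B] by linarith
      then have "(z i)\<^sup>2 \<le> \<lceil>B\<rceil>" by (simp only: of_int_le_iff)
      then have 1: "(z i)\<^sup>2 \<le> int N" using B by (simp add: N_def)
      have "\<bar>z i\<bar> \<le> (z i)\<^sup>2"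
      proof -
        have "\<bar>z i\<bar> * 1 \<le> \<bar>z i\<bar> * \<bar>z i\<bar>"
          by (cases "z i = 0") (auto intro: mult_left_mono simp del: abs_mult_self_eq)
        then show ?thesis by (simp add: power2_eq_square)
      qed
      then show ?thesis using 1 by (auto simp: K_def)
    qed
    then show "z \<in> PiE {..<n} (\<lambda>_. K)" using z by (auto simp: S_def PiE_def)
  qed
  have finK: "finite (PiE {..<n} (\<lambda>_. K))" by (intro finite_PiE) (auto simp: K_def)
  then show fin: "finite S" using SK by (rule finite_subset[rotated])
  \<comment> \<open>One coordinate: 0 contributes 1, and the positive and the negative integers
    contribute at most 2 \<rho> each, because replacing the square in the exponent by the integer
    itself only increases the power.\<close>
  have one: "(\<Sum>k\<in>K. \<rho> ^ nat (k\<^sup>2)) \<le> exp (4 * \<rho>)"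
  proof -
    have "K = (int ` {..N}) \<union> ((\<lambda>i. - int i) ` {1..N})"
    proof (intro equalityI subsetI)
      fix k assume k: "k \<in> K"
      show "k \<in> (int ` {..N}) \<union> ((\<lambda>i. - int i) ` {1..N})"
      proof (cases "k \<ge> 0")
        case True
        then have "k = int (nat k)" "nat k \<in> {..N}" using k by (auto simp: K_def)
        then show ?thesis by blast
      next
        case False
        then have "k = - int (nat (- k))" "nat (- k) \<in> {1..N}" using k by (auto simp: K_def)
        then show ?thesis by blast
      qed
    qed (auto simp: K_def)
    then have "(\<Sum>k\<in>K. \<rho> ^ nat (k\<^sup>2)) \<le> (\<Sum>k\<in>int ` {..N}. \<rho> ^ nat (k\<^sup>2)) + (\<Sum>k\<in>(\<lambda>i. - int i) ` {1..N}. \<rho> ^ nat (k\<^sup>2))"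
      using \<rho> by (simp add: sum_Un sum_nonneg)
    also have "\<dots> = (\<Sum>i\<le>N. \<rho> ^ (i\<^sup>2)) + (\<Sum>i=1..N. \<rho> ^ (i\<^sup>2))"
      by (subst (1 2) sum.reindex) (auto simp: inj_on_def nat_power_eq)
    also have "(\<Sum>i\<le>N. \<rho> ^ (i\<^sup>2)) = 1 + (\<Sum>i=1..N. \<rho> ^ (i\<^sup>2))"
    proof -
      have "{..N} = insert 0 {1..N}" by auto
      then show ?thesis by simp
    qed
    also have "(\<Sum>i=1..N. \<rho> ^ (i\<^sup>2)) \<le> (\<Sum>i=1..N. \<rho> ^ i)"
      using \<rho> by (intro sum_mono power_decreasing) (auto simp: power2_eq_square)
    also have "(\<Sum>i=1..N. \<rho> ^ i) = \<rho> * (\<Sum>i<N. \<rho> ^ i)"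
      by (simp add: sum.atLeast1_atMost_eq sum_distrib_left)
    also have "(\<Sum>i<N. \<rho> ^ i) \<le> 2"
    proof -
      have "(\<Sum>i<N. \<rho> ^ i) = (1 - \<rho> ^ N) / (1 - \<rho>)" using \<rho> by (subst sum_gp_strict) auto
      also have "\<dots> \<le> 1 / (1 - \<rho>)" using \<rho> by (intro divide_right_mono) auto
      also have "\<dots> \<le> 2" using \<rho> by (simp add: field_simps)
      finally show ?thesis .
    qed
    finally have "(\<Sum>k\<in>K. \<rho> ^ nat (k\<^sup>2)) \<le> 1 + 4 * \<rho>" using \<rho> by simp
    also have "\<dots> \<le> exp (4 * \<rho>)" by (rule exp_ge_add_one_self)
    finally show ?thesis .
  qed
  have "real (card S) = (\<Sum>z\<in>S. 1)" by simp
  also have "\<dots> \<le> (\<Sum>z\<in>S. \<rho> powr (- B) * (\<Prod>i<n. \<rho> ^ nat ((z i)\<^sup>2)))"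
  proof (intro sum_mono)
    fix z assume z: "z \<in> S"
    have "(\<Prod>i<n. \<rho> ^ nat ((z i)\<^sup>2)) = \<rho> ^ (\<Sum>i<n. nat ((z i)\<^sup>2))" by (simp add: power_sum)
    also have "\<dots> = \<rho> powr (real (\<Sum>i<n. nat ((z i)\<^sup>2)))" using \<rho> by (simp only: powr_realpow)
    also have "real (\<Sum>i<n. nat ((z i)\<^sup>2)) = real_of_int (\<Sum>i<n. (z i)\<^sup>2)" by simp
    finally have "\<rho> powr (- B) * (\<Prod>i<n. \<rho> ^ nat ((z i)\<^sup>2)) = \<rho> powr (real_of_int (\<Sum>i<n. (z i)\<^sup>2) - B)"
      by (simp add: powr_add[symmetric])
    moreover have "\<rho> powr 0 \<le> \<rho> powr (real_of_int (\<Sum>i<n. (z i)\<^sup>2) - B)"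
      using z \<rho> by (intro powr_mono') (auto simp: S_def)
    ultimately show "1 \<le> \<rho> powr (- B) * (\<Prod>i<n. \<rho> ^ nat ((z i)\<^sup>2))" using \<rho> by simp
  qed
  also have "\<dots> \<le> (\<Sum>z\<in>PiE {..<n} (\<lambda>_. K). \<rho> powr (- B) * (\<Prod>i<n. \<rho> ^ nat ((z i)\<^sup>2)))"
    using SK finK \<rho> by (intro sum_mono2) (auto intro!: mult_nonneg_nonneg prod_nonneg)
  also have "\<dots> = \<rho> powr (- B) * (\<Prod>i<n. \<Sum>k\<in>K. \<rho> ^ nat (k\<^sup>2))"
    by (subst prod_sum_PiE) (auto simp: K_def sum_distrib_left)
  also have "\<dots> \<le> \<rho> powr (- B) * (\<Prod>i<n. exp (4 * \<rho>))"
    using one \<rho> by (intro mult_left_mono prod_mono) (auto intro!: sum_nonneg)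
  also have "(\<Prod>i<n. exp (4 * \<rho>)) = exp (4 * \<rho> * real n)"
    by (simp add: exp_of_nat_mult[symmetric] mult.commute)
  finally show "real (card S) \<le> exp (4 * \<rho> * real n) * \<rho> powr (- B)" by (simp add: mult.commute)
qed

section \<open>Linear and quadratic functionals of the GOE\<close>

definition edges :: "nat \<Rightarrow> (nat \<times> nat) set" where
  "edges n = {(i, j). i < j \<and> j < n}"

text \<open>The position above the diagonal that represents both (i, j) and (j, i). Independence is
  available only for such positions, so functionals of the matrix are rewritten over
  \<open>edges\<close> before probabilities are estimated.\<close>

definition edge :: "nat \<Rightarrow> nat \<Rightarrow> nat \<times> nat" where
  "edge i j = (min i j, max i j)"

lemma finite_edges [simp]: "finite (edges n)"
  by (rule finite_subset[of _ "{..<n} \<times> {..<n}"]) (auto simp: edges_def)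

lemma edge_commute: "edge i j = edge j i"
  by (simp add: edge_def min.commute max.commute)

lemma edge_in_edges: "i < n \<Longrightarrow> j < n \<Longrightarrow> i \<noteq> j \<Longrightarrow> edge i j \<in> edges n"
  by (auto simp: edge_def edges_def min_def max_def)

lemma edge_eq_iff: "edge i j = edge k l \<longleftrightarrow> (i = k \<and> j = l) \<or> (i = l \<and> j = k)"
  by (auto simp: edge_def min_def max_def split: if_splits)

lemma inj_edge: "inj_on (edge i) S"
  by (rule inj_onI) (auto simp: edge_eq_iff)

lemma GOE_prob_space: "GOE n M A \<Longrightarrow> prob_space M"
  by (simp add: GOE_def)

lemma GOE_carrier: "GOE n M A \<Longrightarrow> \<omega> \<in> space M \<Longrightarrow> A \<omega> \<in> carrier_mat n n"
  and GOE_sym: "GOE n M A \<Longrightarrow> \<omega> \<in> space M \<Longrightarrow> transpose_mat (A \<omega>) = A \<omega>"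
  by (simp_all add: GOE_def)

lemma GOE_edges_indep:
  assumes "GOE n M A"
  shows "prob_space.indep_vars M (\<lambda>_. borel) (\<lambda>e \<omega>. A \<omega> $$ e) (edges n)"
proof -
  interpret prob_space M by (rule GOE_prob_space[OF assms])
  have eq: "(\<lambda>(i, j) \<omega>. A \<omega> $$ (i, j)) = (\<lambda>e \<omega>. A \<omega> $$ e)" by auto
  have "indep_vars (\<lambda>_. borel) (\<lambda>e \<omega>. A \<omega> $$ e) {(i, j). i \<le> j \<and> j < n}"
    using assms unfolding GOE_def eq by blast
  then show ?thesis by (rule indep_vars_subset) (auto simp: edges_def)
qed

lemma GOE_edges_normal:
  assumes "GOE n M A" "e \<in> edges n"
  shows "distributed M lborel (\<lambda>\<omega>. A \<omega> $$ e) (normal_density 0 (1 / sqrt (real n)))"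
proof -
  obtain i j where e: "e = (i, j)" "i < j" "j < n" using assms(2) by (auto simp: edges_def)
  then have "distributed M lborel (\<lambda>\<omega>. A \<omega> $$ (i, j)) (normal_density 0 (sqrt ((1 + (if i = j then 1 else 0)) / real n)))"
    using assms(1) unfolding GOE_def by (metis less_imp_le)
  then show ?thesis using e by (simp add: real_sqrt_divide)
qed

lemma GOE_entry_measurable:
  assumes "GOE n M A" "i < n" "j < n"
  shows "(\<lambda>\<omega>. A \<omega> $$ (i,j)) \<in> borel_measurable M"
proof -
  have 1: "(\<lambda>\<omega>. A \<omega> $$ (i,j)) \<in> borel_measurable M" if "i \<le> j" "j < n" for i j
    using assms(1) that unfolding GOE_def distributed_def by (auto simp: measurable_lborel1)
  show ?thesis
  proof (cases "i \<le> j")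
    case False
    have "A \<omega> $$ (i,j) = A \<omega> $$ (j,i)" if "\<omega> \<in> space M" for \<omega>
    proof -
      have "transpose_mat (A \<omega>) $$ (i,j) = A \<omega> $$ (j,i)"
        using GOE_carrier[OF assms(1) that] assms by (intro index_transpose_mat) auto
      then show ?thesis using GOE_sym[OF assms(1) that] by simp
    qed
    then show ?thesis using 1[of j i] False assms by (simp cong: measurable_cong)
  qed (use 1 assms in auto)
qed

lemma offdiag_edge:
  assumes "A \<in> carrier_mat n n" "transpose_mat A = A" "i < n" "j < n" "i \<noteq> j"
  shows "offdiag A i j = A $$ edge i j"
proof (cases "i < j")
  case False
  then have "offdiag A i j = offdiag A j i" using offdiag_sym[OF assms(1,2)] by simp
  then show ?thesis using False assms by (simp add: offdiag_def edge_def)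
qed (use assms in \<open>simp add: offdiag_def edge_def\<close>)

lemma offdiag_measurable:
  assumes "GOE n M A"
  shows "(\<lambda>\<omega>. offdiag (A \<omega>) i j) \<in> borel_measurable M"
proof (cases "i < n \<and> j < n \<and> i \<noteq> j")
  case True
  have "offdiag (A \<omega>) i j = A \<omega> $$ (i,j)" if "\<omega> \<in> space M" for \<omega>
    using True GOE_carrier[OF assms that] by (auto simp: offdiag_def)
  then show ?thesis using GOE_entry_measurable[OF assms, of i j] True by (simp cong: measurable_cong)
next
  case False
  have "offdiag (A \<omega>) i j = 0" if "\<omega> \<in> space M" for \<omega>
    using False GOE_carrier[OF assms that] by (auto simp: offdiag_def)
  then show ?thesis by (simp cong: measurable_cong)
qed

lemma degree_sum_eq:
  assumes "A \<in> carrier_mat n n"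
  shows "degree_sum A i = (\<Sum>j<n. offdiag A i j)"
  using assms by (simp add: degree_sum_def)

lemma degree_sum_measurable:
  assumes "GOE n M A"
  shows "(\<lambda>\<omega>. degree_sum (A \<omega>) i) \<in> borel_measurable M"
proof -
  have "(\<lambda>\<omega>. \<Sum>j<n. offdiag (A \<omega>) i j) \<in> borel_measurable M"
    by (intro borel_measurable_sum offdiag_measurable[OF assms])
  moreover have "degree_sum (A \<omega>) i = (\<Sum>j<n. offdiag (A \<omega>) i j)" if "\<omega> \<in> space M" for \<omega>
    using degree_sum_eq[OF GOE_carrier[OF assms that]] .
  ultimately show ?thesis by (simp cong: measurable_cong)
qed

lemma sum_offdiag_edges:
  fixes F :: "real \<Rightarrow> real"
  assumes A: "A \<in> carrier_mat n n" "transpose_mat A = A" and i: "i < n" and J: "J \<subseteq> {..<n} - {i}"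
  shows "(\<Sum>j\<in>J. F (offdiag A i j)) = (\<Sum>e\<in>edge i ` J. F (A $$ e))"
proof -
  have "offdiag A i j = A $$ edge i j" if "j \<in> J" for j
    using that J i by (intro offdiag_edge[OF A]) auto
  then show ?thesis by (subst sum.reindex[OF inj_edge]) (simp cong: sum.cong)
qed

lemma degree_sum_edges:
  assumes A: "A \<in> carrier_mat n n" "transpose_mat A = A" and i: "i < n"
  shows "degree_sum A i = (\<Sum>e\<in>edge i ` ({..<n} - {i}). A $$ e)"
proof -
  have "degree_sum A i = (\<Sum>j\<in>{..<n} - {i}. offdiag A i j)"
    unfolding degree_sum_eq[OF A(1)] by (intro sum.mono_neutral_right) (auto simp: offdiag_def)
  then show ?thesis using sum_offdiag_edges[OF A i, of _ "\<lambda>x. x"] by simp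
qed

lemma qform_edges:
  assumes A: "A \<in> carrier_mat n n" "transpose_mat A = A"
  shows "qform n (offdiag A) z = (\<Sum>e\<in>edges n. (2 * z (fst e) * z (snd e)) * A $$ e)"
proof -
  let ?f = "\<lambda>(i, j). offdiag A i j * z i * z j"
  have s: "offdiag A i j = offdiag A j i" for i j by (rule offdiag_sym[OF A])
  have "qform n (offdiag A) z = (\<Sum>e\<in>{..<n} \<times> {..<n}. ?f e)"
    by (simp add: qform_def sum.cartesian_product)
  also have "\<dots> = (\<Sum>e\<in>edges n \<union> prod.swap ` edges n. ?f e)"
  proof (rule sum.mono_neutral_right)
    show "\<forall>e\<in>{..<n} \<times> {..<n} - (edges n \<union> prod.swap ` edges n). ?f e = 0"
    proof
      fix e assume e: "e \<in> {..<n} \<times> {..<n} - (edges n \<union> prod.swap ` edges n)"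
      obtain i j where ij: "e = (i, j)" by (cases e)
      have "i = j"
      proof (rule ccontr)
        assume "i \<noteq> j"
        then have "(i, j) \<in> edges n \<or> (j, i) \<in> edges n" using e ij by (auto simp: edges_def)
        then show False using e ij by (auto simp: image_iff)
      qed
      then show "?f e = 0" using ij by (simp add: offdiag_def)
    qed
  qed (auto simp: edges_def)
  also have "\<dots> = (\<Sum>e\<in>edges n. ?f e) + (\<Sum>e\<in>prod.swap ` edges n. ?f e)"
    by (intro sum.union_disjoint finite_imageI finite_edges) (auto simp: edges_def)
  also have "(\<Sum>e\<in>prod.swap ` edges n. ?f e) = (\<Sum>e\<in>edges n. ?f e)"
    by (subst sum.reindex) (auto simp: inj_on_def s mult_ac intro!: sum.cong)
  finally have "qform n (offdiag A) z = 2 * (\<Sum>e\<in>edges n. ?f e)" by simp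
  also have "\<dots> = (\<Sum>e\<in>edges n. (2 * z (fst e) * z (snd e)) * A $$ e)"
    unfolding sum_distrib_left
    by (intro sum.cong refl) (use A in \<open>auto simp: edges_def offdiag_def\<close>)
  finally show ?thesis .
qed

text \<open>Functions of disjoint groups of entries are independent, and coefficients of modulus 1
  make the variance \<sigma>^2 times the group size. The groups will be the column pairs of two
  rows, combined with either sign, and the entries joining an index of a fixed set to the complement
  of that set.\<close>

lemma (in prob_space) grouped_linear_normal:
  fixes X :: "'b \<Rightarrow> 'a \<Rightarrow> real"
  assumes ind: "indep_vars (\<lambda>_. borel) X E"
    and X: "\<And>e. e \<in> E \<Longrightarrow> distributed M lborel (X e) (normal_density 0 \<sigma>)" and \<sigma>: "\<sigma> > 0"
    and K: "\<And>l. l \<in> L \<Longrightarrow> K l \<subseteq> E" "\<And>l. l \<in> L \<Longrightarrow> finite (K l)" "disjoint_family_on K L"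
  shows "indep_vars (\<lambda>_. borel) (\<lambda>l \<omega>. \<Sum>e\<in>K l. c l e * X e \<omega>) L"
    "l \<in> L \<Longrightarrow> K l \<noteq> {} \<Longrightarrow> (\<And>e. e \<in> K l \<Longrightarrow> (c l e)\<^sup>2 = 1) \<Longrightarrow>
      distributed M lborel (\<lambda>\<omega>. \<Sum>e\<in>K l. c l e * X e \<omega>) (normal_density 0 (\<sigma> * sqrt (real (card (K l)))))"
proof -
  have "indep_vars (\<lambda>l. PiM (K l) (\<lambda>_. borel)) (\<lambda>l \<omega>. restrict (\<lambda>e. X e \<omega>) (K l)) L"
    by (rule indep_vars_restrict[OF ind K(1,3)])
  then have "indep_vars (\<lambda>_. borel) (\<lambda>l \<omega>. (\<lambda>f. \<Sum>e\<in>K l. c l e * f e) (restrict (\<lambda>e. X e \<omega>) (K l))) L"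
    by (rule indep_vars_compose2) (auto intro!: borel_measurable_sum borel_measurable_times)
  then show "indep_vars (\<lambda>_. borel) (\<lambda>l \<omega>. \<Sum>e\<in>K l. c l e * X e \<omega>) L"
    by (simp cong: sum.cong)
  assume l: "l \<in> L" "K l \<noteq> {}" and c: "\<And>e. e \<in> K l \<Longrightarrow> (c l e)\<^sup>2 = 1"
  have c1: "\<bar>c l e\<bar> = 1" if "e \<in> K l" for e using c[OF that] by (auto simp: power2_eq_1_iff)
  have c0: "c l e \<noteq> 0" if "e \<in> K l" for e using c1[OF that] by auto
  have "distributed M lborel (\<lambda>\<omega>. \<Sum>e\<in>K l. c l e * X e \<omega>) (normal_density (\<Sum>e\<in>K l. 0) (sqrt (\<Sum>e\<in>K l. \<sigma>\<^sup>2)))"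
  proof (rule sum_indep_normal[where \<mu> = "\<lambda>_. 0" and \<sigma> = "\<lambda>_. \<sigma>"])
    show "indep_vars (\<lambda>i. borel) (\<lambda>e \<omega>. c l e * X e \<omega>) (K l)"
      by (rule indep_vars_compose2[OF indep_vars_subset[OF ind K(1)[OF l(1)]]]) auto
    fix e assume e: "e \<in> K l"
    then have "distributed M lborel (\<lambda>\<omega>. 0 + c l e * X e \<omega>) (normal_density (0 + c l e * 0) (\<bar>c l e\<bar> * \<sigma>))"
      using K(1)[OF l(1)] c0 by (intro normal_density_affine X \<sigma>) auto
    then show "distributed M lborel (\<lambda>\<omega>. c l e * X e \<omega>) (normal_density 0 \<sigma>)"
      using c1[OF e] by simp
  qed (use \<sigma> K(2)[OF l(1)] l in auto)
  moreover have "sqrt (\<Sum>e\<in>K l. \<sigma>\<^sup>2) = \<sigma> * sqrt (real (card (K l)))"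
    using \<sigma> by (simp add: real_sqrt_mult mult.commute)
  ultimately show "distributed M lborel (\<lambda>\<omega>. \<Sum>e\<in>K l. c l e * X e \<omega>) (normal_density 0 (\<sigma> * sqrt (real (card (K l)))))"
    by simp
qed

section \<open>Tail bounds for degrees, entries, quadratic forms and rows\<close>

lemma GOE_linear_tail:
  assumes G: "GOE n M A" and n: "n \<ge> 1" and I: "I \<subseteq> edges n"
    and V: "(\<Sum>e\<in>I. (c e)\<^sup>2) / real n \<le> V" "V > 0" and t: "t \<ge> 0"
  shows "measure M {\<omega> \<in> space M. t \<le> \<bar>\<Sum>e\<in>I. c e * A \<omega> $$ e\<bar>} \<le> 2 * exp (- t\<^sup>2 / (2 * V))"
    "measure M {\<omega> \<in> space M. t \<le> (\<Sum>e\<in>I. c e * A \<omega> $$ e)} \<le> exp (- t\<^sup>2 / (2 * V))"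
proof -
  interpret prob_space M by (rule GOE_prob_space[OF G])
  have fin: "finite I" using I finite_edges by (rule finite_subset)
  have ind: "indep_vars (\<lambda>_. borel) (\<lambda>e \<omega>. A \<omega> $$ e) I" by (rule indep_vars_subset[OF GOE_edges_indep[OF G] I])
  have V': "(\<Sum>e\<in>I. (c e)\<^sup>2 * (1 / sqrt (real n))\<^sup>2) \<le> V"
    using V(1) n by (simp add: power_divide sum_divide_distrib)
  have \<sigma>: "0 < 1 / sqrt (real n)" using n by simp
  have X: "distributed M lborel (\<lambda>\<omega>. A \<omega> $$ e) (normal_density 0 (1 / sqrt (real n)))" if "e \<in> I" for e
    using GOE_edges_normal[OF G] I that by blast
  show "measure M {\<omega> \<in> space M. t \<le> \<bar>\<Sum>e\<in>I. c e * A \<omega> $$ e\<bar>} \<le> 2 * exp (- t\<^sup>2 / (2 * V))"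
    by (rule gaussian_sum_tail_abs[OF fin ind \<sigma> X V' V(2) t])
  show "measure M {\<omega> \<in> space M. t \<le> (\<Sum>e\<in>I. c e * A \<omega> $$ e)} \<le> exp (- t\<^sup>2 / (2 * V))"
    by (rule gaussian_sum_tail[OF fin ind \<sigma> X V' V(2) t])
qed

lemma edge_star_subset: "i < n \<Longrightarrow> edge i ` ({..<n} - {i}) \<subseteq> edges n"
  by (rule image_subsetI) (auto intro: edge_in_edges)

lemma GOE_degree_tail:
  assumes G: "GOE n M A" and i: "i < n" and t: "t \<ge> 0"
  shows "measure M {\<omega> \<in> space M. t \<le> degree_sum (A \<omega>) i} \<le> exp (- t\<^sup>2 / 2)"
    "measure M {\<omega> \<in> space M. t \<le> \<bar>degree_sum (A \<omega>) i\<bar>} \<le> 2 * exp (- t\<^sup>2 / 2)"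
proof -
  let ?I = "edge i ` ({..<n} - {i})"
  have e: "degree_sum (A \<omega>) i = (\<Sum>e\<in>?I. 1 * A \<omega> $$ e)" if "\<omega> \<in> space M" for \<omega>
    using degree_sum_edges[OF GOE_carrier[OF G that] GOE_sym[OF G that] i] by simp
  have V: "(\<Sum>e\<in>?I. (1::real)\<^sup>2) / real n \<le> 1"
    using i by (simp add: card_image[OF inj_edge])
  have s: "{\<omega> \<in> space M. t \<le> degree_sum (A \<omega>) i} = {\<omega> \<in> space M. t \<le> (\<Sum>e\<in>?I. 1 * A \<omega> $$ e)}"
    "{\<omega> \<in> space M. t \<le> \<bar>degree_sum (A \<omega>) i\<bar>} = {\<omega> \<in> space M. t \<le> \<bar>\<Sum>e\<in>?I. 1 * A \<omega> $$ e\<bar>}"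
    by (auto simp: e)
  have n: "n \<ge> 1" using i by simp
  show "measure M {\<omega> \<in> space M. t \<le> degree_sum (A \<omega>) i} \<le> exp (- t\<^sup>2 / 2)"
    unfolding s using GOE_linear_tail(2)[OF G n edge_star_subset[OF i] V _ t] by simp
  show "measure M {\<omega> \<in> space M. t \<le> \<bar>degree_sum (A \<omega>) i\<bar>} \<le> 2 * exp (- t\<^sup>2 / 2)"
    unfolding s using GOE_linear_tail(1)[OF G n edge_star_subset[OF i] V _ t] by simp
qed

lemma GOE_entry_tail:
  assumes G: "GOE n M A" and i: "i < n" "j < n" and t: "t > 0"
  shows "measure M {\<omega> \<in> space M. t \<le> \<bar>offdiag (A \<omega>) i j\<bar>} \<le> 2 * exp (- real n * t\<^sup>2 / 2)"
proof (cases "i = j")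
  case True
  then have s: "{\<omega> \<in> space M. t \<le> \<bar>offdiag (A \<omega>) i j\<bar>} = {}" using t by (auto simp: offdiag_def)
  show ?thesis unfolding s by simp
next
  case False
  have s: "{\<omega> \<in> space M. t \<le> \<bar>offdiag (A \<omega>) i j\<bar>} = {\<omega> \<in> space M. t \<le> \<bar>\<Sum>e\<in>{edge i j}. 1 * A \<omega> $$ e\<bar>}"
    using offdiag_edge[OF GOE_carrier[OF G] GOE_sym[OF G] i False] by auto
  have n: "n \<ge> 1" using i by simp
  have "- t\<^sup>2 / (2 * (1 / real n)) = - real n * t\<^sup>2 / 2" by simp
  then show ?thesis
    unfolding s using GOE_linear_tail(1)[OF G n, of "{edge i j}" "\<lambda>_. 1" "1 / real n" t] edge_in_edges[OF i False] t n by (simp add: mult.commute)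
qed

text \<open>The form is linear in the entries with coefficients 2 z_i z_j over pairs i < j, so its
  variance is at most 2 S^2 / n. The resulting exponent n t^2 / 4 has to beat the logarithm of the
  size of the net.\<close>

lemma GOE_qform_tail:
  assumes G: "GOE n M A" and n: "n \<ge> 1" and S: "(\<Sum>i<n. (z i)\<^sup>2) \<le> S" "S > 0" and t: "t \<ge> 0"
  shows "measure M {\<omega> \<in> space M. t * S \<le> \<bar>qform n (offdiag (A \<omega>)) z\<bar>} \<le> 2 * exp (- real n * t\<^sup>2 / 4)"
proof -
  have s: "{\<omega> \<in> space M. t * S \<le> \<bar>qform n (offdiag (A \<omega>)) z\<bar>} = {\<omega> \<in> space M. t * S \<le> \<bar>\<Sum>e\<in>edges n. (2 * z (fst e) * z (snd e)) * A \<omega> $$ e\<bar>}"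
    using qform_edges[OF GOE_carrier[OF G] GOE_sym[OF G]] by auto
  have "2 * (\<Sum>e\<in>edges n. (z (fst e))\<^sup>2 * (z (snd e))\<^sup>2) = (\<Sum>e\<in>edges n. (z (fst e))\<^sup>2 * (z (snd e))\<^sup>2) + (\<Sum>e\<in>prod.swap ` edges n. (z (fst e))\<^sup>2 * (z (snd e))\<^sup>2)"
    by (subst sum.reindex) (auto simp: inj_on_def mult.commute)
  also have "\<dots> = (\<Sum>e\<in>edges n \<union> prod.swap ` edges n. (z (fst e))\<^sup>2 * (z (snd e))\<^sup>2)"
    by (intro sum.union_disjoint[symmetric] finite_imageI finite_edges) (auto simp: edges_def)
  also have "\<dots> \<le> (\<Sum>e\<in>{..<n} \<times> {..<n}. (z (fst e))\<^sup>2 * (z (snd e))\<^sup>2)"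
    by (intro sum_mono2) (auto simp: edges_def)
  also have "\<dots> = (\<Sum>i<n. (z i)\<^sup>2) * (\<Sum>i<n. (z i)\<^sup>2)"
    by (simp add: sum_product sum.cartesian_product case_prod_unfold)
  also have "\<dots> \<le> S * S" using S by (intro mult_mono) (auto intro!: sum_nonneg)
  finally have 1: "2 * (\<Sum>e\<in>edges n. (z (fst e))\<^sup>2 * (z (snd e))\<^sup>2) \<le> S\<^sup>2" by (simp add: power2_eq_square)
  have "(\<Sum>e\<in>edges n. (2 * z (fst e) * z (snd e))\<^sup>2) = 4 * (\<Sum>e\<in>edges n. (z (fst e))\<^sup>2 * (z (snd e))\<^sup>2)"
    by (simp add: power_mult_distrib sum_distrib_left mult.assoc)
  then have V: "(\<Sum>e\<in>edges n. (2 * z (fst e) * z (snd e))\<^sup>2) / real n \<le> 2 * S\<^sup>2 / real n"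
    using 1 by (intro divide_right_mono) auto
  have pos: "2 * S\<^sup>2 / real n > 0" using S n by simp
  have e: "- (t * S)\<^sup>2 / (2 * (2 * S\<^sup>2 / real n)) = - real n * t\<^sup>2 / 4"
    using S n by (simp add: power_mult_distrib field_simps)
  have ts: "0 \<le> t * S" using S t by simp
  show ?thesis unfolding s by (rule GOE_linear_tail(1)[OF G n subset_refl V pos ts, unfolded e])
qed

text \<open>A row has n - 1 off-diagonal entries of variance 1 / n, so its squared norm has mean 1 -
  1 / n; the extra 1 / n in the threshold absorbs this bias.\<close>

lemma GOE_row_norm:
  assumes G: "GOE n M A" and i: "i < n" and t: "0 < t" "t \<le> 1"
  shows "measure M {\<omega> \<in> space M. t + 1 / real n < \<bar>(\<Sum>j<n. (offdiag (A \<omega>) i j)\<^sup>2) - 1\<bar>} \<le> 2 * exp (- real (n - 1) * t\<^sup>2 / 16)"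
proof -
  interpret prob_space M by (rule GOE_prob_space[OF G])
  let ?I = "edge i ` ({..<n} - {i})"
  have n: "n \<ge> 1" using i by simp
  have card: "card ?I = n - 1" using i by (simp add: card_image[OF inj_edge])
  have eq: "(\<Sum>j<n. (offdiag (A \<omega>) i j)\<^sup>2) = (\<Sum>e\<in>?I. (A \<omega> $$ e)\<^sup>2)" if "\<omega> \<in> space M" for \<omega>
  proof -
    have "(\<Sum>j<n. (offdiag (A \<omega>) i j)\<^sup>2) = (\<Sum>j\<in>{..<n} - {i}. (offdiag (A \<omega>) i j)\<^sup>2)"
      by (intro sum.mono_neutral_right) (auto simp: offdiag_def)
    then show ?thesis using sum_offdiag_edges[OF GOE_carrier[OF G that] GOE_sym[OF G that] i, of _ "\<lambda>x. x\<^sup>2"] by simp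
  qed
  have X: "distributed M lborel (\<lambda>\<omega>. A \<omega> $$ e) (normal_density 0 (1 / sqrt (real n)))" if "e \<in> ?I" for e
    using GOE_edges_normal[OF G] edge_star_subset[OF i] that by blast
  have meas: "(\<lambda>\<omega>. A \<omega> $$ e) \<in> borel_measurable M" if "e \<in> ?I" for e
    using X[OF that] by (simp add: distributed_def)
  have ind: "indep_vars (\<lambda>_. borel) (\<lambda>e \<omega>. A \<omega> $$ e) ?I"
    by (rule indep_vars_subset[OF GOE_edges_indep[OF G] edge_star_subset[OF i]])
  have "prob {\<omega> \<in> space M. t + 1 / real n < \<bar>(\<Sum>j<n. (offdiag (A \<omega>) i j)\<^sup>2) - 1\<bar>}
     \<le> prob {\<omega> \<in> space M. t * real (card ?I) \<le> \<bar>(\<Sum>e\<in>?I. (A \<omega> $$ e)\<^sup>2) / (1 / sqrt (real n))\<^sup>2 - real (card ?I)\<bar>}"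
  proof (rule finite_measure_mono)
    show "{\<omega> \<in> space M. t + 1 / real n < \<bar>(\<Sum>j<n. (offdiag (A \<omega>) i j)\<^sup>2) - 1\<bar>}
      \<subseteq> {\<omega> \<in> space M. t * real (card ?I) \<le> \<bar>(\<Sum>e\<in>?I. (A \<omega> $$ e)\<^sup>2) / (1 / sqrt (real n))\<^sup>2 - real (card ?I)\<bar>}"
    proof
      fix \<omega> assume w: "\<omega> \<in> {\<omega> \<in> space M. t + 1 / real n < \<bar>(\<Sum>j<n. (offdiag (A \<omega>) i j)\<^sup>2) - 1\<bar>}"
      define Y where "Y = (\<Sum>e\<in>?I. (A \<omega> $$ e)\<^sup>2)"
      have ws: "\<omega> \<in> space M" "t + 1 / real n < \<bar>(\<Sum>j<n. (offdiag (A \<omega>) i j)\<^sup>2) - 1\<bar>" using w by auto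
      have "t + 1 / real n < \<bar>Y - 1\<bar>" using ws(2) unfolding eq[OF ws(1)] Y_def .
      then have "real n * (t + 1 / real n) < real n * \<bar>Y - 1\<bar>" using n by (intro mult_strict_left_mono) auto
      then have "t * real n + 1 < \<bar>Y * real n - real n\<bar>"
        using n by (simp add: distrib_left abs_mult[of "real n", symmetric, simplified] right_diff_distrib mult.commute)
      moreover have "t * real (n - 1) \<le> t * real n" using t by (intro mult_left_mono) auto
      ultimately have "t * real (n - 1) \<le> \<bar>Y * real n - real (n - 1)\<bar>" using n by (simp add: of_nat_diff)
      then show "\<omega> \<in> {\<omega> \<in> space M. t * real (card ?I) \<le> \<bar>(\<Sum>e\<in>?I. (A \<omega> $$ e)\<^sup>2) / (1 / sqrt (real n))\<^sup>2 - real (card ?I)\<bar>}"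
        using w n unfolding card Y_def by (simp add: power_divide)
    qed
    show "{\<omega> \<in> space M. t * real (card ?I) \<le> \<bar>(\<Sum>e\<in>?I. (A \<omega> $$ e)\<^sup>2) / (1 / sqrt (real n))\<^sup>2 - real (card ?I)\<bar>} \<in> events"
      by (intro borel_measurable_le borel_measurable_const borel_measurable_abs borel_measurable_diff borel_measurable_divide
          borel_measurable_sum borel_measurable_power meas)
  qed
  also have "\<dots> \<le> 2 * exp (- real (card ?I) * t\<^sup>2 / 16)"
    using n by (intro chi_square_concentration[OF _ ind _ X t]) auto
  finally show ?thesis unfolding card .
qed

text \<open>The inner product is a quarter of the difference between the squared norms of the sum
  and of the difference of the two rows. Both consist of independent Gaussians of variance 2 / n
  once the columns \<open>i\<close> and \<open>i'\<close> are removed; there the product vanishes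
  because \<open>offdiag\<close> has zero diagonal.\<close>

lemma GOE_row_inner:
  assumes G: "GOE n M A" and i: "i < n" "i' < n" "i \<noteq> i'" and t: "0 < t" "t \<le> 1"
  shows "measure M {\<omega> \<in> space M. t < \<bar>\<Sum>j<n. offdiag (A \<omega>) i j * offdiag (A \<omega>) i' j\<bar>} \<le> 4 * exp (- real (n - 2) * t\<^sup>2 / 16)"
proof -
  interpret prob_space M by (rule GOE_prob_space[OF G])
  define L where "L = {..<n} - {i, i'}"
  define K where "K = (\<lambda>l. {edge i l, edge i' l})"
  \<comment> \<open>The sign \<open>s\<close> is 1 for the sum and -1 for the difference of the
    rows.\<close>
  define c where "c = (\<lambda>s l e. if e = edge i l then 1 else s :: real)"
  define Y where "Y = (\<lambda>s l \<omega>. \<Sum>e\<in>K l. c s l e * A \<omega> $$ e)"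
  have n: "n \<ge> 2" using i by linarith
  have L: "finite L" "card L = n - 2" using i by (auto simp: L_def card_Diff_subset)
  have K: "K l \<subseteq> edges n" "finite (K l)" "K l \<noteq> {}" "card (K l) = 2" if "l \<in> L" for l
    using that i by (auto simp: K_def L_def edge_eq_iff intro!: edge_in_edges)
  have disj: "disjoint_family_on K L"
    unfolding disjoint_family_on_def K_def L_def by (auto simp: edge_eq_iff)
  have \<sigma>: "0 < 1 / sqrt (real n)" using n by simp

  have Yeq: "Y s l \<omega> = offdiag (A \<omega>) i l + s * offdiag (A \<omega>) i' l" if "l \<in> L" "\<omega> \<in> space M" for s l \<omega>
  proof -
    have ne: "edge i l \<noteq> edge i' l" using i by (auto simp: edge_eq_iff)
    have "offdiag (A \<omega>) i l = A \<omega> $$ edge i l" "offdiag (A \<omega>) i' l = A \<omega> $$ edge i' l"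
      using that i by (auto simp: L_def intro!: offdiag_edge[OF GOE_carrier[OF G that(2)] GOE_sym[OF G that(2)]])
    then show ?thesis using ne by (simp add: Y_def K_def c_def)
  qed
  define s2 where "s2 = 1 / sqrt (real n) * sqrt 2"
  have s2: "s2 > 0" "s2\<^sup>2 = 2 / real n" using n by (auto simp: s2_def power_mult_distrib power_divide)
  have ind: "indep_vars (\<lambda>_. borel) (Y s) L" for s
    unfolding Y_def by (rule grouped_linear_normal(1)[OF GOE_edges_indep[OF G] GOE_edges_normal[OF G] \<sigma> K(1,2) disj])
  have norm: "distributed M lborel (Y s l) (normal_density 0 s2)" if "l \<in> L" "s\<^sup>2 = 1" for s l
  proof -
    have "distributed M lborel (\<lambda>\<omega>. \<Sum>e\<in>K l. c s l e * A \<omega> $$ e) (normal_density 0 (1 / sqrt (real n) * sqrt (real (card (K l)))))"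
      by (rule grouped_linear_normal(2)[OF GOE_edges_indep[OF G] GOE_edges_normal[OF G] \<sigma> K(1,2) disj that(1) K(3)[OF that(1)]])
        (use that(2) in \<open>auto simp: c_def\<close>)
    then show ?thesis unfolding Y_def s2_def using K(4)[OF that(1)] by simp
  qed
  have Ym: "Y s l \<in> borel_measurable M" if "l \<in> L" "s\<^sup>2 = 1" for s l
    using norm[OF that] by (simp add: distributed_def)
  define Ev where "Ev = (\<lambda>s. {\<omega> \<in> space M. t * real (card L) \<le> \<bar>(\<Sum>l\<in>L. (Y s l \<omega>)\<^sup>2) / s2\<^sup>2 - real (card L)\<bar>})"
  have Evm: "Ev s \<in> events" if "s\<^sup>2 = 1" for s
    unfolding Ev_def
    by (intro borel_measurable_le borel_measurable_const borel_measurable_abs borel_measurable_diff borel_measurable_divide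
          borel_measurable_sum borel_measurable_power Ym that)
  have "prob {\<omega> \<in> space M. t < \<bar>\<Sum>j<n. offdiag (A \<omega>) i j * offdiag (A \<omega>) i' j\<bar>} \<le> prob (Ev 1 \<union> Ev (-1))"
  proof (rule finite_measure_mono)
    show "{\<omega> \<in> space M. t < \<bar>\<Sum>j<n. offdiag (A \<omega>) i j * offdiag (A \<omega>) i' j\<bar>} \<subseteq> Ev 1 \<union> Ev (-1)"
    proof (rule subsetI, rule ccontr)
      fix \<omega> assume w: "\<omega> \<in> {\<omega> \<in> space M. t < \<bar>\<Sum>j<n. offdiag (A \<omega>) i j * offdiag (A \<omega>) i' j\<bar>}" and nw: "\<omega> \<notin> Ev 1 \<union> Ev (-1)"
      define m where "m = real (card L)"
      define P where "P = (\<Sum>l\<in>L. (Y 1 l \<omega>)\<^sup>2)"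
      define Q where "Q = (\<Sum>l\<in>L. (Y (-1) l \<omega>)\<^sup>2)"
      have "(\<Sum>j<n. offdiag (A \<omega>) i j * offdiag (A \<omega>) i' j) = (\<Sum>j\<in>L. offdiag (A \<omega>) i j * offdiag (A \<omega>) i' j)"
        unfolding L_def by (intro sum.mono_neutral_right) (auto simp: offdiag_def)
      also have "\<dots> = (P - Q) / 4"
        unfolding P_def Q_def sum_subtractf[symmetric] sum_divide_distrib using w
        by (intro sum.cong refl) (simp add: Yeq power2_eq_square algebra_simps)
      finally have PQ: "(\<Sum>j<n. offdiag (A \<omega>) i j * offdiag (A \<omega>) i' j) = (P - Q) / 4" .
      have "t < \<bar>\<Sum>j<n. offdiag (A \<omega>) i j * offdiag (A \<omega>) i' j\<bar>" using w by blast
      then have 1: "t < \<bar>(P - Q) / 4\<bar>" unfolding PQ .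
      have "\<bar>P / s2\<^sup>2 - m\<bar> < t * m" "\<bar>Q / s2\<^sup>2 - m\<bar> < t * m" using nw w by (auto simp: Ev_def P_def Q_def m_def)
      then have "\<bar>P / s2\<^sup>2 - Q / s2\<^sup>2\<bar> < 2 * (t * m)" by linarith
      moreover have "P / s2\<^sup>2 - Q / s2\<^sup>2 = real n * (P - Q) / 2" unfolding s2(2) by (simp add: field_simps)
      ultimately have "\<bar>real n * (P - Q) / 2\<bar> < 2 * (t * m)" by simp
      then have "real n * \<bar>P - Q\<bar> < 4 * (t * m)" by (simp add: abs_mult)
      also have "\<dots> \<le> 4 * (t * real n)" using t n by (simp add: m_def L(2))
      finally have "\<bar>P - Q\<bar> < 4 * t" using n by simp
      then show False using 1 by simp
    qed
    show "Ev 1 \<union> Ev (-1) \<in> events" by (intro sets.Un Evm) auto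
  qed
  also have "\<dots> \<le> prob (Ev 1) + prob (Ev (-1))" by (intro measure_Un_le Evm) auto
  also have "\<dots> \<le> 2 * exp (- real (card L) * t\<^sup>2 / 16) + 2 * exp (- real (card L) * t\<^sup>2 / 16)"
    unfolding Ev_def by (intro add_mono chi_square_concentration[OF L(1) ind s2(1) norm t]) auto
  finally show ?thesis by (simp add: L(2))
qed

section \<open>Norms of sparse principal submatrices\<close>

text \<open>Extensional functions, so that vectors differing only outside \<open>{..<n}\<close> are
  identified and the ball is finite.\<close>

definition lattice_ball :: "nat \<Rightarrow> real \<Rightarrow> (nat \<Rightarrow> int) set" where
  "lattice_ball n B = {z \<in> PiE {..<n} (\<lambda>_. UNIV). real_of_int (\<Sum>i<n. (z i)\<^sup>2) \<le> B}"

text \<open>Dividing by 4 sqrt (\<eta> n) turns these vectors into a net for the unit vectors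
  supported on at most \<eta> n coordinates. An integer vector of squared norm at most 16 \<eta> n
  has at most that many nonzero entries, so the count handles the choice of the support by
  itself.\<close>

definition net_bound :: "nat \<Rightarrow> real \<Rightarrow> real \<Rightarrow> real mat \<Rightarrow> bool" where
  "net_bound n \<eta> t A \<longleftrightarrow> (\<forall>z\<in>lattice_ball n (16 * (\<eta> * real n)). \<bar>qform n (offdiag A) (\<lambda>i. real_of_int (z i))\<bar> < t * (16 * (\<eta> * real n)))"

lemma qform_measurable:
  assumes "GOE n M A"
  shows "(\<lambda>\<omega>. qform n (offdiag (A \<omega>)) z) \<in> borel_measurable M"
  unfolding qform_def
  by (intro borel_measurable_sum borel_measurable_times borel_measurable_const offdiag_measurable[OF assms])

text \<open>Union bound with \<rho> = \<eta> / 2 in the lattice count: the logarithm of the number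
  of vectors is at most n (2 \<eta> + 16 \<eta> ln (2 / \<eta>)), against the exponent n t^2 / 4 of
  a single vector.\<close>

lemma GOE_net_bound:
  assumes G: "GOE n M A" and n: "n \<ge> 1" and \<eta>: "0 < \<eta>" "\<eta> \<le> 1" and t: "t \<ge> 0"
  shows "{\<omega> \<in> space M. \<not> net_bound n \<eta> t (A \<omega>)} \<in> sets M"
    "measure M {\<omega> \<in> space M. \<not> net_bound n \<eta> t (A \<omega>)} \<le> 2 * exp (- real n * (t\<^sup>2 / 4 - 2 * \<eta> - 16 * \<eta> * ln (2 / \<eta>)))"
proof -
  interpret prob_space M by (rule GOE_prob_space[OF G])
  define S where "S = 16 * (\<eta> * real n)"
  have S: "S > 0" using \<eta> n by (simp add: S_def)
  let ?B = "lattice_ball n S"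
  have fin: "finite ?B" and card: "real (card ?B) \<le> exp (4 * (\<eta> / 2) * real n) * (\<eta> / 2) powr (- S)"
    unfolding lattice_ball_def using lattice_points_count[of "\<eta> / 2" S n] \<eta> S by auto
  define Ev where "Ev = (\<lambda>z. {\<omega> \<in> space M. t * S \<le> \<bar>qform n (offdiag (A \<omega>)) (\<lambda>i. real_of_int (z i))\<bar>})"
  have Evm: "Ev z \<in> events" for z
    unfolding Ev_def by (intro borel_measurable_le borel_measurable_const borel_measurable_abs qform_measurable[OF G])
  have eq: "{\<omega> \<in> space M. \<not> net_bound n \<eta> t (A \<omega>)} = (\<Union>z\<in>?B. Ev z)"
    by (auto simp: net_bound_def Ev_def S_def not_less)
  show "{\<omega> \<in> space M. \<not> net_bound n \<eta> t (A \<omega>)} \<in> sets M"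
    unfolding eq using fin Evm by (intro sets.finite_UN) auto
  have "measure M {\<omega> \<in> space M. \<not> net_bound n \<eta> t (A \<omega>)} \<le> (\<Sum>z\<in>?B. measure M (Ev z))"
    unfolding eq using fin Evm by (intro finite_measure_subadditive_finite) auto
  also have "\<dots> \<le> (\<Sum>z\<in>?B. 2 * exp (- real n * t\<^sup>2 / 4))"
  proof (intro sum_mono)
    fix z assume "z \<in> ?B"
    then have "(\<Sum>i<n. (real_of_int (z i))\<^sup>2) \<le> S" by (simp add: lattice_ball_def)
    then show "measure M (Ev z) \<le> 2 * exp (- real n * t\<^sup>2 / 4)"
      unfolding Ev_def by (intro GOE_qform_tail[OF G n _ S t])
  qed
  also have "\<dots> = real (card ?B) * (2 * exp (- real n * t\<^sup>2 / 4))" by simp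
  also have "\<dots> \<le> exp (4 * (\<eta> / 2) * real n) * (\<eta> / 2) powr (- S) * (2 * exp (- real n * t\<^sup>2 / 4))"
    by (intro mult_right_mono card) auto
  also have "(\<eta> / 2) powr (- S) = exp (S * ln (2 / \<eta>))"
    using \<eta> by (simp add: powr_def ln_div algebra_simps)
  also have "exp (4 * (\<eta> / 2) * real n) * exp (S * ln (2 / \<eta>)) * (2 * exp (- real n * t\<^sup>2 / 4))
     = 2 * exp (4 * (\<eta> / 2) * real n + S * ln (2 / \<eta>) + - real n * t\<^sup>2 / 4)"
    by (simp only: exp_add mult_ac)
  also have "4 * (\<eta> / 2) * real n + S * ln (2 / \<eta>) + - real n * t\<^sup>2 / 4 = - real n * (t\<^sup>2 / 4 - 2 * \<eta> - 16 * \<eta> * ln (2 / \<eta>))"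
    by (simp add: S_def algebra_simps)
  finally show "measure M {\<omega> \<in> space M. \<not> net_bound n \<eta> t (A \<omega>)} \<le> 2 * exp (- real n * (t\<^sup>2 / 4 - 2 * \<eta> - 16 * \<eta> * ln (2 / \<eta>)))" .
qed

lemma net_bound_qform:
  assumes A: "A \<in> carrier_mat n n" "transpose_mat A = A" and n: "n \<ge> 1" and \<eta>: "0 < \<eta>" and nb: "net_bound n \<eta> t A"
    and U: "U \<subseteq> {..<n}" "real (card U) \<le> \<eta> * real n" and v: "\<forall>i. v i \<noteq> 0 \<longrightarrow> i \<in> U"
  shows "\<bar>qform n (offdiag A) v\<bar> \<le> 2 * t * (\<Sum>i<n. (v i)\<^sup>2)"
proof (rule qform_bound_from_lattice[OF _ U(1) _ U(2) _ v])
  show "offdiag A i j = offdiag A j i" for i j by (rule offdiag_sym[OF A])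
  show "0 < \<eta> * real n" using \<eta> n by simp
  fix z :: "nat \<Rightarrow> int" assume z: "\<forall>i. z i \<noteq> 0 \<longrightarrow> i \<in> U" "real_of_int (\<Sum>i<n. (z i)\<^sup>2) \<le> 16 * (\<eta> * real n)"
  define z' where "z' = restrict z {..<n}"
  have "(\<Sum>i<n. (z' i)\<^sup>2) = (\<Sum>i<n. (z i)\<^sup>2)" by (intro sum.cong) (auto simp: z'_def)
  then have "z' \<in> lattice_ball n (16 * (\<eta> * real n))" using z(2) by (auto simp: lattice_ball_def z'_def)
  then have "\<bar>qform n (offdiag A) (\<lambda>i. real_of_int (z' i))\<bar> < t * (16 * (\<eta> * real n))" using nb by (simp add: net_bound_def)
  moreover have "qform n (offdiag A) (\<lambda>i. real_of_int (z' i)) = qform n (offdiag A) (\<lambda>i. real_of_int (z i))"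
    unfolding qform_def by (intro sum.cong refl) (auto simp: z'_def)
  ultimately show "\<bar>qform n (offdiag A) (\<lambda>i. real_of_int (z i))\<bar> \<le> t * (16 * (\<eta> * real n))" by simp
qed

section \<open>Gaussian tails and exceedance patterns\<close>

definition gauss_tail :: "real \<Rightarrow> real" where
  "gauss_tail t = measure (density lborel std_normal_density) {t<..}"

lemma prob_space_std_normal: "prob_space (density lborel std_normal_density)"
  by (rule prob_space_normal_density) simp

lemma gauss_tail_antimono: "s \<le> t \<Longrightarrow> gauss_tail t \<le> gauss_tail s"
proof -
  interpret prob_space "density lborel std_normal_density" by (rule prob_space_std_normal)
  show "s \<le> t \<Longrightarrow> gauss_tail t \<le> gauss_tail s"
    unfolding gauss_tail_def by (intro finite_measure_mono) auto
qed

lemma gauss_tail_nonneg: "gauss_tail t \<ge> 0"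
  by (simp add: gauss_tail_def)

text \<open>The antiderivative of \<open>\<phi>(x) (1 + 1/x\<^sup>2)\<close> is \<open>-\<phi>(x)/x\<close>, which traps the tail between two multiples of \<open>\<phi>(t)/t\<close>.\<close>

lemma gauss_tail_mills:
  assumes t: "t > 0"
  shows "gauss_tail t \<le> std_normal_density t / t" "std_normal_density t / t \<le> (1 + 1 / t\<^sup>2) * gauss_tail t"
proof -
  interpret prob_space "density lborel std_normal_density" by (rule prob_space_std_normal)
  define C where "C = 1 / sqrt (2 * pi)"
  have phi: "std_normal_density = (\<lambda>x. C * exp (- x\<^sup>2 / 2))"
    by (rule ext) (simp add: std_normal_density_def C_def)
  define f where "f = (\<lambda>x. std_normal_density x * (1 + 1 / x\<^sup>2))"
  have [measurable]: "f \<in> borel_measurable borel" unfolding f_def by measurable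
  have fpos: "f x \<ge> 0" for x unfolding f_def by (intro mult_nonneg_nonneg) auto
  have I: "(\<integral>\<^sup>+x. ennreal (f x) * indicator {t ..} x \<partial>lborel) = 0 - (- std_normal_density t / t)"
  proof (rule nn_integral_FTC_atLeast)
    show "DERIV (\<lambda>x. - std_normal_density x / x) x :> f x" if "t \<le> x" for x
    proof -
      have "x > 0" using t that by simp
      then show ?thesis unfolding f_def phi
        by (auto intro!: derivative_eq_intros simp: field_simps power2_eq_square)
    qed
    show "((\<lambda>x. - std_normal_density x / x) \<longlongrightarrow> 0) at_top"
      unfolding phi by real_asymp
  qed (auto simp: fpos)
  have T: "ennreal (gauss_tail t) = (\<integral>\<^sup>+x. ennreal (std_normal_density x) * indicator {t<..} x \<partial>lborel)"
    unfolding gauss_tail_def by (subst emeasure_eq_measure[symmetric], subst emeasure_density) auto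
  also have "\<dots> \<le> (\<integral>\<^sup>+x. ennreal (f x) * indicator {t ..} x \<partial>lborel)"
  proof (intro nn_integral_mono)
    fix x
    have "std_normal_density x * 1 \<le> f x" unfolding f_def by (intro mult_left_mono) auto
    then show "ennreal (std_normal_density x) * indicator {t<..} x \<le> ennreal (f x) * indicator {t ..} x"
      by (auto simp: indicator_def intro!: ennreal_leI)
  qed
  finally show "gauss_tail t \<le> std_normal_density t / t"
    unfolding I using t by (subst (asm) ennreal_le_iff) auto
  have "(\<integral>\<^sup>+x. ennreal (f x) * indicator {t ..} x \<partial>lborel) \<le> (\<integral>\<^sup>+x. ennreal (1 + 1 / t\<^sup>2) * (ennreal (std_normal_density x) * indicator {t<..} x) \<partial>lborel)"
  proof (rule nn_integral_mono_AE)
    show "AE x in lborel. ennreal (f x) * indicator {t ..} x \<le> ennreal (1 + 1 / t\<^sup>2) * (ennreal (std_normal_density x) * indicator {t<..} x)"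
      using AE_lborel_singleton[of t]
    proof eventually_elim
      case (elim x)
      show ?case
      proof (cases "t < x")
        case True
        then have "1 / x\<^sup>2 \<le> 1 / t\<^sup>2" using t by (intro divide_left_mono) (auto intro: power_mono)
        then have "f x \<le> (1 + 1 / t\<^sup>2) * std_normal_density x"
          unfolding f_def by (subst mult.commute) (intro mult_right_mono, auto)
        then have "ennreal (f x) \<le> ennreal ((1 + 1 / t\<^sup>2) * std_normal_density x)" by (rule ennreal_leI)
        also have "\<dots> = ennreal (1 + 1 / t\<^sup>2) * ennreal (std_normal_density x)" by (rule ennreal_mult) auto
        finally show ?thesis using True by simp
      qed (use elim in auto)
    qed
  qed
  also have "\<dots> = ennreal (1 + 1 / t\<^sup>2) * ennreal (gauss_tail t)"
    unfolding T by (intro nn_integral_cmult) auto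
  also have "\<dots> = ennreal ((1 + 1 / t\<^sup>2) * gauss_tail t)"
    by (simp add: ennreal_mult gauss_tail_nonneg)
  finally show "std_normal_density t / t \<le> (1 + 1 / t\<^sup>2) * gauss_tail t"
    unfolding I by (subst (asm) ennreal_le_iff) (auto intro!: mult_nonneg_nonneg simp: gauss_tail_nonneg)
qed

lemma a_seq_at_top: "filterlim a_seq at_top sequentially"
  unfolding a_seq_def by real_asymp

lemma a_seq_pos: "n \<ge> 2 \<Longrightarrow> a_seq n > 0"
  by (simp add: a_seq_def)

text \<open>The centring \<open>b'_seq\<close> is such that \<open>n\<close> times the density
  there, divided by \<open>a_seq n\<close>, tends to 1; moving the point by w / a multiplies the
  density by about exp (- w), and Mills' bounds transfer this to the tail. Only convergence of w is
  assumed, so that perturbed levels are covered.\<close>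

lemma gauss_tail_asymptotic:
  assumes v: "(\<lambda>n. a_seq n * (v n - b'_seq n)) \<longlonglongrightarrow> x"
  shows "(\<lambda>n. real n * gauss_tail (v n)) \<longlonglongrightarrow> exp (- x)"
proof -
  define w where "w = (\<lambda>n. a_seq n * (v n - b'_seq n))"
  have apos: "eventually (\<lambda>n. a_seq n > 0) sequentially"
    using eventually_ge_at_top[of 2] by eventually_elim (rule a_seq_pos)
  \<comment> \<open>Expanding the square of b', the terms - L + s / 2 cancel the prefactor exactly.
    What remains is exp (- s^2 / (16 L)), with \<open>L = ln n\<close> and \<open>s\<close> of order
    ln ln n.\<close>
  have L1: "(\<lambda>n. real n / sqrt (2 * pi) * exp (- (b'_seq n)\<^sup>2 / 2) / a_seq n) \<longlonglongrightarrow> 1"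
  proof (rule Lim_transform_eventually)
    define c where "c = ln (4 * pi)"
    have "(\<lambda>n. (ln (ln (real n)) + c)\<^sup>2 / (16 * ln (real n))) \<longlonglongrightarrow> 0" by real_asymp
    then have "(\<lambda>n. exp (- ((ln (ln (real n)) + c)\<^sup>2 / (16 * ln (real n))))) \<longlonglongrightarrow> exp (- 0)"
      by (intro tendsto_intros)
    then show "(\<lambda>n. exp (- ((ln (ln (real n)) + c)\<^sup>2 / (16 * ln (real n))))) \<longlonglongrightarrow> 1" by simp
    show "eventually (\<lambda>n. exp (- ((ln (ln (real n)) + c)\<^sup>2 / (16 * ln (real n)))) =
        real n / sqrt (2 * pi) * exp (- (b'_seq n)\<^sup>2 / 2) / a_seq n) sequentially"
      using eventually_ge_at_top[of 2]
    proof eventually_elim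
      case (elim n)
      define L where "L = ln (real n)"
      define s where "s = ln L + c"
      have L: "L > 0" using elim by (simp add: L_def)
      have a2: "(a_seq n)\<^sup>2 = 2 * L" using L by (simp add: a_seq_def L_def)
      have a: "a_seq n > 0" by (rule a_seq_pos[OF elim])
      have "b'_seq n = a_seq n - s / (2 * a_seq n)" by (simp add: b'_seq_def a_seq_def s_def L_def c_def)
      then have "(b'_seq n)\<^sup>2 = (a_seq n)\<^sup>2 - 2 * (a_seq n * (s / (2 * a_seq n))) + (s / (2 * a_seq n))\<^sup>2"
        by (simp add: power2_diff mult.assoc)
      also have "a_seq n * (s / (2 * a_seq n)) = s / 2" using a by simp
      also have "(s / (2 * a_seq n))\<^sup>2 = s\<^sup>2 / (4 * (a_seq n)\<^sup>2)" by (simp add: power_divide power_mult_distrib)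
      finally have "(b'_seq n)\<^sup>2 = (a_seq n)\<^sup>2 - s + s\<^sup>2 / (4 * (a_seq n)\<^sup>2)" by simp
      then have "- (b'_seq n)\<^sup>2 / 2 = - L + s / 2 + - (s\<^sup>2 / (16 * L))"
        unfolding a2 using L by (simp add: field_simps)
      then have e: "exp (- (b'_seq n)\<^sup>2 / 2) = exp (- L) * exp (s / 2) * exp (- (s\<^sup>2 / (16 * L)))"
        by (simp only: exp_add)
      have eL: "exp (- L) = 1 / real n" using elim by (simp add: L_def exp_minus inverse_eq_divide)
      have "(exp (s / 2))\<^sup>2 = exp s" by (simp add: power2_eq_square exp_add[symmetric])
      also have "\<dots> = L * (4 * pi)" using L by (simp add: s_def c_def exp_add)
      finally have "exp (s / 2) = sqrt (L * (4 * pi))" by (metis exp_ge_zero real_sqrt_unique)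
      also have "\<dots> = sqrt (2 * pi) * a_seq n" by (simp add: a_seq_def L_def real_sqrt_mult[symmetric] mult_ac)
      finally have es: "exp (s / 2) = sqrt (2 * pi) * a_seq n" .
      have "real n / sqrt (2 * pi) * exp (- (b'_seq n)\<^sup>2 / 2) / a_seq n = exp (- (s\<^sup>2 / (16 * L)))"
        unfolding e eL es using a elim by simp
      then show ?case by (simp add: s_def L_def)
    qed
  qed
  have L2: "(\<lambda>n. b'_seq n / a_seq n) \<longlonglongrightarrow> 1" unfolding a_seq_def b'_seq_def by real_asymp
  have L3: "(\<lambda>n. 1 / (a_seq n)\<^sup>2) \<longlonglongrightarrow> 0" unfolding a_seq_def by real_asymp
  have W: "w \<longlonglongrightarrow> x" using v by (simp add: w_def)
  have vw: "eventually (\<lambda>n. v n = b'_seq n + w n / a_seq n) sequentially"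
    using apos by eventually_elim (simp add: w_def)
  have VA0: "(\<lambda>n. b'_seq n / a_seq n + w n * (1 / (a_seq n)\<^sup>2)) \<longlonglongrightarrow> 1 + x * 0"
    by (intro tendsto_add tendsto_mult L2 L3 W)
  have VA: "(\<lambda>n. v n / a_seq n) \<longlonglongrightarrow> 1"
  proof (rule Lim_transform_eventually)
    show "(\<lambda>n. b'_seq n / a_seq n + w n * (1 / (a_seq n)\<^sup>2)) \<longlonglongrightarrow> 1" using VA0 by simp
    show "eventually (\<lambda>n. b'_seq n / a_seq n + w n * (1 / (a_seq n)\<^sup>2) = v n / a_seq n) sequentially"
      using vw by eventually_elim (simp add: add_divide_distrib power2_eq_square)
  qed
  have vtop: "filterlim v at_top sequentially"
  proof -
    have "filterlim (\<lambda>n. (v n / a_seq n) * a_seq n) at_top sequentially"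
      by (rule filterlim_tendsto_pos_mult_at_top[OF VA _ a_seq_at_top]) simp
    moreover have "eventually (\<lambda>n. (v n / a_seq n) * a_seq n = v n) sequentially"
      using apos by eventually_elim simp
    ultimately show ?thesis by (simp cong: filterlim_cong)
  qed
  have vpos: "eventually (\<lambda>n. v n > 0) sequentially" using vtop by (auto simp: filterlim_at_top_dense)
  have D: "(\<lambda>n. real n * (std_normal_density (v n) / v n)) \<longlonglongrightarrow> exp (- x)"
  proof (rule Lim_transform_eventually)
    have "(\<lambda>n. (real n / sqrt (2 * pi) * exp (- (b'_seq n)\<^sup>2 / 2) / a_seq n)
        * exp (- ((b'_seq n / a_seq n) * w n + (w n)\<^sup>2 * (1 / (a_seq n)\<^sup>2) / 2)) / (v n / a_seq n)) \<longlonglongrightarrow> 1 * exp (- (1 * x + x\<^sup>2 * 0 / 2)) / 1"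
      by (intro tendsto_intros L1 L2 L3 W VA) auto
    then show "(\<lambda>n. (real n / sqrt (2 * pi) * exp (- (b'_seq n)\<^sup>2 / 2) / a_seq n)
        * exp (- ((b'_seq n / a_seq n) * w n + (w n)\<^sup>2 * (1 / (a_seq n)\<^sup>2) / 2)) / (v n / a_seq n)) \<longlonglongrightarrow> exp (- x)" by simp
    show "eventually (\<lambda>n. (real n / sqrt (2 * pi) * exp (- (b'_seq n)\<^sup>2 / 2) / a_seq n)
        * exp (- ((b'_seq n / a_seq n) * w n + (w n)\<^sup>2 * (1 / (a_seq n)\<^sup>2) / 2)) / (v n / a_seq n)
        = real n * (std_normal_density (v n) / v n)) sequentially"
      using vw apos vpos
    proof eventually_elim
      case (elim n)
      have "- (v n)\<^sup>2 / 2 = - (b'_seq n)\<^sup>2 / 2 + - ((b'_seq n / a_seq n) * w n + (w n)\<^sup>2 * (1 / (a_seq n)\<^sup>2) / 2)"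
        unfolding elim(1) using elim(2) by (simp add: field_simps power2_eq_square)
      then have e: "exp (- (v n)\<^sup>2 / 2) = exp (- (b'_seq n)\<^sup>2 / 2) * exp (- ((b'_seq n / a_seq n) * w n + (w n)\<^sup>2 * (1 / (a_seq n)\<^sup>2) / 2))"
        by (simp only: exp_add)
      show ?case unfolding std_normal_density_def e using elim(2,3) by simp
    qed
  qed
  have inv0: "(\<lambda>n. 1 / (v n)\<^sup>2) \<longlonglongrightarrow> 0"
    using tendsto_power[OF tendsto_inverse_0_at_top[OF vtop], of 2] by (simp add: power_inverse divide_inverse)
  show ?thesis
  proof (rule tendsto_sandwich[OF _ _ _ D])
    show "eventually (\<lambda>n. real n * gauss_tail (v n) \<le> real n * (std_normal_density (v n) / v n)) sequentially"
      using vpos by eventually_elim (intro mult_left_mono gauss_tail_mills(1), auto)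
    show "eventually (\<lambda>n. real n * (std_normal_density (v n) / v n) / (1 + 1 / (v n)\<^sup>2) \<le> real n * gauss_tail (v n)) sequentially"
      using vpos
    proof eventually_elim
      case (elim n)
      have "std_normal_density (v n) / v n / (1 + 1 / (v n)\<^sup>2) \<le> gauss_tail (v n)"
        using gauss_tail_mills(2)[OF elim] by (subst pos_divide_le_eq) (auto simp: mult.commute intro!: add_pos_nonneg)
      then have "real n * (std_normal_density (v n) / v n / (1 + 1 / (v n)\<^sup>2)) \<le> real n * gauss_tail (v n)"
        by (intro mult_left_mono) auto
      then show ?case by simp
    qed
    have "(\<lambda>n. real n * (std_normal_density (v n) / v n) / (1 + 1 / (v n)\<^sup>2)) \<longlonglongrightarrow> exp (- x) / (1 + 0)"
      by (intro tendsto_divide D tendsto_add tendsto_const inv0) auto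
    then show "(\<lambda>n. real n * (std_normal_density (v n) / v n) / (1 + 1 / (v n)\<^sup>2)) \<longlonglongrightarrow> exp (- x)" by simp
  qed
qed

section \<open>Cells of exceedance patterns and their Gaussian weights\<close>

text \<open>Separate thresholds for exceeding (\<open>l\<close>) and for not exceeding
  (\<open>h\<close>) let a cell be shrunk or enlarged when a variable is known only up to a small
  error. For equal thresholds the cells are the fibres of \<open>pattern\<close>.\<close>

definition cell :: "nat \<Rightarrow> (nat \<Rightarrow> real) \<Rightarrow> (nat \<Rightarrow> real) \<Rightarrow> nat set \<Rightarrow> real set" where
  "cell k l h b = {y. (\<forall>i\<in>b. l i < y) \<and> (\<forall>i\<in>{1..k} - b. y \<le> h i)}"

text \<open>The limit of \<open>n\<close> times the Gaussian measure of a cell. The values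
  \<open>x i\<close> need not be ordered, so the interval from the largest exceeded to the smallest
  unexceeded level may be empty; hence the maximum with 0. If every level is exceeded the interval
  is a half-line and nothing is subtracted.\<close>

definition cell_weight :: "nat \<Rightarrow> (nat \<Rightarrow> real) \<Rightarrow> nat set \<Rightarrow> real" where
  "cell_weight k x b = max 0 (exp (- Max (x ` b)) - (if {1..k} - b = {} then 0 else exp (- Min (x ` ({1..k} - b)))))"

lemma cell_borel [measurable]: "cell k l h b \<in> sets borel" if "b \<subseteq> {1..k}"
proof -
  have fin: "finite b" using that by (rule finite_subset) simp
  have "cell k l h b = (\<Inter>i\<in>b. {l i<..}) \<inter> (\<Inter>i\<in>{1..k} - b. {..h i})" by (auto simp: cell_def)
  moreover have inter: "(\<Inter>i\<in>D. f i) \<in> sets borel" if "finite D" "\<And>i. f i \<in> sets borel" for D and f :: "nat \<Rightarrow> real set"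
    using that by (cases "D = {}") (auto intro!: sets.finite_INT)
  have "(\<Inter>i\<in>b. {l i<..}) \<in> sets borel" "(\<Inter>i\<in>{1..k} - b. {..h i}) \<in> sets borel"
    using fin by (auto intro!: inter)
  ultimately show ?thesis by auto
qed

lemma cell_measure:
  assumes b: "b \<subseteq> {1..k}" "b \<noteq> {}"
  shows "measure (density lborel std_normal_density) (cell k l h b) =
    max 0 (gauss_tail (Max (l ` b)) - (if {1..k} - b = {} then 0 else gauss_tail (Min (h ` ({1..k} - b)))))"
proof -
  interpret prob_space "density lborel std_normal_density" by (rule prob_space_std_normal)
  have fin: "finite b" using b(1) by (rule finite_subset) simp
  define D where "D = {1..k} - b"
  have finD: "finite D" by (simp add: D_def)
  have m1: "Max (l ` b) < y \<longleftrightarrow> (\<forall>i\<in>b. l i < y)" for y using fin b by simp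
  show ?thesis unfolding D_def[symmetric]
  proof (cases "D = {}")
    case True
    then have "cell k l h b = {Max (l ` b)<..}" unfolding cell_def D_def[symmetric] by (auto simp: m1)
    then show "measure (density lborel std_normal_density) (cell k l h b) =
      max 0 (gauss_tail (Max (l ` b)) - (if D = {} then 0 else gauss_tail (Min (h ` D))))"
      using True by (simp add: gauss_tail_def)
  next
    case False
    let ?lo = "Max (l ` b)" and ?hi = "Min (h ` D)"
    have m2: "y \<le> ?hi \<longleftrightarrow> (\<forall>i\<in>D. y \<le> h i)" for y using finD False by simp
    have c: "cell k l h b = {?lo<..} - {?hi<..}"
      unfolding cell_def D_def[symmetric] by (rule Set.set_eqI) (simp add: m1 not_less m2 del: Min_ge_iff Max_less_iff)
    show "measure (density lborel std_normal_density) (cell k l h b) =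
      max 0 (gauss_tail (Max (l ` b)) - (if D = {} then 0 else gauss_tail (Min (h ` D))))"
    proof (cases "?lo \<le> ?hi")
      case True
      then have "measure (density lborel std_normal_density) (cell k l h b) = gauss_tail ?lo - gauss_tail ?hi"
        unfolding c gauss_tail_def by (intro finite_measure_Diff) auto
      then show ?thesis using False gauss_tail_antimono[OF True] by simp
    next
      case hl: False
      then have e: "cell k l h b = {}" unfolding c by auto
      have "gauss_tail ?lo \<le> gauss_tail ?hi" using hl by (intro gauss_tail_antimono) linarith
      then show ?thesis using False unfolding e by simp
    qed
  qed
qed

lemma scaled_Max_tendsto:
  assumes "finite I" "I \<noteq> {}" and "\<And>i. i \<in> I \<Longrightarrow> (\<lambda>n. a_seq n * (l i n - b'_seq n)) \<longlonglongrightarrow> x i"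
  shows "(\<lambda>n. a_seq n * (Max ((\<lambda>i. l i n) ` I) - b'_seq n)) \<longlonglongrightarrow> Max (x ` I)"
  using assms
proof (induction I rule: finite_ne_induct)
  case (insert i F)
  have a0: "a_seq n \<ge> 0" for n by (cases n) (auto simp: a_seq_def)
  have "a_seq n * (Max ((\<lambda>i. l i n) ` insert i F) - b'_seq n) = max (a_seq n * (l i n - b'_seq n)) (a_seq n * (Max ((\<lambda>i. l i n) ` F) - b'_seq n))" for n
    using insert.hyps a0[of n] by (simp add: max_diff_distrib_left max_mult_distrib_left)
  moreover have "(\<lambda>n. max (a_seq n * (l i n - b'_seq n)) (a_seq n * (Max ((\<lambda>i. l i n) ` F) - b'_seq n))) \<longlonglongrightarrow> max (x i) (Max (x ` F))"
    using insert.IH insert.prems by (intro tendsto_max) auto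
  ultimately show ?case using insert.hyps by simp
qed simp

lemma scaled_Min_tendsto:
  assumes "finite I" "I \<noteq> {}" and "\<And>i. i \<in> I \<Longrightarrow> (\<lambda>n. a_seq n * (l i n - b'_seq n)) \<longlonglongrightarrow> x i"
  shows "(\<lambda>n. a_seq n * (Min ((\<lambda>i. l i n) ` I) - b'_seq n)) \<longlonglongrightarrow> Min (x ` I)"
  using assms
proof (induction I rule: finite_ne_induct)
  case (insert i F)
  have a0: "a_seq n \<ge> 0" for n by (cases n) (auto simp: a_seq_def)
  have "a_seq n * (Min ((\<lambda>i. l i n) ` insert i F) - b'_seq n) = min (a_seq n * (l i n - b'_seq n)) (a_seq n * (Min ((\<lambda>i. l i n) ` F) - b'_seq n))" for n
    using insert.hyps a0[of n] by (simp add: min_diff_distrib_left min_mult_distrib_left)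
  moreover have "(\<lambda>n. min (a_seq n * (l i n - b'_seq n)) (a_seq n * (Min ((\<lambda>i. l i n) ` F) - b'_seq n))) \<longlonglongrightarrow> min (x i) (Min (x ` F))"
    using insert.IH insert.prems by (intro tendsto_min) auto
  ultimately show ?case using insert.hyps by simp
qed simp

text \<open>The two families of levels may differ as long as they share their scaled limits;
  shrunken and enlarged cells thus have the same limiting weight, which closes the sandwich for the
  degrees.\<close>

lemma cell_measure_tendsto:
  assumes b: "b \<subseteq> {1..k}" "b \<noteq> {}"
    and l: "\<And>i. i \<in> {1..k} \<Longrightarrow> (\<lambda>n. a_seq n * (l i n - b'_seq n)) \<longlonglongrightarrow> x i"
    and h: "\<And>i. i \<in> {1..k} \<Longrightarrow> (\<lambda>n. a_seq n * (h i n - b'_seq n)) \<longlonglongrightarrow> x i"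
  shows "(\<lambda>n. real n * measure (density lborel std_normal_density) (cell k (\<lambda>i. l i n) (\<lambda>i. h i n) b)) \<longlonglongrightarrow> cell_weight k x b"
proof -
  have fin: "finite b" using b(1) by (rule finite_subset) simp
  have 1: "(\<lambda>n. real n * gauss_tail (Max ((\<lambda>i. l i n) ` b))) \<longlonglongrightarrow> exp (- Max (x ` b))"
    using l b by (intro gauss_tail_asymptotic scaled_Max_tendsto fin) auto
  have 2: "(\<lambda>n. if {1..k} - b = {} then 0 else real n * gauss_tail (Min ((\<lambda>i. h i n) ` ({1..k} - b)))) \<longlonglongrightarrow>
      (if {1..k} - b = {} then 0 else exp (- Min (x ` ({1..k} - b))))"
  proof (cases "{1..k} - b = {}")
    case False
    then have "(\<lambda>n. real n * gauss_tail (Min ((\<lambda>i. h i n) ` ({1..k} - b)))) \<longlonglongrightarrow> exp (- Min (x ` ({1..k} - b)))"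
      using h by (intro gauss_tail_asymptotic scaled_Min_tendsto) auto
    then show ?thesis using False by simp
  qed simp
  have "real n * measure (density lborel std_normal_density) (cell k (\<lambda>i. l i n) (\<lambda>i. h i n) b)
     = max 0 (real n * gauss_tail (Max ((\<lambda>i. l i n) ` b)) - (if {1..k} - b = {} then 0 else real n * gauss_tail (Min ((\<lambda>i. h i n) ` ({1..k} - b)))))" for n
    unfolding cell_measure[OF b] by (simp add: max_mult_distrib_left right_diff_distrib)
  moreover have "(\<lambda>n. max 0 (real n * gauss_tail (Max ((\<lambda>i. l i n) ` b)) - (if {1..k} - b = {} then 0 else real n * gauss_tail (Min ((\<lambda>i. h i n) ` ({1..k} - b)))))) \<longlonglongrightarrow> cell_weight k x b"
    unfolding cell_weight_def by (intro tendsto_max tendsto_const tendsto_diff 1 2)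
  ultimately show ?thesis by simp
qed

text \<open>Uniformity over \<open>J\<close> comes from relabelling: the products depend on
  \<open>b\<close> only through a labelling of \<open>{..<r}\<close>, and there are finitely many of
  these, so one threshold for \<open>n\<close> serves all \<open>J\<close>.\<close>

lemma product_moments_sandwich:
  fixes lo hi :: "nat \<Rightarrow> 'l \<Rightarrow> real" and p :: "nat \<Rightarrow> nat set \<Rightarrow> (nat \<Rightarrow> 'l) \<Rightarrow> real"
  assumes L: "finite L"
    and lo: "\<And>b. b \<in> L \<Longrightarrow> (\<lambda>n. real n * lo n b) \<longlonglongrightarrow> \<tau> b"
    and hi: "\<And>b. b \<in> L \<Longrightarrow> (\<lambda>n. real n * hi n b) \<longlonglongrightarrow> \<tau> b"
    and err: "(\<lambda>n. real n ^ r * err n) \<longlonglongrightarrow> 0"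
    and p: "eventually (\<lambda>n. \<forall>J b. J \<subseteq> {..<n} \<longrightarrow> card J = r \<longrightarrow> b \<in> PiE J (\<lambda>_. L) \<longrightarrow>
        (\<Prod>j\<in>J. lo n (b j)) - err n \<le> p n J b \<and> p n J b \<le> (\<Prod>j\<in>J. hi n (b j)) + err n) sequentially"
    and \<epsilon>: "\<epsilon> > 0"
  shows "eventually (\<lambda>n. \<forall>J b. J \<subseteq> {..<n} \<longrightarrow> card J = r \<longrightarrow> b \<in> PiE J (\<lambda>_. L) \<longrightarrow>
        \<bar>real n ^ r * p n J b - (\<Prod>j\<in>J. \<tau> (b j))\<bar> \<le> \<epsilon>) sequentially"
proof -
  have finP: "finite (PiE {..<r} (\<lambda>_. L))" using L by (intro finite_PiE) auto
  have lim: "eventually (\<lambda>n. \<forall>f\<in>PiE {..<r} (\<lambda>_. L). dist (\<Prod>i<r. real n * q n (f i)) (\<Prod>i<r. \<tau> (f i)) < \<epsilon> / 2) sequentially"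
    if q: "\<forall>b\<in>L. (\<lambda>n. real n * q n b) \<longlonglongrightarrow> \<tau> b" for q
    using \<epsilon> by (intro eventually_ball_finite finP ballI tendstoD tendsto_prod q[rule_format]) auto
  have errs: "eventually (\<lambda>n. dist (real n ^ r * err n) 0 < \<epsilon> / 2) sequentially"
    using \<epsilon> by (intro tendstoD[OF err]) auto
  have lo': "\<forall>b\<in>L. (\<lambda>n. real n * lo n b) \<longlonglongrightarrow> \<tau> b" and hi': "\<forall>b\<in>L. (\<lambda>n. real n * hi n b) \<longlonglongrightarrow> \<tau> b"
    using lo hi by blast+
  show ?thesis using lim[OF lo'] lim[OF hi'] errs p
  proof eventually_elim
    case (elim n)
    show ?case
    proof (intro allI impI)
      fix J b assume J: "J \<subseteq> {..<n}" "card J = r" and b: "b \<in> PiE J (\<lambda>_. L)"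
      have "finite J" using J(1) by (rule finite_subset) simp
      then obtain h where h: "bij_betw h {..<r} J"
        using ex_bij_betw_nat_finite[of J] J(2) by (auto simp: atLeast0LessThan)
      define f where "f = restrict (\<lambda>i. b (h i)) {..<r}"
      have f: "f \<in> PiE {..<r} (\<lambda>_. L)" using b h by (auto simp: f_def PiE_def Pi_def bij_betw_def)
      have re: "(\<Prod>j\<in>J. g (b j)) = (\<Prod>i<r. g (f i))" for g :: "'l \<Rightarrow> real"
        using prod.reindex_bij_betw[OF h, of "\<lambda>j. g (b j)", symmetric] by (simp add: f_def)
      have sc: "real n ^ r * (\<Prod>j\<in>J. g (b j)) = (\<Prod>i<r. real n * g (f i))" for g :: "'l \<Rightarrow> real"
        unfolding re by (simp add: prod.distrib)
      have P: "(\<Prod>j\<in>J. lo n (b j)) - err n \<le> p n J b" "p n J b \<le> (\<Prod>j\<in>J. hi n (b j)) + err n"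
        using elim(4) J b by auto
      have "real n ^ r * ((\<Prod>j\<in>J. lo n (b j)) - err n) \<le> real n ^ r * p n J b" "real n ^ r * p n J b \<le> real n ^ r * ((\<Prod>j\<in>J. hi n (b j)) + err n)"
        by (intro mult_left_mono P; simp)+
      then have "(\<Prod>i<r. real n * lo n (f i)) - real n ^ r * err n \<le> real n ^ r * p n J b"
        "real n ^ r * p n J b \<le> (\<Prod>i<r. real n * hi n (f i)) + real n ^ r * err n"
        by (simp_all only: right_diff_distrib distrib_left sc)
      moreover have "dist (\<Prod>i<r. real n * lo n (f i)) (\<Prod>i<r. \<tau> (f i)) < \<epsilon> / 2" "dist (\<Prod>i<r. real n * hi n (f i)) (\<Prod>i<r. \<tau> (f i)) < \<epsilon> / 2"
        using elim(1,2) f by auto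
      ultimately show "\<bar>real n ^ r * p n J b - (\<Prod>j\<in>J. \<tau> (b j))\<bar> \<le> \<epsilon>"
        using elim(3) unfolding re[of \<tau>] dist_real_def by linarith
    qed
  qed
qed

text \<open>Here \<open>b j\<close> is the set of levels exceeded by index \<open>j\<close>. For
  \<open>i\<close> at most the number of indices, fewer than \<open>i\<close> exceedances of level
  \<open>i\<close> means that the i-th largest value does not exceed it.\<close>

definition counts_ok :: "nat \<Rightarrow> (nat \<Rightarrow> nat set) \<Rightarrow> nat set \<Rightarrow> bool" where
  "counts_ok k b J \<longleftrightarrow> (\<forall>i\<in>{1..k}. card {j \<in> J. i \<in> b j} < i)"

lemma counts_ok_bij:
  assumes f: "bij_betw f I J"
  shows "counts_ok k b J \<longleftrightarrow> counts_ok k (\<lambda>i. b (f i)) I"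
proof -
  have "card {j \<in> J. i \<in> b j} = card {j \<in> I. i \<in> b (f j)}" for i
    by (rule bij_betw_same_card[symmetric], rule bij_betw_subset[OF f]) (use f in \<open>auto simp: bij_betw_def\<close>)
  then show ?thesis by (simp add: counts_ok_def)
qed

lemma counts_ok_cong: "(\<And>i. i \<in> I \<Longrightarrow> b i = b' i) \<Longrightarrow> counts_ok k b I \<longleftrightarrow> counts_ok k b' I"
proof -
  assume "\<And>i. i \<in> I \<Longrightarrow> b i = b' i"
  then have "{j \<in> I. i \<in> b j} = {j \<in> I. i \<in> b' j}" for i by auto
  then show ?thesis by (simp add: counts_ok_def)
qed

text \<open>The label of a value. The empty label is kept out of the label set: nearly all indices
  carry it, and it contributes to none of the counts.\<close>

definition pattern :: "nat \<Rightarrow> (nat \<Rightarrow> real) \<Rightarrow> real \<Rightarrow> nat set" where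
  "pattern k u y = {i \<in> {1..k}. u i < y}"

lemma pattern_eq_iff: "b \<subseteq> {1..k} \<Longrightarrow> pattern k u y = b \<longleftrightarrow> y \<in> cell k u u b"
  unfolding pattern_def cell_def by (auto simp: not_less[symmetric])

lemma counts_ok_pattern:
  "counts_ok k (\<lambda>j. pattern k u (X j)) {j. j < n \<and> pattern k u (X j) \<in> Pow {1..k} - {{}}} \<longleftrightarrow>
   (\<forall>i\<in>{1..k}. card {j. j < n \<and> u i < X j} < i)"
proof -
  have "{j \<in> {j. j < n \<and> pattern k u (X j) \<in> Pow {1..k} - {{}}}. i \<in> pattern k u (X j)} = {j. j < n \<and> u i < X j}" if "i \<in> {1..k}" for i
    using that by (auto simp: pattern_def)
  then show ?thesis by (simp add: counts_ok_def)
qed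

text \<open>The factorial moment expansion of the probability that independent Poisson counts with
  means \<open>cell_weight\<close>, one for each nonempty label, satisfy \<open>counts_ok\<close>.
  It serves as the common limit of the two models.\<close>

definition order_limit :: "nat \<Rightarrow> (nat \<Rightarrow> real) \<Rightarrow> real" where
  "order_limit k x = (\<Sum>r. (\<Sum>b\<in>PiE {..<r} (\<lambda>_. Pow {1..k} - {{}}).
     mobius (\<lambda>K. of_bool (counts_ok k b K)) {..<r} * (\<Prod>j<r. cell_weight k x (b j))) / fact r)"

definition level :: "(nat \<Rightarrow> real) \<Rightarrow> nat \<Rightarrow> nat \<Rightarrow> real" where
  "level x n i = b'_seq n + x i / a_seq n"

lemma exceedance_counts_measurable:
  fixes X :: "nat \<Rightarrow> 'a \<Rightarrow> real" and u :: "nat \<Rightarrow> real"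
  assumes X: "\<And>j. j < n \<Longrightarrow> X j \<in> borel_measurable M"
  shows "{\<omega> \<in> space M. \<forall>i\<in>{1..k}. card {j. j < n \<and> u i < X j \<omega>} < i} \<in> sets M"
proof (rule sets.sets_Collect_finite_All)
  fix i :: nat assume "i \<in> {1..k}"
  have sm: "(\<lambda>\<omega>. \<Sum>j<n. indicator {y. u i < y} (X j \<omega>) :: real) \<in> borel_measurable M"
    using X by (intro borel_measurable_sum measurable_compose[OF _ borel_measurable_indicator]) auto
  have sc: "(\<Sum>j<n. indicator {y. u i < y} (X j \<omega>) :: real) = real (card {j. j < n \<and> u i < X j \<omega>})" for \<omega>
  proof -
    have "(\<Sum>j<n. indicator {y. u i < y} (X j \<omega>) :: real) = (\<Sum>j\<in>{..<n}. if u i < X j \<omega> then 1 else 0)"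
      by (intro sum.cong) (auto simp: indicator_def)
    also have "\<dots> = real (card ({..<n} \<inter> {j. u i < X j \<omega>}))" by (simp add: sum.If_cases)
    also have "{..<n} \<inter> {j. u i < X j \<omega>} = {j. j < n \<and> u i < X j \<omega>}" by auto
    finally show ?thesis .
  qed
  have m: "(\<lambda>\<omega>. real (card {j. j < n \<and> u i < X j \<omega>})) \<in> borel_measurable M"
    using sm unfolding sc .
  have "{\<omega> \<in> space M. real (card {j. j < n \<and> u i < X j \<omega>}) < real i} \<in> sets M"
    by (rule borel_measurable_less[OF m borel_measurable_const])
  then show "{\<omega> \<in> space M. card {j. j < n \<and> u i < X j \<omega>} < i} \<in> sets M"
    unfolding of_nat_less_iff .
qed simp

text \<open>The part common to both models: a model enters only through the joint cell probabilities
  of \<open>r\<close> indices, rescaled by n^r.\<close>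

lemma exceedance_counts_converge:
  fixes P :: "nat \<Rightarrow> 'a measure" and X :: "nat \<Rightarrow> nat \<Rightarrow> 'a \<Rightarrow> real"
  assumes ps: "\<And>n. n \<ge> 1 \<Longrightarrow> prob_space (P n)"
    and X: "\<And>n j. n \<ge> 1 \<Longrightarrow> j < n \<Longrightarrow> X n j \<in> borel_measurable (P n)"
    and moments: "\<And>r \<epsilon>. \<epsilon> > 0 \<Longrightarrow> eventually (\<lambda>n. \<forall>J b. J \<subseteq> {..<n} \<longrightarrow> card J = r \<longrightarrow> b \<in> PiE J (\<lambda>_. Pow {1..k} - {{}}) \<longrightarrow>
        \<bar>real n ^ r * measure (P n) {\<omega> \<in> space (P n). \<forall>j\<in>J. X n j \<omega> \<in> cell k (level x n) (level x n) (b j)} - (\<Prod>j\<in>J. cell_weight k x (b j))\<bar> \<le> \<epsilon>) sequentially"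
  shows "(\<lambda>n. measure (P n) {\<omega> \<in> space (P n). \<forall>i\<in>{1..k}. card {j. j < n \<and> level x n i < X n j \<omega>} < i}) \<longlonglongrightarrow> order_limit k x"
proof -
  define L where "L = Pow {1..k} - {{}::nat set}"
  define c where "c = (\<lambda>n \<omega> j. pattern k (level x n) (X n j \<omega>))"
  have ev: "{\<omega> \<in> space (P n). counts_ok k (c n \<omega>) {j. j < n \<and> c n \<omega> j \<in> L}} = {\<omega> \<in> space (P n). \<forall>i\<in>{1..k}. card {j. j < n \<and> level x n i < X n j \<omega>} < i}" for n
    unfolding c_def L_def counts_ok_pattern ..
  have "(\<lambda>n. measure (P n) {\<omega> \<in> space (P n). counts_ok k (c n \<omega>) {j. j < n \<and> c n \<omega> j \<in> L}}) \<longlonglongrightarrow>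
     (\<Sum>r. (\<Sum>b\<in>PiE {..<r} (\<lambda>_. L). mobius (\<lambda>K. of_bool (counts_ok k b K)) {..<r} * (\<Prod>j<r. cell_weight k x (b j))) / fact r)"
  proof (rule factorial_moment_convergence[OF ps])
    show "finite L" by (simp add: L_def)
    show "{\<omega> \<in> space (P n). c n \<omega> j = b} \<in> sets (P n)" if n: "1 \<le> n" "j < n" "b \<in> L" for n j b
    proof -
      have "{\<omega> \<in> space (P n). c n \<omega> j = b} = X n j -` cell k (level x n) (level x n) b \<inter> space (P n)"
        using that by (auto simp: c_def L_def pattern_eq_iff)
      also have "\<dots> \<in> sets (P n)" using X[OF n(1,2)] n(3) by (intro measurable_sets[OF _ cell_borel]) (auto simp: L_def)
      finally show ?thesis .
    qed
    fix r and \<epsilon> :: real assume "\<epsilon> > 0"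
    show "eventually (\<lambda>n. \<forall>J b. J \<subseteq> {..<n} \<longrightarrow> card J = r \<longrightarrow> b \<in> PiE J (\<lambda>_. L) \<longrightarrow>
        \<bar>real n ^ r * measure (P n) {\<omega> \<in> space (P n). \<forall>j\<in>J. c n \<omega> j = b j} - (\<Prod>j\<in>J. cell_weight k x (b j))\<bar> \<le> \<epsilon>) sequentially"
      using moments[OF \<open>\<epsilon> > 0\<close>, of r]
    proof eventually_elim
      case (elim n)
      show ?case
      proof (intro allI impI)
        fix J b assume J: "J \<subseteq> {..<n}" "card J = r" and b: "b \<in> PiE J (\<lambda>_. L)"
        have "{\<omega> \<in> space (P n). \<forall>j\<in>J. c n \<omega> j = b j} = {\<omega> \<in> space (P n). \<forall>j\<in>J. X n j \<omega> \<in> cell k (level x n) (level x n) (b j)}"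
        proof -
          have "b j \<subseteq> {1..k}" if "j \<in> J" for j using b that by (auto simp: L_def PiE_def Pi_def)
          then show ?thesis by (auto simp: c_def pattern_eq_iff)
        qed
        then show "\<bar>real n ^ r * measure (P n) {\<omega> \<in> space (P n). \<forall>j\<in>J. c n \<omega> j = b j} - (\<Prod>j\<in>J. cell_weight k x (b j))\<bar> \<le> \<epsilon>"
          using elim J b by (simp add: L_def)
      qed
    qed
  next
    show "cell_weight k x b \<ge> 0" for b by (simp add: cell_weight_def)
    show "counts_ok k b J \<longleftrightarrow> counts_ok k (\<lambda>i. b (f i)) I" if "bij_betw f I J" for f I J b
      by (rule counts_ok_bij[OF that])
    show "counts_ok k b I \<longleftrightarrow> counts_ok k b' I" if "\<And>i. i \<in> I \<Longrightarrow> b i = b' i" for b b' I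
      by (rule counts_ok_cong[OF that])
    show "{\<omega> \<in> space (P n). counts_ok k (c n \<omega>) {j. j < n \<and> c n \<omega> j \<in> L}} \<in> sets (P n)" if "1 \<le> n" for n
      unfolding ev by (rule exceedance_counts_measurable[OF X[OF that]])
  qed
  then show ?thesis unfolding ev unfolding order_limit_def L_def .
qed

section \<open>Extremes of the diagonal\<close>

lemma level_scaled_tendsto: "(\<lambda>n. a_seq n * (level x n i - b'_seq n)) \<longlonglongrightarrow> x i"
proof (rule Lim_transform_eventually[OF tendsto_const])
  show "eventually (\<lambda>n. x i = a_seq n * (level x n i - b'_seq n)) sequentially"
    using eventually_ge_at_top[of 2]
  proof eventually_elim
    case (elim n)
    then show ?case using a_seq_pos[OF elim] by (simp add: level_def)
  qed
qed

lemma prob_space_iid: "prob_space (iid_std_gaussian n)"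
  unfolding iid_std_gaussian_def by (intro prob_space_PiM prob_space_std_normal)

lemma iid_coordinate_measurable: "j < n \<Longrightarrow> (\<lambda>\<xi>. \<xi> j) \<in> borel_measurable (iid_std_gaussian n)"
  unfolding iid_std_gaussian_def
  using measurable_component_singleton[of j "{..<n}" "\<lambda>_. density lborel std_normal_density"] by simp

lemma iid_product_measure:
  assumes J: "J \<subseteq> {..<n}" and C: "\<And>j. j \<in> J \<Longrightarrow> C j \<in> sets borel"
  shows "measure (iid_std_gaussian n) {\<xi> \<in> space (iid_std_gaussian n). \<forall>j\<in>J. \<xi> j \<in> C j} = (\<Prod>j\<in>J. measure (density lborel std_normal_density) (C j))"
proof -
  let ?N = "density lborel std_normal_density"
  interpret N: prob_space ?N by (rule prob_space_std_normal)
  interpret P: finite_product_prob_space "\<lambda>_. ?N" "{..<n}" by unfold_locales auto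
  define D where "D = (\<lambda>j. if j \<in> J then C j else UNIV)"
  have "{\<xi> \<in> space (iid_std_gaussian n). \<forall>j\<in>J. \<xi> j \<in> C j} = PiE {..<n} D"
    using J unfolding iid_std_gaussian_def space_PiM D_def by (auto simp: PiE_def Pi_def split: if_splits)
  then have "measure (iid_std_gaussian n) {\<xi> \<in> space (iid_std_gaussian n). \<forall>j\<in>J. \<xi> j \<in> C j} = (\<Prod>j<n. measure ?N (D j))"
    unfolding iid_std_gaussian_def using C by (simp add: P.prob_times D_def)
  also have "\<dots> = (\<Prod>j\<in>J. measure ?N (C j))"
    using J N.prob_space by (intro prod.mono_neutral_cong_right) (auto simp: D_def)
  finally show ?thesis .
qed

lemma iid_exceedance_counts_converge:
  "(\<lambda>n. measure (iid_std_gaussian n) {\<xi> \<in> space (iid_std_gaussian n). \<forall>i\<in>{1..k}. card {j. j < n \<and> level x n i < \<xi> j} < i}) \<longlonglongrightarrow> order_limit k x"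
proof (rule exceedance_counts_converge[where X = "\<lambda>n j \<xi>. \<xi> j"])
  show "prob_space (iid_std_gaussian n)" for n by (rule prob_space_iid)
  show "(\<lambda>\<xi>. \<xi> j) \<in> borel_measurable (iid_std_gaussian n)" if "j < n" for n j by (rule iid_coordinate_measurable[OF that])
  fix r and \<epsilon> :: real assume \<epsilon>: "\<epsilon> > 0"
  let ?q = "\<lambda>n b. measure (density lborel std_normal_density) (cell k (level x n) (level x n) b)"
  have q: "(\<lambda>n. real n * ?q n b) \<longlonglongrightarrow> cell_weight k x b" if "b \<in> Pow {1..k} - {{}}" for b
    using that by (intro cell_measure_tendsto level_scaled_tendsto) auto
  show "eventually (\<lambda>n. \<forall>J b. J \<subseteq> {..<n} \<longrightarrow> card J = r \<longrightarrow> b \<in> PiE J (\<lambda>_. Pow {1..k} - {{}}) \<longrightarrow>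
        \<bar>real n ^ r * measure (iid_std_gaussian n) {\<xi> \<in> space (iid_std_gaussian n). \<forall>j\<in>J. \<xi> j \<in> cell k (level x n) (level x n) (b j)} - (\<Prod>j\<in>J. cell_weight k x (b j))\<bar> \<le> \<epsilon>) sequentially"
  proof (rule product_moments_sandwich[where lo = ?q and hi = ?q and err = "\<lambda>_. 0", OF _ q q _ _ \<epsilon>])
    show "eventually (\<lambda>n. \<forall>J b. J \<subseteq> {..<n} \<longrightarrow> card J = r \<longrightarrow> b \<in> PiE J (\<lambda>_. Pow {1..k} - {{}}) \<longrightarrow>
        (\<Prod>j\<in>J. ?q n (b j)) - 0 \<le> measure (iid_std_gaussian n) {\<xi> \<in> space (iid_std_gaussian n). \<forall>j\<in>J. \<xi> j \<in> cell k (level x n) (level x n) (b j)} \<and>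
        measure (iid_std_gaussian n) {\<xi> \<in> space (iid_std_gaussian n). \<forall>j\<in>J. \<xi> j \<in> cell k (level x n) (level x n) (b j)} \<le> (\<Prod>j\<in>J. ?q n (b j)) + 0) sequentially"
    proof (intro always_eventually allI impI)
      fix n :: nat and J b assume J: "J \<subseteq> {..<n}" and b: "b \<in> PiE J (\<lambda>_. Pow {1..k} - {{}::nat set})"
      have "measure (iid_std_gaussian n) {\<xi> \<in> space (iid_std_gaussian n). \<forall>j\<in>J. \<xi> j \<in> cell k (level x n) (level x n) (b j)} = (\<Prod>j\<in>J. ?q n (b j))"
        using b by (intro iid_product_measure[OF J] cell_borel) auto
      then show "(\<Prod>j\<in>J. ?q n (b j)) - 0 \<le> measure (iid_std_gaussian n) {\<xi> \<in> space (iid_std_gaussian n). \<forall>j\<in>J. \<xi> j \<in> cell k (level x n) (level x n) (b j)} \<and>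
        measure (iid_std_gaussian n) {\<xi> \<in> space (iid_std_gaussian n). \<forall>j\<in>J. \<xi> j \<in> cell k (level x n) (level x n) (b j)} \<le> (\<Prod>j\<in>J. ?q n (b j)) + 0"
        by simp
    qed
  qed auto
qed

text \<open>For n \<ge> k the event about order statistics is one about exceedance counts.
  Convergence of the latter shows that the limit in the definition exists and identifies it with the
  series.\<close>

lemma F_cdf_eq_order_limit: "F_cdf k x = order_limit k x"
proof -
  have "eventually (\<lambda>n. measure (iid_std_gaussian n) {\<xi> \<in> space (iid_std_gaussian n). \<forall>i\<in>{1..k}. card {j. j < n \<and> level x n i < \<xi> j} < i} =
     measure (iid_std_gaussian n) {\<xi> \<in> space (iid_std_gaussian n). \<forall>i\<in>{1..k}. a_seq n * (order_statistic n i \<xi> - b'_seq n) \<le> x i}) sequentially"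
    using eventually_ge_at_top[of "max 2 k"]
  proof eventually_elim
    case (elim n)
    have a: "a_seq n > 0" using elim by (intro a_seq_pos) simp
    have "a_seq n * (order_statistic n i \<xi> - b'_seq n) \<le> x i \<longleftrightarrow> card {j. j < n \<and> level x n i < \<xi> j} < i"
      if "i \<in> {1..k}" for i \<xi>
    proof -
      have "a_seq n * (order_statistic n i \<xi> - b'_seq n) \<le> x i \<longleftrightarrow> order_statistic n i \<xi> \<le> level x n i"
        using a by (simp add: level_def field_simps)
      then show ?thesis using that elim by (simp add: order_statistic_le_iff)
    qed
    then show ?case by (intro arg_cong[of _ _ "measure (iid_std_gaussian n)"]) auto
  qed
  from Lim_transform_eventually[OF iid_exceedance_counts_converge this]
  show ?thesis unfolding F_cdf_def by (rule limI)
qed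

text \<open>Monotonicity and continuity are read off from the iid model instead of the series: if
  the event changes, some coordinate lies between the two positions of a level, and the union bound
  over the coordinates converges to the difference of exponentials.\<close>

lemma order_limit_shift:
  assumes e: "e \<ge> 0"
  shows "order_limit k x \<le> order_limit k (\<lambda>i. x i + e)"
    "order_limit k (\<lambda>i. x i + e) - order_limit k x \<le> (\<Sum>i\<in>{1..k}. exp (- x i) - exp (- (x i + e)))"
proof -
  define y where "y = (\<lambda>i. x i + e)"
  define S where "S = (\<lambda>z n. {\<xi> \<in> space (iid_std_gaussian n). \<forall>i\<in>{1..k}. card {j. j < n \<and> level z n i < \<xi> j} < i})"
  have lim: "(\<lambda>n. measure (iid_std_gaussian n) (S z n)) \<longlonglongrightarrow> order_limit k z" for z
    unfolding S_def by (rule iid_exceedance_counts_converge)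
  have cm: "{\<xi> \<in> space (iid_std_gaussian n). s < \<xi> j \<and> \<xi> j \<le> t} \<in> sets (iid_std_gaussian n)" if "j < n" for n j s t
    using iid_coordinate_measurable[OF that] by (intro sets.sets_Collect_conj borel_measurable_less borel_measurable_le) auto
  have key: "measure (iid_std_gaussian n) (S x n) \<le> measure (iid_std_gaussian n) (S y n) \<and>
      measure (iid_std_gaussian n) (S y n) - measure (iid_std_gaussian n) (S x n) \<le> (\<Sum>i\<in>{1..k}. real n * gauss_tail (level x n i) - real n * gauss_tail (level y n i))"
    if n: "n \<ge> 2" for n
  proof -
    interpret prob_space "iid_std_gaussian n" by (rule prob_space_iid)
    have a: "a_seq n > 0" by (rule a_seq_pos[OF n])
    have xy: "level x n i \<le> level y n i" for i
      using a e by (simp add: level_def y_def divide_right_mono)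
    have Sm: "S z n \<in> events" for z
      unfolding S_def by (intro exceedance_counts_measurable iid_coordinate_measurable)
    have sub: "S x n \<subseteq> S y n"
    proof
      fix \<xi> assume xi: "\<xi> \<in> S x n"
      have "card {j. j < n \<and> level y n i < \<xi> j} \<le> card {j. j < n \<and> level x n i < \<xi> j}" for i
        using xy[of i] by (intro card_mono) auto
      then show "\<xi> \<in> S y n" using xi unfolding S_def by (auto intro: le_less_trans)
    qed
    define B where "B = (\<lambda>(i, j). {\<xi> \<in> space (iid_std_gaussian n). level x n i < \<xi> j \<and> \<xi> j \<le> level y n i})"
    have "S y n - S x n \<subseteq> (\<Union>p\<in>{1..k} \<times> {..<n}. B p)"
    proof
      fix \<xi> assume "\<xi> \<in> S y n - S x n"
      then obtain i where i: "i \<in> {1..k}" "\<xi> \<in> space (iid_std_gaussian n)" "card {j. j < n \<and> level y n i < \<xi> j} < i" "\<not> card {j. j < n \<and> level x n i < \<xi> j} < i"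
        unfolding S_def by auto
      have "\<exists>j<n. level x n i < \<xi> j \<and> \<xi> j \<le> level y n i"
      proof (rule ccontr)
        assume "\<not> ?thesis"
        then have "{j. j < n \<and> level x n i < \<xi> j} \<subseteq> {j. j < n \<and> level y n i < \<xi> j}" by (auto simp: not_le)
        then have "card {j. j < n \<and> level x n i < \<xi> j} \<le> card {j. j < n \<and> level y n i < \<xi> j}" by (intro card_mono) auto
        then show False using i by simp
      qed
      then show "\<xi> \<in> (\<Union>p\<in>{1..k} \<times> {..<n}. B p)" using i unfolding B_def by force
    qed
    then have "prob (S y n - S x n) \<le> prob (\<Union>p\<in>{1..k} \<times> {..<n}. B p)"
      by (intro finite_measure_mono sets.finite_UN) (auto simp: B_def intro!: cm)
    also have "\<dots> \<le> (\<Sum>p\<in>{1..k} \<times> {..<n}. prob (B p))"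
      by (intro finite_measure_subadditive_finite) (auto simp: B_def intro!: cm)
    also have "\<dots> = (\<Sum>p\<in>{1..k} \<times> {..<n}. gauss_tail (level x n (fst p)) - gauss_tail (level y n (fst p)))"
    proof (intro sum.cong refl)
      fix p assume p: "p \<in> {1..k} \<times> {..<n}"
      obtain i j where ij: "p = (i, j)" "j < n" using p by (cases p) auto
      interpret N: prob_space "density lborel std_normal_density" by (rule prob_space_std_normal)
      have "B p = {\<xi> \<in> space (iid_std_gaussian n). \<forall>j'\<in>{j}. \<xi> j' \<in> {level x n i<..level y n i}}"
        unfolding ij B_def by auto
      then have "prob (B p) = measure (density lborel std_normal_density) {level x n i<..level y n i}"
        using iid_product_measure[of "{j}" n "\<lambda>_. {level x n i<..level y n i}"] ij by simp
      also have "{level x n i<..level y n i} = {level x n i<..} - {level y n i<..}" by auto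
      also have "measure (density lborel std_normal_density) \<dots> = gauss_tail (level x n i) - gauss_tail (level y n i)"
        unfolding gauss_tail_def using xy[of i] by (intro N.finite_measure_Diff) auto
      finally show "prob (B p) = gauss_tail (level x n (fst p)) - gauss_tail (level y n (fst p))" by (simp add: ij)
    qed
    also have "\<dots> = (\<Sum>i\<in>{1..k}. \<Sum>j<n. gauss_tail (level x n i) - gauss_tail (level y n i))"
      unfolding sum.cartesian_product by (intro sum.cong) auto
    also have "\<dots> = (\<Sum>i\<in>{1..k}. real n * gauss_tail (level x n i) - real n * gauss_tail (level y n i))"
      by (simp add: right_diff_distrib)
    finally show ?thesis using finite_measure_Diff[OF Sm Sm sub] finite_measure_mono[OF sub Sm] by simp
  qed
  have ev: "eventually (\<lambda>n. n \<ge> (2::nat)) sequentially" by (rule eventually_ge_at_top)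
  show "order_limit k x \<le> order_limit k (\<lambda>i. x i + e)" unfolding y_def[symmetric]
    by (rule tendsto_le[OF sequentially_bot lim lim], rule eventually_mono[OF ev], use key in blast)
  have "(\<lambda>n. \<Sum>i\<in>{1..k}. real n * gauss_tail (level x n i) - real n * gauss_tail (level y n i)) \<longlonglongrightarrow> (\<Sum>i\<in>{1..k}. exp (- x i) - exp (- y i))"
    by (intro tendsto_sum tendsto_diff gauss_tail_asymptotic level_scaled_tendsto)
  then have "order_limit k y - order_limit k x \<le> (\<Sum>i\<in>{1..k}. exp (- x i) - exp (- y i))"
    by (rule tendsto_le[OF sequentially_bot _ tendsto_diff[OF lim lim]], intro eventually_mono[OF ev], use key in blast)
  then show "order_limit k (\<lambda>i. x i + e) - order_limit k x \<le> (\<Sum>i\<in>{1..k}. exp (- x i) - exp (- (x i + e)))"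
    by (simp add: y_def)
qed

section \<open>Decoupling of the degree sums\<close>

lemma (in prob_space) std_normal_prob:
  assumes Y: "distributed M lborel Y std_normal_density" and C: "C \<in> sets borel"
  shows "prob (Y -` C \<inter> space M) = measure (density lborel std_normal_density) C"
proof -
  have "distr M lborel Y = density lborel std_normal_density"
    using distributed_distr_eq_density[OF Y] by simp
  moreover have "measure (distr M lborel Y) C = prob (Y -` C \<inter> space M)"
    using distributed_measurable[OF Y] C by (intro measure_distr) auto
  ultimately show ?thesis by simp
qed

lemma (in prob_space) normal_cell_prob:
  assumes s: "s > 0" and Y: "distributed M lborel Y (normal_density 0 s)" and b: "b \<subseteq> {1..k}"
  shows "prob (Y -` cell k l h b \<inter> space M) = measure (density lborel std_normal_density) (cell k (\<lambda>i. l i / s) (\<lambda>i. h i / s) b)"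
proof -
  have Y': "distributed M lborel (\<lambda>\<omega>. Y \<omega> / s) std_normal_density"
    using Y normal_standard_normal_convert[OF s, of Y 0] by simp
  have "Y -` cell k l h b \<inter> space M = (\<lambda>\<omega>. Y \<omega> / s) -` cell k (\<lambda>i. l i / s) (\<lambda>i. h i / s) b \<inter> space M"
    using s by (auto simp: cell_def divide_less_cancel divide_le_cancel)
  then show ?thesis using std_normal_prob[OF Y' cell_borel[OF b]] by simp
qed

lemma power_exp_sqrt_tendsto_0:
  assumes c: "c > 0"
  shows "(\<lambda>n. real n ^ r * exp (- c * sqrt (real n))) \<longlonglongrightarrow> 0"
proof -
  have "filterlim (\<lambda>n. c * sqrt (real n)) at_top sequentially" using c by real_asymp
  from filterlim_compose[OF tendsto_power_div_exp_0[of "2 * r"] this]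
  have "(\<lambda>n. (c * sqrt (real n)) ^ (2 * r) / exp (c * sqrt (real n)) / c ^ (2 * r)) \<longlonglongrightarrow> 0 / c ^ (2 * r)"
    using c by (intro tendsto_divide tendsto_const) auto
  moreover have "(c * sqrt (real n)) ^ (2 * r) / exp (c * sqrt (real n)) / c ^ (2 * r) = real n ^ r * exp (- c * sqrt (real n))" for n
    using c by (simp add: power_mult_distrib power_mult exp_minus divide_inverse)
  ultimately show ?thesis by simp
qed

text \<open>Both perturbations stem from decoupling: an additive error of order n^(-1/4), and the
  variance (n - r) / n in place of 1. On a level of size about a, rescaled by a, the latter has an
  effect of order a^2 / n.\<close>

lemma perturbed_level_tendsto:
  "(\<lambda>n. a_seq n * ((level x n i + c * real n powr (-1/4)) / sqrt ((real n - real r) / real n) - b'_seq n)) \<longlonglongrightarrow> x i"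
proof -
  have 1: "(\<lambda>n. 1 / sqrt ((real n - real r) / real n)) \<longlonglongrightarrow> 1" by real_asymp
  have 2: "(\<lambda>n. a_seq n * real n powr (-1/4)) \<longlonglongrightarrow> 0" unfolding a_seq_def by real_asymp
  have 3: "(\<lambda>n. (a_seq n)\<^sup>2 * (1 / sqrt ((real n - real r) / real n) - 1)) \<longlonglongrightarrow> 0" unfolding a_seq_def by real_asymp
  have 4: "(\<lambda>n. b'_seq n / a_seq n) \<longlonglongrightarrow> 1" unfolding a_seq_def b'_seq_def by real_asymp
  have "(\<lambda>n. x i * (1 / sqrt ((real n - real r) / real n)) + c * (a_seq n * real n powr (-1/4)) * (1 / sqrt ((real n - real r) / real n))
     + b'_seq n / a_seq n * ((a_seq n)\<^sup>2 * (1 / sqrt ((real n - real r) / real n) - 1))) \<longlonglongrightarrow> x i * 1 + c * 0 * 1 + 1 * 0"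
    by (intro tendsto_add tendsto_mult tendsto_const 1 2 3 4)
  then have "(\<lambda>n. x i * (1 / sqrt ((real n - real r) / real n)) + c * (a_seq n * real n powr (-1/4)) * (1 / sqrt ((real n - real r) / real n))
     + b'_seq n / a_seq n * ((a_seq n)\<^sup>2 * (1 / sqrt ((real n - real r) / real n) - 1))) \<longlonglongrightarrow> x i" by simp
  then show ?thesis
  proof (rule Lim_transform_eventually)
    show "eventually (\<lambda>n. x i * (1 / sqrt ((real n - real r) / real n)) + c * (a_seq n * real n powr (-1/4)) * (1 / sqrt ((real n - real r) / real n))
     + b'_seq n / a_seq n * ((a_seq n)\<^sup>2 * (1 / sqrt ((real n - real r) / real n) - 1))
     = a_seq n * ((level x n i + c * real n powr (-1/4)) / sqrt ((real n - real r) / real n) - b'_seq n)) sequentially"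
      using eventually_ge_at_top[of 2]
    proof eventually_elim
      case (elim n)
      define q where "q = 1 / sqrt ((real n - real r) / real n)"
      define p where "p = real n powr (-1/4)"
      have a: "a_seq n > 0" by (rule a_seq_pos[OF elim])
      have "a_seq n * ((level x n i + c * p) * q - b'_seq n) = x i * q + c * (a_seq n * p) * q + b'_seq n / a_seq n * ((a_seq n)\<^sup>2 * (q - 1))"
        using a by (simp add: level_def field_simps power2_eq_square)
      then show ?case by (simp add: q_def p_def)
    qed
  qed
qed

lemma cell_shift:
  assumes "\<bar>y - y'\<bar> \<le> \<delta>"
    and y: "y \<in> cell k l h b"
  shows "y' \<in> cell k (\<lambda>i. l i - \<delta>) (\<lambda>i. h i + \<delta>) b"
  unfolding cell_def mem_Collect_eq
proof (intro conjI ballI)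
  fix i assume "i \<in> b"
  then have "l i < y" using y by (simp add: cell_def)
  then show "l i - \<delta> < y'" using assms(1) by linarith
next
  fix i assume "i \<in> {1..k} - b"
  then have "y \<le> h i" using y unfolding cell_def by blast
  then show "y' \<le> h i + \<delta>" using assms(1) by linarith
qed

text \<open>Once the entries between two indices of \<open>J\<close> are dropped, the degrees are
  independent: each remaining entry joins \<open>J\<close> to its complement and belongs to a single
  index of \<open>J\<close>. Outside an event of probability at most \<open>err\<close>, each
  dropped entry is at most \<delta> / (r + 1) in modulus, so a degree moves by at most \<delta>;
  this is traded for shifted levels.\<close>

lemma GOE_degree_moments:
  assumes G: "GOE n M A" and n: "n \<ge> 1" and J: "J \<subseteq> {..<n}" "card J = r" "r < n" and b: "b \<in> PiE J (\<lambda>_. Pow {1..k})" and \<delta>: "\<delta> > 0"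
  defines "s \<equiv> sqrt ((real n - real r) / real n)" and "err \<equiv> 2 * (real r)\<^sup>2 * exp (- real n * (\<delta> / (real r + 1))\<^sup>2 / 2)"
  shows "(\<Prod>j\<in>J. measure (density lborel std_normal_density) (cell k (\<lambda>i. (l i + \<delta>) / s) (\<lambda>i. (l i - \<delta>) / s) (b j))) - err
      \<le> measure M {\<omega> \<in> space M. \<forall>j\<in>J. degree_sum (A \<omega>) j \<in> cell k l l (b j)}"
    "measure M {\<omega> \<in> space M. \<forall>j\<in>J. degree_sum (A \<omega>) j \<in> cell k l l (b j)}
      \<le> (\<Prod>j\<in>J. measure (density lborel std_normal_density) (cell k (\<lambda>i. (l i - \<delta>) / s) (\<lambda>i. (l i + \<delta>) / s) (b j))) + err"
proof -
  interpret prob_space M by (rule GOE_prob_space[OF G])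
  have finJ: "finite J" using J(1) by (rule finite_subset) simp
  have s: "s > 0" using J(3) n by (simp add: s_def)
  have bj: "b j \<subseteq> {1..k}" if "j \<in> J" for j using b that by (auto simp: PiE_def Pi_def)
  define K where "K = (\<lambda>j. edge j ` ({..<n} - J))"
  define X where "X = (\<lambda>j \<omega>. \<Sum>e\<in>K j. 1 * A \<omega> $$ e)"
  have K: "K j \<subseteq> edges n" "finite (K j)" "K j \<noteq> {}" "card (K j) = n - r" if "j \<in> J" for j
  proof -
    show "K j \<subseteq> edges n" unfolding K_def using that J(1) by (intro image_subsetI edge_in_edges) auto
    show "finite (K j)" by (simp add: K_def)
    show c: "card (K j) = n - r" unfolding K_def using J finJ by (simp add: card_image[OF inj_edge] card_Diff_subset)
    show "K j \<noteq> {}" using c J(3) by auto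
  qed
  have disj: "disjoint_family_on K J"
    unfolding disjoint_family_on_def K_def by (auto simp: edge_eq_iff)
  have \<sigma>: "0 < 1 / sqrt (real n)" using n by simp
  have ind: "indep_vars (\<lambda>_. borel) X J"
    unfolding X_def by (rule grouped_linear_normal(1)[OF GOE_edges_indep[OF G] GOE_edges_normal[OF G] \<sigma> K(1,2) disj])
  have norm: "distributed M lborel (X j) (normal_density 0 s)" if "j \<in> J" for j
  proof -
    have "distributed M lborel (X j) (normal_density 0 (1 / sqrt (real n) * sqrt (real (card (K j)))))"
      unfolding X_def by (rule grouped_linear_normal(2)[OF GOE_edges_indep[OF G] GOE_edges_normal[OF G] \<sigma> K(1,2) disj that K(3)[OF that]]) auto
    also have "1 / sqrt (real n) * sqrt (real (card (K j))) = s"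
      using K(4)[OF that] J(3) by (simp add: s_def real_sqrt_divide of_nat_diff)
    finally show ?thesis .
  qed
  have Xm: "X j \<in> borel_measurable M" if "j \<in> J" for j using norm[OF that] by (simp add: distributed_def)
  have prodX: "prob {\<omega> \<in> space M. \<forall>j\<in>J. X j \<omega> \<in> cell k l' h' (b j)} = (\<Prod>j\<in>J. measure (density lborel std_normal_density) (cell k (\<lambda>i. l' i / s) (\<lambda>i. h' i / s) (b j)))" for l' h'
  proof (cases "J = {}")
    case False
    have "{\<omega> \<in> space M. \<forall>j\<in>J. X j \<omega> \<in> cell k l' h' (b j)} = (\<Inter>j\<in>J. X j -` cell k l' h' (b j) \<inter> space M)" using False by auto
    also have "prob \<dots> = (\<Prod>j\<in>J. prob (X j -` cell k l' h' (b j) \<inter> space M))"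
      by (rule indep_varsD_finite[OF ind False finJ]) (use bj in \<open>auto intro: cell_borel\<close>)
    also have "\<dots> = (\<Prod>j\<in>J. measure (density lborel std_normal_density) (cell k (\<lambda>i. l' i / s) (\<lambda>i. h' i / s) (b j)))"
      by (intro prod.cong refl normal_cell_prob[OF s norm bj])
    finally show ?thesis .
  qed (simp add: prob_space)
  define \<eta> where "\<eta> = \<delta> / (real r + 1)"
  have \<eta>: "\<eta> > 0" using \<delta> by (simp add: \<eta>_def)
  define W where "W = (\<Union>p\<in>J \<times> J. {\<omega> \<in> space M. \<eta> \<le> \<bar>offdiag (A \<omega>) (fst p) (snd p)\<bar>})"
  have Wm: "W \<in> events"
    unfolding W_def using finJ
    by (intro sets.finite_UN borel_measurable_le borel_measurable_const borel_measurable_abs offdiag_measurable[OF G]) auto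
  have "prob W \<le> (\<Sum>p\<in>J \<times> J. prob {\<omega> \<in> space M. \<eta> \<le> \<bar>offdiag (A \<omega>) (fst p) (snd p)\<bar>})"
    unfolding W_def using finJ
    by (intro finite_measure_subadditive_finite image_subsetI borel_measurable_le borel_measurable_const borel_measurable_abs offdiag_measurable[OF G]) auto
  also have "\<dots> \<le> (\<Sum>p\<in>J \<times> J. 2 * exp (- real n * \<eta>\<^sup>2 / 2))"
    using J(1) by (intro sum_mono GOE_entry_tail[OF G _ _ \<eta>]) auto
  also have "\<dots> = err" using J(2) by (simp add: err_def \<eta>_def card_cartesian_product power2_eq_square)
  finally have W: "prob W \<le> err" .
  have close: "\<bar>degree_sum (A \<omega>) j - X j \<omega>\<bar> \<le> \<delta>" if "j \<in> J" "\<omega> \<in> space M" "\<omega> \<notin> W" for j \<omega>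
  proof -
    note C = GOE_carrier[OF G that(2)] and Sy = GOE_sym[OF G that(2)]
    have jn: "j < n" using that(1) J(1) by auto
    have sub: "{..<n} - J \<subseteq> {..<n} - {j}" using that(1) by auto
    have "X j \<omega> = (\<Sum>l\<in>{..<n} - J. offdiag (A \<omega>) j l)"
      unfolding X_def K_def using sum_offdiag_edges[OF C Sy jn sub, of "\<lambda>x. x"] by simp
    moreover have "degree_sum (A \<omega>) j = (\<Sum>l\<in>{..<n} - J. offdiag (A \<omega>) j l) + (\<Sum>l\<in>J. offdiag (A \<omega>) j l)"
      unfolding degree_sum_eq[OF C] using J(1) by (intro sum.subset_diff) auto
    ultimately have "\<bar>degree_sum (A \<omega>) j - X j \<omega>\<bar> = \<bar>\<Sum>l\<in>J. offdiag (A \<omega>) j l\<bar>" by simp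
    also have "\<dots> \<le> (\<Sum>l\<in>J. \<bar>offdiag (A \<omega>) j l\<bar>)" by (rule sum_abs)
    also have "\<dots> \<le> (\<Sum>l\<in>J. \<eta>)"
    proof (intro sum_mono)
      fix l assume "l \<in> J"
      then have "(j, l) \<in> J \<times> J" using that(1) by simp
      then show "\<bar>offdiag (A \<omega>) j l\<bar> \<le> \<eta>" using that(2,3) unfolding W_def by (fastforce simp: not_le)
    qed
    also have "\<dots> = real r * \<eta>" using J(2) by simp
    also have "\<dots> \<le> \<delta>" using \<delta> by (simp add: \<eta>_def field_simps)
    finally show ?thesis .
  qed
  define D where "D = {\<omega> \<in> space M. \<forall>j\<in>J. degree_sum (A \<omega>) j \<in> cell k l l (b j)}"
  have Dm: "D \<in> events"
    unfolding D_def using finJ bj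
    by (intro sets.sets_Collect_finite_All) (auto intro!: measurable_sets_Collect[OF degree_sum_measurable[OF G]] cell_borel)
  define XX where "XX = (\<lambda>l' h'. {\<omega> \<in> space M. \<forall>j\<in>J. X j \<omega> \<in> cell k l' h' (b j)})"
  have XXm: "XX l' h' \<in> events" for l' h'
    unfolding XX_def using finJ bj Xm
    by (intro sets.sets_Collect_finite_All) (auto intro!: measurable_sets_Collect[OF Xm] cell_borel)
  have up: "D \<subseteq> XX (\<lambda>i. l i - \<delta>) (\<lambda>i. l i + \<delta>) \<union> W"
    unfolding D_def XX_def using close cell_shift by blast
  have lo: "XX (\<lambda>i. l i + \<delta>) (\<lambda>i. l i - \<delta>) \<subseteq> D \<union> W"
  proof
    fix \<omega> assume w: "\<omega> \<in> XX (\<lambda>i. l i + \<delta>) (\<lambda>i. l i - \<delta>)"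
    show "\<omega> \<in> D \<union> W"
    proof (cases "\<omega> \<in> W")
      case False
      have "degree_sum (A \<omega>) j \<in> cell k l l (b j)" if j: "j \<in> J" for j
      proof -
        have "\<bar>X j \<omega> - degree_sum (A \<omega>) j\<bar> \<le> \<delta>" using close[OF j _ False] w by (simp add: XX_def abs_minus_commute)
        from cell_shift[OF this, of k "\<lambda>i. l i + \<delta>" "\<lambda>i. l i - \<delta>" "b j"] show ?thesis
          using w j by (simp add: XX_def)
      qed
      then show ?thesis using w by (simp add: D_def XX_def)
    qed simp
  qed
  have "prob D \<le> prob (XX (\<lambda>i. l i - \<delta>) (\<lambda>i. l i + \<delta>)) + prob W"
    using finite_measure_mono[OF up] measure_Un_le[OF XXm Wm] XXm Wm by (meson order_trans sets.Un)
  then show "measure M {\<omega> \<in> space M. \<forall>j\<in>J. degree_sum (A \<omega>) j \<in> cell k l l (b j)}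
      \<le> (\<Prod>j\<in>J. measure (density lborel std_normal_density) (cell k (\<lambda>i. (l i - \<delta>) / s) (\<lambda>i. (l i + \<delta>) / s) (b j))) + err"
    using W prodX[of "\<lambda>i. l i - \<delta>" "\<lambda>i. l i + \<delta>"] unfolding D_def XX_def by simp
  have "prob (XX (\<lambda>i. l i + \<delta>) (\<lambda>i. l i - \<delta>)) \<le> prob D + prob W"
    using finite_measure_mono[OF lo] measure_Un_le[OF Dm Wm] Dm Wm by (meson order_trans sets.Un)
  then show "(\<Prod>j\<in>J. measure (density lborel std_normal_density) (cell k (\<lambda>i. (l i + \<delta>) / s) (\<lambda>i. (l i - \<delta>) / s) (b j))) - err
      \<le> measure M {\<omega> \<in> space M. \<forall>j\<in>J. degree_sum (A \<omega>) j \<in> cell k l l (b j)}"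
    using W prodX[of "\<lambda>i. l i + \<delta>" "\<lambda>i. l i - \<delta>"] unfolding D_def XX_def by simp
qed

lemma degree_exceedance_counts_converge:
  fixes M :: "nat \<Rightarrow> 'a measure"
  assumes G: "\<And>n. n \<ge> 1 \<Longrightarrow> GOE n (M n) (A n)"
  shows "(\<lambda>n. measure (M n) {\<omega> \<in> space (M n). \<forall>i\<in>{1..k}. card {j. j < n \<and> level x n i < degree_sum (A n \<omega>) j} < i}) \<longlonglongrightarrow> order_limit k x"
proof (rule exceedance_counts_converge[where X = "\<lambda>n j \<omega>. degree_sum (A n \<omega>) j"])
  show "prob_space (M n)" if "1 \<le> n" for n by (rule GOE_prob_space[OF G[OF that]])
  show "(\<lambda>\<omega>. degree_sum (A n \<omega>) j) \<in> borel_measurable (M n)" if "1 \<le> n" for n j by (rule degree_sum_measurable[OF G[OF that]])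
  fix r and \<epsilon> :: real assume \<epsilon>: "\<epsilon> > 0"
  \<comment> \<open>The exponent is a compromise: \<delta> is o(1/a), so that the levels do not move
    on the relevant scale, yet n \<delta>^2 = sqrt n, so that \<open>err\<close> is smaller than any
    power of \<open>n\<close>.\<close>
  define \<delta> where "\<delta> = (\<lambda>n. real n powr (-1/4))"
  define s where "s = (\<lambda>n. sqrt ((real n - real r) / real n))"
  define err where "err = (\<lambda>n. 2 * (real r)\<^sup>2 * exp (- real n * (\<delta> n / (real r + 1))\<^sup>2 / 2))"
  define lo where "lo = (\<lambda>n b. measure (density lborel std_normal_density) (cell k (\<lambda>i. (level x n i + \<delta> n) / s n) (\<lambda>i. (level x n i - \<delta> n) / s n) b))"
  define hi where "hi = (\<lambda>n b. measure (density lborel std_normal_density) (cell k (\<lambda>i. (level x n i - \<delta> n) / s n) (\<lambda>i. (level x n i + \<delta> n) / s n) b))"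
  have pl: "(\<lambda>n. a_seq n * ((level x n i + \<delta> n) / s n - b'_seq n)) \<longlonglongrightarrow> x i" "(\<lambda>n. a_seq n * ((level x n i - \<delta> n) / s n - b'_seq n)) \<longlonglongrightarrow> x i" for i
    using perturbed_level_tendsto[of x i 1 r] perturbed_level_tendsto[of x i "-1" r] by (simp_all add: \<delta>_def s_def)
  show "eventually (\<lambda>n. \<forall>J b. J \<subseteq> {..<n} \<longrightarrow> card J = r \<longrightarrow> b \<in> PiE J (\<lambda>_. Pow {1..k} - {{}}) \<longrightarrow>
        \<bar>real n ^ r * measure (M n) {\<omega> \<in> space (M n). \<forall>j\<in>J. degree_sum (A n \<omega>) j \<in> cell k (level x n) (level x n) (b j)} - (\<Prod>j\<in>J. cell_weight k x (b j))\<bar> \<le> \<epsilon>) sequentially"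
  proof (rule product_moments_sandwich[where lo = lo and hi = hi and err = err, OF _ _ _ _ _ \<epsilon>])
    show "(\<lambda>n. real n * lo n b) \<longlonglongrightarrow> cell_weight k x b" if "b \<in> Pow {1..k} - {{}}" for b
      unfolding lo_def using that by (intro cell_measure_tendsto pl) auto
    show "(\<lambda>n. real n * hi n b) \<longlonglongrightarrow> cell_weight k x b" if "b \<in> Pow {1..k} - {{}}" for b
      unfolding hi_def using that by (intro cell_measure_tendsto pl) auto
    define c where "c = 1 / (2 * (real r + 1)\<^sup>2)"
    have c: "c > 0" by (simp add: c_def add_pos_nonneg)
    have "real n * (\<delta> n / (real r + 1))\<^sup>2 / 2 = c * sqrt (real n)" for n
    proof -
      have "real n * (\<delta> n)\<^sup>2 = sqrt (real n)"
      proof (cases "n = 0")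
        case False
        then have "real n * (\<delta> n)\<^sup>2 = real n powr (1 + (-1/4) + (-1/4))"
          unfolding \<delta>_def power2_eq_square by (simp only: powr_add mult.assoc) simp
        then show ?thesis using False by (simp add: powr_half_sqrt)
      qed simp
      then show ?thesis by (simp add: c_def power_divide)
    qed
    then have errn: "real n ^ r * err n = 2 * (real r)\<^sup>2 * (real n ^ r * exp (- c * sqrt (real n)))" for n
      unfolding err_def by simp
    have "(\<lambda>n. 2 * (real r)\<^sup>2 * (real n ^ r * exp (- c * sqrt (real n)))) \<longlonglongrightarrow> 2 * (real r)\<^sup>2 * 0"
      by (intro tendsto_mult tendsto_const power_exp_sqrt_tendsto_0 c)
    then show "(\<lambda>n. real n ^ r * err n) \<longlonglongrightarrow> 0" unfolding errn by simp
    show "eventually (\<lambda>n. \<forall>J b. J \<subseteq> {..<n} \<longrightarrow> card J = r \<longrightarrow> b \<in> PiE J (\<lambda>_. Pow {1..k} - {{}}) \<longrightarrow>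
        (\<Prod>j\<in>J. lo n (b j)) - err n \<le> measure (M n) {\<omega> \<in> space (M n). \<forall>j\<in>J. degree_sum (A n \<omega>) j \<in> cell k (level x n) (level x n) (b j)} \<and>
        measure (M n) {\<omega> \<in> space (M n). \<forall>j\<in>J. degree_sum (A n \<omega>) j \<in> cell k (level x n) (level x n) (b j)} \<le> (\<Prod>j\<in>J. hi n (b j)) + err n) sequentially"
      using eventually_gt_at_top[of r]
    proof eventually_elim
      case (elim n)
      show ?case
      proof (intro allI impI)
        fix J b assume J: "J \<subseteq> {..<n}" "card J = r" and b: "b \<in> PiE J (\<lambda>_. Pow {1..k} - {{}::nat set})"
        have b': "b \<in> PiE J (\<lambda>_. Pow {1..k})" using b by (auto simp: PiE_def Pi_def)
        have n: "n \<ge> 1" using elim by simp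
        have d: "\<delta> n > 0" using n by (simp add: \<delta>_def)
        show "(\<Prod>j\<in>J. lo n (b j)) - err n \<le> measure (M n) {\<omega> \<in> space (M n). \<forall>j\<in>J. degree_sum (A n \<omega>) j \<in> cell k (level x n) (level x n) (b j)} \<and>
        measure (M n) {\<omega> \<in> space (M n). \<forall>j\<in>J. degree_sum (A n \<omega>) j \<in> cell k (level x n) (level x n) (b j)} \<le> (\<Prod>j\<in>J. hi n (b j)) + err n"
          unfolding lo_def hi_def err_def s_def
          by (intro conjI GOE_degree_moments[OF G[OF n] n J elim b' d])
      qed
    qed
  qed auto
qed

section \<open>Typical matrices\<close>

text \<open>The eigenvalue is a continuous function of the entries by the Lipschitz estimate. The
  entries are gathered into one random function of index pairs, where coordinatewise measurability
  suffices.\<close>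

lemma ordered_eigenvalue_measurable:
  assumes G: "GOE n M A" and m: "1 \<le> m" "m \<le> n"
  shows "(\<lambda>\<omega>. ordered_eigenvalue m (laplacian (A \<omega>))) \<in> borel_measurable M"
proof -
  \<comment> \<open>An arbitrary function of pairs is symmetrised and stripped of its diagonal, so
    that \<open>Lm f\<close> is symmetric for every \<open>f\<close> and the eigenvalue map is
    continuous on the whole function space.\<close>
  define e where "e = (\<lambda>f i j. if i = j then 0 else f (edge i j) :: real)"
  define Lm where "Lm = (\<lambda>f. mat n n (\<lambda>(i, j). (if i = j then \<Sum>l<n. e f i l else 0) - e f i j))"
  have esym: "e f i j = e f j i" for f i j by (simp add: e_def edge_commute)
  have Lc: "Lm f \<in> carrier_mat n n" for f by (simp add: Lm_def)
  have Ls: "transpose_mat (Lm f) = Lm f" for f by (rule eq_matI) (auto simp: Lm_def esym)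
  define F where "F = (\<lambda>f. ordered_eigenvalue m (Lm f))"
  have cont_e: "continuous_on UNIV (\<lambda>f. e f i j)" for i j
    unfolding e_def by (cases "i = j") (auto intro!: continuous_on_product_coordinates)
  have "continuous_on UNIV F"
    unfolding continuous_on_def
  proof (intro ballI)
    fix f :: "nat \<times> nat \<Rightarrow> real"
    have entry: "((\<lambda>h. Lm h $$ (i,j)) \<longlongrightarrow> Lm f $$ (i,j)) (at f within UNIV)" if "i < n" "j < n" for i j
    proof -
      have "continuous_on UNIV (\<lambda>h. (if i = j then \<Sum>l<n. e h i l else 0) - e h i j)"
        by (cases "i = j") (auto intro!: continuous_intros cont_e)
      then show ?thesis using that by (simp add: Lm_def continuous_on_def)
    qed
    have "((\<lambda>h. \<Sum>i<n. \<Sum>j<n. \<bar>Lm h $$ (i,j) - Lm f $$ (i,j)\<bar>) \<longlongrightarrow> (\<Sum>i<n. \<Sum>j<n. \<bar>Lm f $$ (i,j) - Lm f $$ (i,j)\<bar>)) (at f within UNIV)"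
      by (intro tendsto_intros entry) auto
    then have lim: "((\<lambda>h. \<Sum>i<n. \<Sum>j<n. \<bar>Lm h $$ (i,j) - Lm f $$ (i,j)\<bar>) \<longlongrightarrow> 0) (at f within UNIV)" by simp
    have "((\<lambda>h. F h - F f) \<longlongrightarrow> 0) (at f within UNIV)"
    proof (rule Lim_null_comparison[OF _ lim], rule always_eventually, rule allI)
      fix h
      show "norm (F h - F f) \<le> (\<Sum>i<n. \<Sum>j<n. \<bar>Lm h $$ (i,j) - Lm f $$ (i,j)\<bar>)"
        unfolding F_def real_norm_def by (rule ordered_eigenvalue_lipschitz[OF Lc Ls Lc Ls m])
    qed
    then show "(F \<longlongrightarrow> F f) (at f within UNIV)" by (rule LIM_zero_cancel)
  qed
  then have Fm: "F \<in> borel_measurable borel" by (rule borel_measurable_continuous_onI)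
  have "(\<lambda>\<omega> p. offdiag (A \<omega>) (fst p) (snd p)) \<in> borel_measurable M"
    by (rule measurable_coordinatewise_then_product) (rule offdiag_measurable[OF G])
  then have "(\<lambda>\<omega>. F (\<lambda>p. offdiag (A \<omega>) (fst p) (snd p))) \<in> borel_measurable M"
    using Fm by (rule measurable_compose)
  moreover have "laplacian (A \<omega>) = Lm (\<lambda>p. offdiag (A \<omega>) (fst p) (snd p))" if "\<omega> \<in> space M" for \<omega>
  proof -
    note C = GOE_carrier[OF G that] and S = GOE_sym[OF G that]
    have e: "e (\<lambda>p. offdiag (A \<omega>) (fst p) (snd p)) i j = offdiag (A \<omega>) i j" for i j
      using offdiag_sym[OF C S, of i j] by (auto simp: e_def edge_def min_def max_def offdiag_def)
    show ?thesis
    proof (rule eq_matI)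
      fix i j assume "i < dim_row (Lm (\<lambda>p. offdiag (A \<omega>) (fst p) (snd p)))" "j < dim_col (Lm (\<lambda>p. offdiag (A \<omega>) (fst p) (snd p)))"
      then have ij: "i < n" "j < n" by (auto simp: Lm_def)
      then show "laplacian (A \<omega>) $$ (i,j) = Lm (\<lambda>p. offdiag (A \<omega>) (fst p) (snd p)) $$ (i,j)"
        by (simp add: laplacian_index[OF C] Lm_def e degree_sum_eq[OF C])
    qed (use laplacian_carrier[OF C] in \<open>auto simp: Lm_def\<close>)
  qed
  ultimately show ?thesis by (simp add: F_def cong: measurable_cong)
qed

text \<open>A first moment bound, valid for dependent events; the degree sums are
  correlated.\<close>

lemma (in prob_space) card_markov:
  assumes E: "\<And>j. j < n \<Longrightarrow> E j \<in> events" and c: "c > 0" and p: "\<And>j. j < n \<Longrightarrow> prob (E j) \<le> p"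
  shows "{\<omega> \<in> space M. c \<le> real (card {j. j < n \<and> \<omega> \<in> E j})} \<in> events"
    "prob {\<omega> \<in> space M. c \<le> real (card {j. j < n \<and> \<omega> \<in> E j})} \<le> real n * p / c"
proof -
  have cardeq: "real (card {j. j < n \<and> \<omega> \<in> E j}) = (\<Sum>j<n. indicator (E j) \<omega>)" for \<omega>
  proof -
    have "(\<Sum>j<n. indicator (E j) \<omega> :: real) = (\<Sum>j\<in>{..<n}. if \<omega> \<in> E j then 1 else 0)"
      by (intro sum.cong) (auto simp: indicator_def)
    also have "\<dots> = real (card ({..<n} \<inter> {j. \<omega> \<in> E j}))" by (simp add: sum.If_cases)
    also have "{..<n} \<inter> {j. \<omega> \<in> E j} = {j. j < n \<and> \<omega> \<in> E j}" by auto
    finally show ?thesis by simp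
  qed
  have m: "(\<lambda>\<omega>. \<Sum>j<n. indicator (E j) \<omega> :: real) \<in> borel_measurable M"
    using E by (intro borel_measurable_sum borel_measurable_indicator) auto
  show "{\<omega> \<in> space M. c \<le> real (card {j. j < n \<and> \<omega> \<in> E j})} \<in> events"
    unfolding cardeq by (rule borel_measurable_le[OF borel_measurable_const m])
  have int: "integrable M (\<lambda>\<omega>. indicator (E j) \<omega> :: real)" if "j < n" for j
    using E[OF that] by (simp add: less_top[symmetric])
  have "prob {\<omega> \<in> space M. c \<le> (\<Sum>j<n. indicator (E j) \<omega>)} \<le> expectation (\<lambda>\<omega>. \<Sum>j<n. indicator (E j) \<omega>) / c"
    using int by (intro integral_Markov_inequality_measure[where A = "{}"] Bochner_Integration.integrable_sum c)
      (auto intro!: sum_nonneg)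
  also have "expectation (\<lambda>\<omega>. \<Sum>j<n. indicator (E j) \<omega>) = (\<Sum>j<n. prob (E j))"
    using int E by (subst Bochner_Integration.integral_sum) (auto simp: sets.Int_space_eq2)
  also have "\<dots> \<le> real n * p" using sum_bounded_above[of "{..<n}" "\<lambda>j. prob (E j)" p] p by simp
  finally show "prob {\<omega> \<in> space M. c \<le> real (card {j. j < n \<and> \<omega> \<in> E j})} \<le> real n * p / c"
    unfolding cardeq using c by (simp add: divide_right_mono)
qed

text \<open>The entropy rate of the net vanishes as its sparsity tends to 0, since \<eta> ln (2 /
  \<eta>) does.\<close>

lemma sparsity_level_exists:
  fixes t :: real
  assumes "t > 0"
  obtains \<eta> where "0 < \<eta>" "\<eta> \<le> 1" "2 * \<eta> + 16 * \<eta> * ln (2 / \<eta>) < t"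
proof -
  have "((\<lambda>\<eta>::real. 2 * \<eta> + 16 * \<eta> * ln (2 / \<eta>)) \<longlongrightarrow> 0) (at_right 0)" by real_asymp
  then have "eventually (\<lambda>\<eta>. 2 * \<eta> + 16 * \<eta> * ln (2 / \<eta>) < t) (at_right 0)"
    by (rule order_tendstoD(2)) (rule assms)
  moreover have "eventually (\<lambda>\<eta>::real. 0 < \<eta> \<and> \<eta> \<le> 1) (at_right 0)"
    using eventually_at_right_real[of 0 1] by (auto elim: eventually_mono)
  ultimately have "eventually (\<lambda>\<eta>. 0 < \<eta> \<and> \<eta> \<le> 1 \<and> 2 * \<eta> + 16 * \<eta> * ln (2 / \<eta>) < t) (at_right 0)"
    by eventually_elim auto
  from eventually_happens'[OF trivial_limit_at_right_real this] show ?thesis using that by blast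
qed

text \<open>The exponents leave room on every side. Entries have size n^(-1/2), so exceeding
  n^(-2/5) has probability at most 2 exp (- n^(1/5) / 2), which survives the union over pairs. The
  expected number of degrees above 9a/10 is at most n^(19/100), well below n^(3/10). And n^(3/10)
  n^(-2/5) still tends to 0 after multiplication by a. The factor 1/2 in the last clause makes room
  for up to \<open>k\<close> further coordinates.\<close>

definition typical :: "nat \<Rightarrow> real \<Rightarrow> real \<Rightarrow> real mat \<Rightarrow> bool" where
  "typical n \<eta> t A \<longleftrightarrow> net_bound n 1 10 A \<and> net_bound n \<eta> t A \<and>
     (\<forall>i<n. \<forall>j<n. \<bar>offdiag A i j\<bar> < real n powr (-2/5)) \<and>
     (\<forall>i<n. \<bar>(\<Sum>j<n. (offdiag A i j)\<^sup>2) - 1\<bar> \<le> real n powr (-2/5) + 1 / real n) \<and>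
     (\<forall>i<n. \<forall>i'<n. i \<noteq> i' \<longrightarrow> \<bar>\<Sum>j<n. offdiag A i j * offdiag A i' j\<bar> \<le> real n powr (-2/5)) \<and>
     real (card {i. i < n \<and> 9/10 * a_seq n \<le> degree_sum A i}) < real n powr (3/10) \<and>
     real (card {i. i < n \<and> sqrt (a_seq n) \<le> \<bar>degree_sum A i\<bar>}) < \<eta> * real n / 2"

lemma GOE_typical:
  assumes G: "\<And>n. n \<ge> 1 \<Longrightarrow> GOE n (M n) (A n)" and \<eta>: "0 < \<eta>" "\<eta> \<le> 1" and t: "0 < t" "2 * \<eta> + 16 * \<eta> * ln (2 / \<eta>) < t\<^sup>2 / 4"
  obtains B where "\<And>n. n \<ge> 1 \<Longrightarrow> B n \<in> sets (M n)" "(\<lambda>n. measure (M n) (B n)) \<longlonglongrightarrow> 0"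
    "\<And>n \<omega>. n \<ge> 1 \<Longrightarrow> \<omega> \<in> space (M n) \<Longrightarrow> \<omega> \<notin> B n \<Longrightarrow> typical n \<eta> t (A n \<omega>)"
proof -
  define p where "p = (\<lambda>n::nat. real n powr (-2/5))"
  define B1 where "B1 = (\<lambda>n. {\<omega> \<in> space (M n). \<not> net_bound n 1 10 (A n \<omega>)})"
  define B2 where "B2 = (\<lambda>n. {\<omega> \<in> space (M n). \<not> net_bound n \<eta> t (A n \<omega>)})"
  define B3 where "B3 = (\<lambda>n. \<Union>q\<in>{..<n} \<times> {..<n}. {\<omega> \<in> space (M n). p n \<le> \<bar>offdiag (A n \<omega>) (fst q) (snd q)\<bar>})"
  define B4 where "B4 = (\<lambda>n. \<Union>i\<in>{..<n}. {\<omega> \<in> space (M n). p n + 1 / real n < \<bar>(\<Sum>j<n. (offdiag (A n \<omega>) i j)\<^sup>2) - 1\<bar>})"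
  define OD where "OD = (\<lambda>n::nat. {..<n} \<times> {..<n} - Id)"
  define B5 where "B5 = (\<lambda>n. \<Union>q\<in>OD n. {\<omega> \<in> space (M n). p n < \<bar>\<Sum>j<n. offdiag (A n \<omega>) (fst q) j * offdiag (A n \<omega>) (snd q) j\<bar>})"
  define E6 where "E6 = (\<lambda>n i. {\<omega> \<in> space (M n). 9/10 * a_seq n \<le> degree_sum (A n \<omega>) i})"
  define B6 where "B6 = (\<lambda>n. {\<omega> \<in> space (M n). real n powr (3/10) \<le> real (card {j. j < n \<and> \<omega> \<in> E6 n j})})"
  define E7 where "E7 = (\<lambda>n i. {\<omega> \<in> space (M n). sqrt (a_seq n) \<le> \<bar>degree_sum (A n \<omega>) i\<bar>})"
  define B7 where "B7 = (\<lambda>n. {\<omega> \<in> space (M n). \<eta> * real n / 2 \<le> real (card {j. j < n \<and> \<omega> \<in> E7 n j})})"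
  have a0: "a_seq n \<ge> 0" for n by (cases n) (auto simp: a_seq_def)
  have finO: "finite (OD n)" for n by (simp add: OD_def)
  have cardO: "real (card (OD n)) \<le> (real n)\<^sup>2" for n
  proof -
    have "card (OD n) \<le> card ({..<n} \<times> {..<n})" unfolding OD_def by (intro card_mono) auto
    then show ?thesis by (simp add: power2_eq_square card_cartesian_product flip: of_nat_mult)
  qed
  have main: "B1 n \<in> sets (M n) \<and> B2 n \<in> sets (M n) \<and> B3 n \<in> sets (M n) \<and> B4 n \<in> sets (M n) \<and> B5 n \<in> sets (M n) \<and> B6 n \<in> sets (M n) \<and> B7 n \<in> sets (M n) \<and>
     measure (M n) (B1 n) \<le> 2 * exp (- real n * (10\<^sup>2 / 4 - 2 * 1 - 16 * 1 * ln (2 / 1))) \<and>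
     measure (M n) (B2 n) \<le> 2 * exp (- real n * (t\<^sup>2 / 4 - 2 * \<eta> - 16 * \<eta> * ln (2 / \<eta>))) \<and>
     measure (M n) (B3 n) \<le> (real n)\<^sup>2 * (2 * exp (- real n * (p n)\<^sup>2 / 2)) \<and>
     measure (M n) (B4 n) \<le> real n * (2 * exp (- real (n - 1) * (p n)\<^sup>2 / 16)) \<and>
     measure (M n) (B5 n) \<le> (real n)\<^sup>2 * (4 * exp (- real (n - 2) * (p n)\<^sup>2 / 16)) \<and>
     measure (M n) (B6 n) \<le> real n * exp (- (9/10 * a_seq n)\<^sup>2 / 2) / real n powr (3/10) \<and>
     measure (M n) (B7 n) \<le> real n * (2 * exp (- (sqrt (a_seq n))\<^sup>2 / 2)) / (\<eta> * real n / 2)"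
    if n: "n \<ge> 1" for n
  proof -
    note Gn = G[OF n]
    interpret prob_space "M n" by (rule GOE_prob_space[OF Gn])
    have "real n powr (-2/5) \<le> real n powr 0" using n by (intro powr_mono) auto
    then have p: "0 < p n" "p n \<le> 1" using n by (auto simp: p_def)
    have m3: "{\<omega> \<in> space (M n). c \<le> \<bar>offdiag (A n \<omega>) i j\<bar>} \<in> events" for i j c
      by (intro borel_measurable_le borel_measurable_const borel_measurable_abs offdiag_measurable[OF Gn])
    have m4: "{\<omega> \<in> space (M n). c < \<bar>(\<Sum>j<n. (offdiag (A n \<omega>) i j)\<^sup>2) - 1\<bar>} \<in> events" for i c
      by (intro borel_measurable_less borel_measurable_const borel_measurable_abs borel_measurable_diff borel_measurable_sum
          borel_measurable_power offdiag_measurable[OF Gn])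
    have m5: "{\<omega> \<in> space (M n). c < \<bar>\<Sum>j<n. offdiag (A n \<omega>) i j * offdiag (A n \<omega>) i' j\<bar>} \<in> events" for i i' c
      by (intro borel_measurable_less borel_measurable_const borel_measurable_abs borel_measurable_sum
          borel_measurable_times offdiag_measurable[OF Gn])
    have m6: "E6 n i \<in> events" for i unfolding E6_def
      by (intro borel_measurable_le borel_measurable_const degree_sum_measurable[OF Gn])
    have m7: "E7 n i \<in> events" for i unfolding E7_def
      by (intro borel_measurable_le borel_measurable_const borel_measurable_abs degree_sum_measurable[OF Gn])
    have s1: "B1 n \<in> events" "prob (B1 n) \<le> 2 * exp (- real n * (10\<^sup>2 / 4 - 2 * 1 - 16 * 1 * ln (2 / 1)))"
      unfolding B1_def by (rule GOE_net_bound[OF Gn n]; simp)+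
    have s2: "B2 n \<in> events" "prob (B2 n) \<le> 2 * exp (- real n * (t\<^sup>2 / 4 - 2 * \<eta> - 16 * \<eta> * ln (2 / \<eta>)))"
      unfolding B2_def by (rule GOE_net_bound[OF Gn n \<eta>]; use t in simp)+
    have s3: "B3 n \<in> events" unfolding B3_def by (intro sets.finite_UN m3) auto
    have "prob (B3 n) \<le> (\<Sum>q\<in>{..<n} \<times> {..<n}. prob {\<omega> \<in> space (M n). p n \<le> \<bar>offdiag (A n \<omega>) (fst q) (snd q)\<bar>})"
      unfolding B3_def by (intro finite_measure_subadditive_finite) (auto intro: m3)
    also have "\<dots> \<le> (\<Sum>q\<in>{..<n} \<times> {..<n}. 2 * exp (- real n * (p n)\<^sup>2 / 2))"
      by (intro sum_mono GOE_entry_tail[OF Gn _ _ p(1)]) auto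
    also have "\<dots> = (real n)\<^sup>2 * (2 * exp (- real n * (p n)\<^sup>2 / 2))" by (simp add: card_cartesian_product power2_eq_square)
    finally have t3: "prob (B3 n) \<le> (real n)\<^sup>2 * (2 * exp (- real n * (p n)\<^sup>2 / 2))" .
    have s4: "B4 n \<in> events" unfolding B4_def by (intro sets.finite_UN m4) auto
    have "prob (B4 n) \<le> (\<Sum>i\<in>{..<n}. prob {\<omega> \<in> space (M n). p n + 1 / real n < \<bar>(\<Sum>j<n. (offdiag (A n \<omega>) i j)\<^sup>2) - 1\<bar>})"
      unfolding B4_def by (intro finite_measure_subadditive_finite) (auto intro: m4)
    also have "\<dots> \<le> (\<Sum>i\<in>{..<n}. 2 * exp (- real (n - 1) * (p n)\<^sup>2 / 16))"
      by (intro sum_mono GOE_row_norm[OF Gn _ p]) auto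
    also have "\<dots> = real n * (2 * exp (- real (n - 1) * (p n)\<^sup>2 / 16))" by (simp only: sum_constant card_lessThan)
    finally have t4: "prob (B4 n) \<le> real n * (2 * exp (- real (n - 1) * (p n)\<^sup>2 / 16))" .
    have s5: "B5 n \<in> events" unfolding B5_def by (intro sets.finite_UN m5 finO)
    have "prob (B5 n) \<le> (\<Sum>q\<in>OD n. prob {\<omega> \<in> space (M n). p n < \<bar>\<Sum>j<n. offdiag (A n \<omega>) (fst q) j * offdiag (A n \<omega>) (snd q) j\<bar>})"
      unfolding B5_def using finO by (intro finite_measure_subadditive_finite) (auto intro: m5)
    also have "\<dots> \<le> (\<Sum>q\<in>OD n. 4 * exp (- real (n - 2) * (p n)\<^sup>2 / 16))"
      by (intro sum_mono GOE_row_inner[OF Gn _ _ _ p]) (auto simp: OD_def)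
    also have "\<dots> = real (card (OD n)) * (4 * exp (- real (n - 2) * (p n)\<^sup>2 / 16))" by simp
    also have "\<dots> \<le> (real n)\<^sup>2 * (4 * exp (- real (n - 2) * (p n)\<^sup>2 / 16))" by (intro mult_right_mono cardO) auto
    finally have t5: "prob (B5 n) \<le> (real n)\<^sup>2 * (4 * exp (- real (n - 2) * (p n)\<^sup>2 / 16))" .
    have s6: "B6 n \<in> events" "prob (B6 n) \<le> real n * exp (- (9/10 * a_seq n)\<^sup>2 / 2) / real n powr (3/10)"
    proof -
      have q: "prob (E6 n j) \<le> exp (- (9/10 * a_seq n)\<^sup>2 / 2)" if "j < n" for j
        unfolding E6_def using a0[of n] by (intro GOE_degree_tail(1)[OF Gn that]) auto
      have c: "real n powr (3/10) > 0" using n by simp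
      show "B6 n \<in> events" unfolding B6_def by (rule card_markov(1)[OF m6 c q])
      show "prob (B6 n) \<le> real n * exp (- (9/10 * a_seq n)\<^sup>2 / 2) / real n powr (3/10)"
        unfolding B6_def by (rule card_markov(2)[OF m6 c q])
    qed
    have s7: "B7 n \<in> events" "prob (B7 n) \<le> real n * (2 * exp (- (sqrt (a_seq n))\<^sup>2 / 2)) / (\<eta> * real n / 2)"
    proof -
      have q: "prob (E7 n j) \<le> 2 * exp (- (sqrt (a_seq n))\<^sup>2 / 2)" if "j < n" for j
        unfolding E7_def using a0[of n] by (intro GOE_degree_tail(2)[OF Gn that]) auto
      have c: "\<eta> * real n / 2 > 0" using n \<eta> by simp
      show "B7 n \<in> events" unfolding B7_def by (rule card_markov(1)[OF m7 c q])
      show "prob (B7 n) \<le> real n * (2 * exp (- (sqrt (a_seq n))\<^sup>2 / 2)) / (\<eta> * real n / 2)"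
        unfolding B7_def by (rule card_markov(2)[OF m7 c q])
    qed
    show ?thesis using s1 s2 s3 t3 s4 t4 s5 t5 s6 s7 by blast
  qed
  have zero: "(\<lambda>n. measure (M n) (Bx n)) \<longlonglongrightarrow> 0"
    if "\<And>n. n \<ge> 1 \<Longrightarrow> measure (M n) (Bx n) \<le> f n" "f \<longlonglongrightarrow> 0" for Bx :: "nat \<Rightarrow> 'a set" and f
  proof (rule tendsto_sandwich[OF _ _ tendsto_const that(2)])
    show "eventually (\<lambda>n. measure (M n) (Bx n) \<le> f n) sequentially"
      using eventually_ge_at_top[of 1] by eventually_elim (rule that(1))
  qed simp
  have expz: "(\<lambda>n. 2 * exp (- real n * c)) \<longlonglongrightarrow> 0" if "c > 0" for c :: real
    using that by real_asymp
  have z1: "(\<lambda>n. measure (M n) (B1 n)) \<longlonglongrightarrow> 0"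
  proof (rule zero)
    \<comment> \<open>The origin of the constant 10: at \<eta> = 1 the entropy rate is 2 + 16 ln 2 <
      18, below 10^2 / 4 = 25.\<close>
    have "0 < 10\<^sup>2 / 4 - 2 * 1 - 16 * 1 * ln (2 / 1 :: real)" using ln_2_less_1 by simp
    then show "(\<lambda>n. 2 * exp (- real n * (10\<^sup>2 / 4 - 2 * 1 - 16 * 1 * ln (2 / 1)))) \<longlonglongrightarrow> 0" by (rule expz)
  qed (use main in blast)
  have z2: "(\<lambda>n. measure (M n) (B2 n)) \<longlonglongrightarrow> 0"
  proof (rule zero)
    have "0 < t\<^sup>2 / 4 - 2 * \<eta> - 16 * \<eta> * ln (2 / \<eta>)" using t by simp
    then show "(\<lambda>n. 2 * exp (- real n * (t\<^sup>2 / 4 - 2 * \<eta> - 16 * \<eta> * ln (2 / \<eta>)))) \<longlonglongrightarrow> 0" by (rule expz)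
  qed (use main in blast)
  have z3: "(\<lambda>n. measure (M n) (B3 n)) \<longlonglongrightarrow> 0"
  proof (rule zero)
    show "(\<lambda>n. (real n)\<^sup>2 * (2 * exp (- real n * (p n)\<^sup>2 / 2))) \<longlonglongrightarrow> 0" unfolding p_def by real_asymp
  qed (use main in blast)
  have z4: "(\<lambda>n. measure (M n) (B4 n)) \<longlonglongrightarrow> 0"
  proof (rule zero)
    have "(\<lambda>n. real n * (2 * exp (- (real n - 1) * (p n)\<^sup>2 / 16))) \<longlonglongrightarrow> 0" unfolding p_def by real_asymp
    then show "(\<lambda>n. real n * (2 * exp (- real (n - 1) * (p n)\<^sup>2 / 16))) \<longlonglongrightarrow> 0"
      by (rule Lim_transform_eventually) (use eventually_ge_at_top[of 1] in \<open>eventually_elim, simp add: of_nat_diff\<close>)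
  qed (use main in blast)
  have z5: "(\<lambda>n. measure (M n) (B5 n)) \<longlonglongrightarrow> 0"
  proof (rule zero)
    have "(\<lambda>n. (real n)\<^sup>2 * (4 * exp (- (real n - 2) * (p n)\<^sup>2 / 16))) \<longlonglongrightarrow> 0" unfolding p_def by real_asymp
    then show "(\<lambda>n. (real n)\<^sup>2 * (4 * exp (- real (n - 2) * (p n)\<^sup>2 / 16))) \<longlonglongrightarrow> 0"
      by (rule Lim_transform_eventually) (use eventually_ge_at_top[of 2] in \<open>eventually_elim, simp add: of_nat_diff\<close>)
  qed (use main in blast)
  have z6: "(\<lambda>n. measure (M n) (B6 n)) \<longlonglongrightarrow> 0"
  proof (rule zero)
    \<comment> \<open>The exponent is 1 - 81/100 - 30/100, because exp (- (9a/10)^2 / 2) =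
      n^(-81/100).\<close>
    have "(\<lambda>n. real n powr (-11/100)) \<longlonglongrightarrow> 0" by real_asymp
    then show "(\<lambda>n. real n * exp (- (9/10 * a_seq n)\<^sup>2 / 2) / real n powr (3/10)) \<longlonglongrightarrow> 0"
    proof (rule Lim_transform_eventually)
      show "eventually (\<lambda>n. real n powr (-11/100) = real n * exp (- (9/10 * a_seq n)\<^sup>2 / 2) / real n powr (3/10)) sequentially"
        using eventually_ge_at_top[of 1]
      proof eventually_elim
        case (elim n)
        have "- (9/10 * a_seq n)\<^sup>2 / 2 = (-81/100) * ln (real n)"
          using elim by (simp add: a_seq_def power_mult_distrib power_divide)
        then have "exp (- (9/10 * a_seq n)\<^sup>2 / 2) = real n powr (-81/100)" using elim by (simp add: powr_def)
        then have "real n * exp (- (9/10 * a_seq n)\<^sup>2 / 2) / real n powr (3/10) = real n powr 1 * real n powr (-81/100) / real n powr (3/10)"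
          using elim by simp
        also have "\<dots> = real n powr (1 + (-81/100) - 3/10)" by (simp only: powr_add powr_diff)
        finally show ?case by simp
      qed
    qed
  qed (use main in blast)
  have z7: "(\<lambda>n. measure (M n) (B7 n)) \<longlonglongrightarrow> 0"
  proof (rule zero)
    have "(\<lambda>n. exp (- a_seq n / 2)) \<longlonglongrightarrow> 0" unfolding a_seq_def by real_asymp
    then have "(\<lambda>n. 4 / \<eta> * exp (- a_seq n / 2)) \<longlonglongrightarrow> 4 / \<eta> * 0" by (intro tendsto_mult tendsto_const)
    then have "(\<lambda>n. 4 / \<eta> * exp (- a_seq n / 2)) \<longlonglongrightarrow> 0" by simp
    then show "(\<lambda>n. real n * (2 * exp (- (sqrt (a_seq n))\<^sup>2 / 2)) / (\<eta> * real n / 2)) \<longlonglongrightarrow> 0"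
    proof (rule Lim_transform_eventually)
      show "eventually (\<lambda>n. 4 / \<eta> * exp (- a_seq n / 2) = real n * (2 * exp (- (sqrt (a_seq n))\<^sup>2 / 2)) / (\<eta> * real n / 2)) sequentially"
        using eventually_ge_at_top[of 1]
      proof eventually_elim
        case (elim n)
        then show ?case using \<eta> a0[of n] by simp
      qed
    qed
  qed (use main in blast)
  define B where "B = (\<lambda>n. B1 n \<union> (B2 n \<union> (B3 n \<union> (B4 n \<union> (B5 n \<union> (B6 n \<union> B7 n))))))"
  show ?thesis
  proof (rule that[of B])
    show Bm: "B n \<in> sets (M n)" if "1 \<le> n" for n using main[OF that] unfolding B_def by blast
    show "(\<lambda>n. measure (M n) (B n)) \<longlonglongrightarrow> 0"
    proof (rule zero)
      fix n :: nat assume n: "1 \<le> n"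
      interpret prob_space "M n" by (rule GOE_prob_space[OF G[OF n]])
      note m = main[OF n]
      show "measure (M n) (B n) \<le> measure (M n) (B1 n) + (measure (M n) (B2 n) + (measure (M n) (B3 n) + (measure (M n) (B4 n) + (measure (M n) (B5 n) + (measure (M n) (B6 n) + measure (M n) (B7 n))))))"
        unfolding B_def
        by (intro order_trans[OF measure_Un_le] add_left_mono) (use m in blast)+
    next
      have "(\<lambda>n. measure (M n) (B1 n) + (measure (M n) (B2 n) + (measure (M n) (B3 n) + (measure (M n) (B4 n) + (measure (M n) (B5 n) + (measure (M n) (B6 n) + measure (M n) (B7 n))))))) \<longlonglongrightarrow> 0 + (0 + (0 + (0 + (0 + (0 + 0)))))"
        by (intro tendsto_add z1 z2 z3 z4 z5 z6 z7)
      then show "(\<lambda>n. measure (M n) (B1 n) + (measure (M n) (B2 n) + (measure (M n) (B3 n) + (measure (M n) (B4 n) + (measure (M n) (B5 n) + (measure (M n) (B6 n) + measure (M n) (B7 n))))))) \<longlonglongrightarrow> 0" by simp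
    qed
    fix n \<omega> assume n: "1 \<le> n" and w: "\<omega> \<in> space (M n)" "\<omega> \<notin> B n"
    have nB: "\<omega> \<notin> B1 n" "\<omega> \<notin> B2 n" "\<omega> \<notin> B3 n" "\<omega> \<notin> B4 n" "\<omega> \<notin> B5 n" "\<omega> \<notin> B6 n" "\<omega> \<notin> B7 n"
      using w(2) unfolding B_def by blast+
    have g3: "\<bar>offdiag (A n \<omega>) i j\<bar> < p n" if "i < n" "j < n" for i j
    proof -
      have "(i, j) \<in> {..<n} \<times> {..<n}" using that by simp
      then show ?thesis using nB(3) w(1) unfolding B3_def by (fastforce simp: not_le)
    qed
    have g5: "\<bar>\<Sum>j<n. offdiag (A n \<omega>) i j * offdiag (A n \<omega>) i' j\<bar> \<le> p n" if "i < n" "i' < n" "i \<noteq> i'" for i i'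
    proof -
      have "(i, i') \<in> OD n" using that by (simp add: OD_def)
      then show ?thesis using nB(5) w(1) unfolding B5_def by (fastforce simp: not_less)
    qed
    have g4: "\<bar>(\<Sum>j<n. (offdiag (A n \<omega>) i j)\<^sup>2) - 1\<bar> \<le> p n + 1 / real n" if "i < n" for i
      using nB(4) w(1) that unfolding B4_def by (fastforce simp: not_less)
    have pn: "real n powr (-2/5) = p n" by (simp add: p_def)
    show "typical n \<eta> t (A n \<omega>)"
      unfolding typical_def pn using nB g3 g4 g5 w(1)
      by (auto simp: B1_def B2_def B6_def B7_def E6_def E7_def not_le)
  qed
qed

section \<open>The limit theorem\<close>

lemma b_seq_eq: "b_seq n = b'_seq n + 1 / a_seq n"
proof (cases "a_seq n = 0")
  case False
  have "b_seq n = a_seq n - (ln (ln (real n)) + ln (4 * pi) - 2) / (2 * a_seq n)" by (simp add: b_seq_def a_seq_def)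
  moreover have "b'_seq n = a_seq n - (ln (ln (real n)) + ln (4 * pi)) / (2 * a_seq n)" by (simp add: b'_seq_def a_seq_def)
  ultimately show ?thesis using False by (simp add: field_simps)
qed (simp add: b_seq_def b'_seq_def a_seq_def)

text \<open>The net with \<eta> = 1, where 20 is twice the lattice bound 10. Components beyond
  \<open>n\<close> are cut off first, since the support has to lie inside
  \<open>{..<n}\<close>.\<close>

lemma typical_full_bound:
  assumes A: "A \<in> carrier_mat n n" "transpose_mat A = A" and n: "n \<ge> 1" and t: "typical n \<eta> t A"
  shows "\<bar>qform n (offdiag A) v\<bar> \<le> 20 * (\<Sum>i<n. (v i)\<^sup>2)"
proof -
  define w where "w = (\<lambda>i. if i < n then v i else 0)"
  have nb: "net_bound n 1 10 A" using t by (simp add: typical_def)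
  have "\<bar>qform n (offdiag A) w\<bar> \<le> 2 * 10 * (\<Sum>i<n. (w i)\<^sup>2)"
    by (rule net_bound_qform[OF A n _ nb, of "{..<n}"]) (auto simp: w_def)
  moreover have "qform n (offdiag A) w = qform n (offdiag A) v"
    unfolding qform_def by (intro sum.cong refl) (auto simp: w_def)
  moreover have "(\<Sum>i<n. (w i)\<^sup>2) = (\<Sum>i<n. (v i)\<^sup>2)" by (intro sum.cong refl) (auto simp: w_def)
  ultimately show ?thesis by simp
qed

lemma typical_rows:
  assumes t: "typical n \<eta> t A" and T: "T \<subseteq> {..<n}" "real (card T) \<le> N" and x: "\<forall>i. x i \<noteq> 0 \<longrightarrow> i \<in> T"
  shows "\<bar>(\<Sum>j<n. (\<Sum>i<n. offdiag A i j * x i)\<^sup>2) - (\<Sum>i<n. (x i)\<^sup>2)\<bar>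
    \<le> (real n powr (-2/5) + 1 / real n + N * real n powr (-2/5)) * (\<Sum>i<n. (x i)\<^sup>2)"
    "\<bar>qform n (offdiag A) x\<bar> \<le> N * real n powr (-2/5) * (\<Sum>i<n. (x i)\<^sup>2)"
proof -
  have X0: "(\<Sum>i<n. (x i)\<^sup>2) \<ge> 0" by (intro sum_nonneg) auto
  have "\<bar>(\<Sum>j<n. (\<Sum>i<n. offdiag A i j * x i)\<^sup>2) - (\<Sum>i<n. (x i)\<^sup>2)\<bar>
    \<le> (real n powr (-2/5) + 1 / real n + real (card T) * real n powr (-2/5)) * (\<Sum>i<n. (x i)\<^sup>2)"
    using t T(1) by (intro sum_mult_square_bound[OF T(1) x]) (auto simp: typical_def subset_eq)
  also have "\<dots> \<le> (real n powr (-2/5) + 1 / real n + N * real n powr (-2/5)) * (\<Sum>i<n. (x i)\<^sup>2)"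
    using T(2) X0 by (intro mult_right_mono add_left_mono) auto
  finally show "\<bar>(\<Sum>j<n. (\<Sum>i<n. offdiag A i j * x i)\<^sup>2) - (\<Sum>i<n. (x i)\<^sup>2)\<bar>
    \<le> (real n powr (-2/5) + 1 / real n + N * real n powr (-2/5)) * (\<Sum>i<n. (x i)\<^sup>2)" .
  have "\<bar>qform n (offdiag A) x\<bar> \<le> real (card T) * real n powr (-2/5) * (\<Sum>i<n. (x i)\<^sup>2)"
    using t by (intro qform_small_support[OF T(1) x]) (auto simp: typical_def less_imp_le)
  also have "\<dots> \<le> N * real n powr (-2/5) * (\<Sum>i<n. (x i)\<^sup>2)"
    using T(2) X0 by (intro mult_right_mono) auto
  finally show "\<bar>qform n (offdiag A) x\<bar> \<le> N * real n powr (-2/5) * (\<Sum>i<n. (x i)\<^sup>2)" .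
qed

lemma b'_over_a_tendsto: "(\<lambda>n. b'_seq n / a_seq n) \<longlonglongrightarrow> 1"
  unfolding a_seq_def b'_seq_def by real_asymp

lemma a_seq_limits:
  "(\<lambda>n. 1 / a_seq n) \<longlonglongrightarrow> 0" "(\<lambda>n. sqrt (a_seq n) / a_seq n) \<longlonglongrightarrow> 0"
  "(\<lambda>n. real n powr (-2/5)) \<longlonglongrightarrow> 0" "(\<lambda>n. real n powr (3/10) * real n powr (-2/5)) \<longlonglongrightarrow> 0"
  "(\<lambda>n. a_seq n * real n powr (-2/5)) \<longlonglongrightarrow> 0" "(\<lambda>n. a_seq n * (real n powr (3/10) * real n powr (-2/5))) \<longlonglongrightarrow> 0"
  "(\<lambda>n. 1 / real n) \<longlonglongrightarrow> 0"
  unfolding a_seq_def by real_asymp+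

text \<open>The correction to the large degrees has three parts: \<open>\<kappa> n\<close>, which is
  o(1/a); \<open>r n / \<gamma> n\<close>, asymptotic to 1/a; and the intermediate coordinates with
  20 * 4 t^2 / a = \<epsilon> / (5 a). Their total stays below (1 + \<epsilon>) / a, which is
  exactly the distance from the eigenvalue threshold down to the level shifted by -
  \<epsilon>.\<close>

lemma typical_upper:
  assumes \<epsilon>: "0 < \<epsilon>" and t: "t > 0" "4 * t\<^sup>2 = \<epsilon> / 100" and \<eta>: "0 < \<eta>"
  shows "eventually (\<lambda>n. \<forall>A. A \<in> carrier_mat n n \<longrightarrow> transpose_mat A = A \<longrightarrow> typical n \<eta> t A \<longrightarrow>
     (\<forall>m\<in>{1..k}. card {j. j < n \<and> level (\<lambda>i. x i - \<epsilon>) n m < degree_sum A j} < m) \<longrightarrow>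
     (\<forall>m\<in>{1..k}. ordered_eigenvalue m (laplacian A) \<le> b_seq n + x m / a_seq n)) sequentially"
proof -
  define C where "C = (\<Sum>m\<in>{1..k}. \<bar>x m\<bar>)"
  have C: "- C \<le> x m" if "m \<in> {1..k}" for m
  proof -
    have "\<bar>x m\<bar> \<le> C" unfolding C_def using that by (intro member_le_sum) auto
    then show ?thesis by linarith
  qed
  \<comment> \<open>Lies at or below the thresholds \<open>b_seq n + x m / a_seq n\<close> for all
    \<open>m\<close> simultaneously.\<close>
  define \<mu> where "\<mu> = (\<lambda>n. b_seq n - C / a_seq n)"
  define \<gamma> where "\<gamma> = (\<lambda>n. \<mu> n - 20 - sqrt (a_seq n))"
  define N where "N = (\<lambda>n::nat. real n powr (3/10))"
  define \<kappa> where "\<kappa> = (\<lambda>n. N n * real n powr (-2/5))"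
  define r where "r = (\<lambda>n. 1 + (real n powr (-2/5) + 1 / real n + N n * real n powr (-2/5)))"
  have ev_a: "eventually (\<lambda>n. a_seq n > 0) sequentially"
    using eventually_ge_at_top[of 2] by eventually_elim (rule a_seq_pos)
  have r1: "r \<longlonglongrightarrow> 1"
  proof -
    have "r \<longlonglongrightarrow> 1 + (0 + 0 + 0)"
      unfolding r_def N_def by (intro tendsto_add tendsto_const a_seq_limits)
    then show ?thesis by simp
  qed
  have \<mu>1: "(\<lambda>n. \<mu> n / a_seq n) \<longlonglongrightarrow> 1"
  proof -
    have "(\<lambda>n. b'_seq n / a_seq n + (1 - C) * (1 / a_seq n) * (1 / a_seq n)) \<longlonglongrightarrow> 1 + (1 - C) * 0 * 0"
      by (intro tendsto_add tendsto_mult tendsto_const b'_over_a_tendsto a_seq_limits)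
    moreover have "b'_seq n / a_seq n + (1 - C) * (1 / a_seq n) * (1 / a_seq n) = \<mu> n / a_seq n" for n
      by (simp add: \<mu>_def b_seq_eq add_divide_distrib diff_divide_distrib algebra_simps)
    ultimately show ?thesis by simp
  qed
  have \<gamma>1: "(\<lambda>n. \<gamma> n / a_seq n) \<longlonglongrightarrow> 1"
  proof -
    have "(\<lambda>n. \<mu> n / a_seq n - 20 * (1 / a_seq n) - sqrt (a_seq n) / a_seq n) \<longlonglongrightarrow> 1 - 20 * 0 - 0"
      by (intro tendsto_diff tendsto_mult tendsto_const \<mu>1 a_seq_limits)
    moreover have "\<mu> n / a_seq n - 20 * (1 / a_seq n) - sqrt (a_seq n) / a_seq n = \<gamma> n / a_seq n" for n
      by (simp add: \<gamma>_def diff_divide_distrib)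
    ultimately show ?thesis by simp
  qed
  have ev1: "eventually (\<lambda>n. \<gamma> n / a_seq n > 0) sequentially"
    by (rule order_tendstoD(1)[OF \<gamma>1]) simp
  have "(\<lambda>n. \<mu> n / a_seq n - 20 * (1 / a_seq n)) \<longlonglongrightarrow> 1 - 20 * 0"
    by (intro tendsto_diff tendsto_mult tendsto_const \<mu>1 a_seq_limits)
  then have ev2: "eventually (\<lambda>n. \<mu> n / a_seq n - 20 * (1 / a_seq n) > 19/20) sequentially"
    by (rule order_tendstoD(1)) simp
  have ev3: "eventually (\<lambda>n. sqrt (a_seq n) / a_seq n < 9/10) sequentially"
    by (rule order_tendstoD(2)[OF a_seq_limits(2)]) simp
  have "(\<lambda>n. a_seq n * \<kappa> n + r n / (\<gamma> n / a_seq n) + 20 * (4 * t\<^sup>2)) \<longlonglongrightarrow> 0 + 1 / 1 + 20 * (4 * t\<^sup>2)"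
    unfolding \<kappa>_def N_def by (intro tendsto_add tendsto_divide tendsto_const r1 \<gamma>1 a_seq_limits) auto
  then have ev4: "eventually (\<lambda>n. a_seq n * \<kappa> n + r n / (\<gamma> n / a_seq n) + 20 * (4 * t\<^sup>2) < 1 + \<epsilon>) sequentially"
    by (rule order_tendstoD(2)) (use \<epsilon> t(2) in simp)
  show ?thesis
    using ev_a ev1 ev2 ev3 ev4 eventually_ge_at_top[of "max 1 k"]
  proof eventually_elim
    case (elim n)
    note a = elim(1)
    have n: "n \<ge> 1" "k \<le> n" using elim(6) by auto
    have \<gamma>: "\<gamma> n > 0" using elim(2) a by (simp add: zero_less_divide_iff)
    \<comment> \<open>Degrees up to 9a/10 keep a gap of a/20, because \<mu> - 20 eventually exceeds
      19a/20.\<close>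
    have \<beta>: "a_seq n / 20 > 0" "a_seq n / 20 \<le> \<mu> n - 20 - 9/10 * a_seq n"
    proof -
      have "(19/20) * a_seq n < (\<mu> n / a_seq n - 20 * (1 / a_seq n)) * a_seq n" using elim(3) a by (intro mult_strict_right_mono) auto
      also have "\<dots> = \<mu> n - 20" using a by (simp add: left_diff_distrib)
      finally show "a_seq n / 20 \<le> \<mu> n - 20 - 9/10 * a_seq n" by simp
    qed (use a in simp)
    have K: "sqrt (a_seq n) \<le> 9/10 * a_seq n" using elim(4) a by (simp add: field_simps)
    have tot: "\<kappa> n + r n / \<gamma> n + (2 * t)\<^sup>2 / (a_seq n / 20) \<le> (1 + \<epsilon>) / a_seq n"
    proof -
      have "a_seq n * (\<kappa> n + r n / \<gamma> n + (2 * t)\<^sup>2 / (a_seq n / 20)) = a_seq n * \<kappa> n + r n / (\<gamma> n / a_seq n) + 20 * (4 * t\<^sup>2)"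
        using a by (simp add: distrib_left power_mult_distrib)
      then have "a_seq n * (\<kappa> n + r n / \<gamma> n + (2 * t)\<^sup>2 / (a_seq n / 20)) \<le> 1 + \<epsilon>" using elim(5) by simp
      then show ?thesis using a by (simp add: pos_le_divide_eq mult.commute)
    qed
    show ?case
    proof (intro allI impI ballI)
      fix A m assume A: "A \<in> carrier_mat n n" "transpose_mat A = A" and ty: "typical n \<eta> t A"
        and cnt: "\<forall>m\<in>{1..k}. card {j. j < n \<and> level (\<lambda>i. x i - \<epsilon>) n m < degree_sum A j} < m" and m: "m \<in> {1..k}"
      define T where "T = {i. i < n \<and> 9/10 * a_seq n < degree_sum A i}"
      define R where "R = {i. i < n \<and> sqrt (a_seq n) < degree_sum A i}"
      have T: "T \<subseteq> {..<n}" "real (card T) \<le> N n"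
      proof -
        have "card T \<le> card {i. i < n \<and> 9/10 * a_seq n \<le> degree_sum A i}" unfolding T_def by (intro card_mono) auto
        moreover have "real (card {i. i < n \<and> 9/10 * a_seq n \<le> degree_sum A i}) < N n" using ty unfolding typical_def N_def by blast
        ultimately show "real (card T) \<le> N n" by linarith
      qed (auto simp: T_def)
      have R: "R \<subseteq> {..<n}" "real (card R) \<le> \<eta> * real n"
      proof -
        have "card R \<le> card {i. i < n \<and> sqrt (a_seq n) \<le> \<bar>degree_sum A i\<bar>}" unfolding R_def by (intro card_mono) auto
        moreover have "real (card {i. i < n \<and> sqrt (a_seq n) \<le> \<bar>degree_sum A i\<bar>}) < \<eta> * real n / 2" using ty unfolding typical_def by blast
        moreover have "\<eta> * real n \<ge> 0" using \<eta> by simp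
        ultimately show "real (card R) \<le> \<eta> * real n" by linarith
      qed (auto simp: R_def)
      have nb: "net_bound n \<eta> t A" using ty by (simp add: typical_def)
      show "ordered_eigenvalue m (laplacian A) \<le> b_seq n + x m / a_seq n"
      proof (rule laplacian_eigenvalue_upper[OF A K, where g = 20 and \<tau> = "2 * t" and r = "r n" and \<kappa> = "\<kappa> n" and \<beta> = "a_seq n / 20" and \<mu> = "\<mu> n" and \<gamma> = "\<gamma> n"])
        show "\<bar>qform n (offdiag A) v\<bar> \<le> 20 * (\<Sum>i<n. (v i)\<^sup>2)" for v by (rule typical_full_bound[OF A n(1) ty])
        show "\<bar>qform n (offdiag A) v\<bar> \<le> 2 * t * (\<Sum>i<n. (v i)\<^sup>2)" if "\<forall>i. v i \<noteq> 0 \<longrightarrow> i < n \<and> sqrt (a_seq n) < degree_sum A i" for v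
          by (rule net_bound_qform[OF A n(1) \<eta> nb R]) (use that in \<open>auto simp: R_def\<close>)
        show "(\<Sum>j<n. (\<Sum>i<n. offdiag A i j * v i)\<^sup>2) \<le> r n * (\<Sum>i<n. (v i)\<^sup>2)" if v: "\<forall>i. v i \<noteq> 0 \<longrightarrow> i < n \<and> 9/10 * a_seq n < degree_sum A i" for v
        proof -
          have "\<forall>i. v i \<noteq> 0 \<longrightarrow> i \<in> T" using v by (auto simp: T_def)
          from typical_rows(1)[OF ty T this] show ?thesis unfolding r_def distrib_right mult_1 by linarith
        qed
        show "\<bar>qform n (offdiag A) v\<bar> \<le> \<kappa> n * (\<Sum>i<n. (v i)\<^sup>2)" if v: "\<forall>i. v i \<noteq> 0 \<longrightarrow> i < n \<and> 9/10 * a_seq n < degree_sum A i" for v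
        proof -
          have "\<forall>i. v i \<noteq> 0 \<longrightarrow> i \<in> T" using v by (auto simp: T_def)
          from typical_rows(2)[OF ty T this] show ?thesis by (simp add: \<kappa>_def)
        qed
        show "\<mu> n \<le> b_seq n + x m / a_seq n"
          using divide_right_mono[OF C[OF m], of "a_seq n"] a by (simp add: \<mu>_def)
        have "level (\<lambda>i. x i - \<epsilon>) n m \<le> b_seq n + x m / a_seq n - (\<kappa> n + r n / \<gamma> n + (2 * t)\<^sup>2 / (a_seq n / 20))"
          using tot by (simp add: level_def b_seq_eq add_divide_distrib diff_divide_distrib)
        then have "card {i. i < n \<and> b_seq n + x m / a_seq n - (\<kappa> n + r n / \<gamma> n + (2 * t)\<^sup>2 / (a_seq n / 20)) < degree_sum A i}
           \<le> card {j. j < n \<and> level (\<lambda>i. x i - \<epsilon>) n m < degree_sum A j}" by (intro card_mono) auto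
        then show "card {i. i < n \<and> b_seq n + x m / a_seq n - (\<kappa> n + r n / \<gamma> n + (2 * t)\<^sup>2 / (a_seq n / 20)) < degree_sum A i} < m"
          using cnt m by (meson le_less_trans)
      qed (use t \<beta> \<gamma> m n in \<open>auto simp: \<gamma>_def\<close>)
    qed
  qed
qed

text \<open>By contradiction: \<open>m\<close> degrees above the level shifted by \<epsilon> produce
  an m-dimensional test space that forces the m-th eigenvalue up to \<open>y n m\<close>, strictly
  above the assumed bound. Half of \<epsilon> is spent on this strictness, the other half on the
  error terms.\<close>

lemma typical_lower:
  assumes \<epsilon>: "0 < \<epsilon>" and t: "t > 0" "4 * t\<^sup>2 = \<epsilon> / 100" and \<eta>: "0 < \<eta>"
  shows "eventually (\<lambda>n. \<forall>A. A \<in> carrier_mat n n \<longrightarrow> transpose_mat A = A \<longrightarrow> typical n \<eta> t A \<longrightarrow>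
     (\<forall>m\<in>{1..k}. ordered_eigenvalue m (laplacian A) \<le> b_seq n + x m / a_seq n) \<longrightarrow>
     (\<forall>m\<in>{1..k}. card {j. j < n \<and> level (\<lambda>i. x i + \<epsilon>) n m < degree_sum A j} < m)) sequentially"
proof -
  define N where "N = real k"
  define \<kappa> where "\<kappa> = (\<lambda>n. N * real n powr (-2/5))"
  define r where "r = (\<lambda>n. 1 - (real n powr (-2/5) + 1 / real n + N * real n powr (-2/5)))"
  define y where "y = (\<lambda>n m. b_seq n + (x m + \<epsilon> / 2) / a_seq n)"
  have ev_a: "eventually (\<lambda>n. a_seq n > 0) sequentially"
    using eventually_ge_at_top[of 2] by eventually_elim (rule a_seq_pos)
  have r1: "r \<longlonglongrightarrow> 1"
  proof -
    have "r \<longlonglongrightarrow> 1 - (0 + 0 + N * 0)"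
      unfolding r_def by (intro tendsto_add tendsto_diff tendsto_mult tendsto_const a_seq_limits)
    then show ?thesis by simp
  qed
  have y1: "(\<lambda>n. (sqrt (a_seq n) + 20 + y n m) / a_seq n) \<longlonglongrightarrow> 1" for m
  proof -
    have "(\<lambda>n. sqrt (a_seq n) / a_seq n + 20 * (1 / a_seq n) + b'_seq n / a_seq n + (1 + x m + \<epsilon> / 2) * (1 / a_seq n) * (1 / a_seq n)) \<longlonglongrightarrow> 0 + 20 * 0 + 1 + (1 + x m + \<epsilon> / 2) * 0 * 0"
      by (intro tendsto_add tendsto_mult tendsto_const b'_over_a_tendsto a_seq_limits)
    moreover have "sqrt (a_seq n) / a_seq n + 20 * (1 / a_seq n) + b'_seq n / a_seq n + (1 + x m + \<epsilon> / 2) * (1 / a_seq n) * (1 / a_seq n) = (sqrt (a_seq n) + 20 + y n m) / a_seq n" for n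
      by (simp add: y_def b_seq_eq add_divide_distrib algebra_simps)
    ultimately show ?thesis by simp
  qed
  have ev1: "eventually (\<lambda>n. \<forall>m\<in>{1..k}. (sqrt (a_seq n) + 20 + y n m) / a_seq n < 2) sequentially"
    by (intro eventually_ball_finite ballI order_tendstoD(2)[OF y1]) auto
  \<comment> \<open>The right-hand side tends to \<epsilon> / 2 - 4 t^2, which is positive because 4
    t^2 = \<epsilon> / 100.\<close>
  have ev2: "eventually (\<lambda>n. \<forall>m\<in>{1..k}. 0 < (r n - 4 * t\<^sup>2) * (2 - (sqrt (a_seq n) + 20 + y n m) / a_seq n) - (1 - \<epsilon> / 2) - a_seq n * \<kappa> n) sequentially"
  proof (intro eventually_ball_finite ballI)
    fix m
    have "(\<lambda>n. (r n - 4 * t\<^sup>2) * (2 - (sqrt (a_seq n) + 20 + y n m) / a_seq n) - (1 - \<epsilon> / 2) - N * (a_seq n * real n powr (-2/5))) \<longlonglongrightarrow> (1 - 4 * t\<^sup>2) * (2 - 1) - (1 - \<epsilon> / 2) - N * 0"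
      by (intro tendsto_diff tendsto_mult tendsto_const r1 y1 a_seq_limits)
    then have "eventually (\<lambda>n. 0 < (r n - 4 * t\<^sup>2) * (2 - (sqrt (a_seq n) + 20 + y n m) / a_seq n) - (1 - \<epsilon> / 2) - N * (a_seq n * real n powr (-2/5))) sequentially"
      by (rule order_tendstoD(1)) (use \<epsilon> t(2) in simp)
    then show "eventually (\<lambda>n. 0 < (r n - 4 * t\<^sup>2) * (2 - (sqrt (a_seq n) + 20 + y n m) / a_seq n) - (1 - \<epsilon> / 2) - a_seq n * \<kappa> n) sequentially"
      by (simp add: \<kappa>_def mult_ac)
  qed simp
  have "(\<lambda>n. real k * (1 / real n)) \<longlonglongrightarrow> real k * 0" by (intro tendsto_mult tendsto_const a_seq_limits)
  then have ev3: "eventually (\<lambda>n. real k * (1 / real n) < \<eta> / 2) sequentially"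
    by (rule order_tendstoD(2)) (use \<eta> in simp)
  show ?thesis
    using ev_a ev1 ev2 ev3 eventually_ge_at_top[of "max 1 k"]
  proof eventually_elim
    case (elim n)
    note a = elim(1)
    have n: "n \<ge> 1" "k \<le> n" using elim(5) by auto
    have kn: "real k < \<eta> * real n / 2" using elim(4) n by (simp add: field_simps)
    show ?case
    proof (intro allI impI ballI, rule ccontr)
      fix A m assume A: "A \<in> carrier_mat n n" "transpose_mat A = A" and ty: "typical n \<eta> t A"
        and ev: "\<forall>m\<in>{1..k}. ordered_eigenvalue m (laplacian A) \<le> b_seq n + x m / a_seq n" and m: "m \<in> {1..k}"
        and "\<not> card {j. j < n \<and> level (\<lambda>i. x i + \<epsilon>) n m < degree_sum A j} < m"
      then have "m \<le> card {j. j < n \<and> level (\<lambda>i. x i + \<epsilon>) n m < degree_sum A j}" by simp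
      then obtain I where I: "I \<subseteq> {j. j < n \<and> level (\<lambda>i. x i + \<epsilon>) n m < degree_sum A j}" "card I = m"
        by (meson obtain_subset_with_card_n)
      have In: "I \<subseteq> {..<n}" "real (card I) \<le> N" using I m by (auto simp: N_def)
      \<comment> \<open>The net allows \<eta> n coordinates: half of them for the strongly negative
        degrees, half for the at most \<open>k\<close> indices in \<open>I\<close>.\<close>
      define U where "U = I \<union> {j. j < n \<and> degree_sum A j < - sqrt (a_seq n)}"
      have U: "U \<subseteq> {..<n}" "real (card U) \<le> \<eta> * real n"
      proof -
        have "card U \<le> card I + card {j. j < n \<and> degree_sum A j < - sqrt (a_seq n)}" unfolding U_def by (rule card_Un_le)
        moreover have "card {j. j < n \<and> degree_sum A j < - sqrt (a_seq n)} \<le> card {i. i < n \<and> sqrt (a_seq n) \<le> \<bar>degree_sum A i\<bar>}"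
          by (intro card_mono) auto
        moreover have "real (card {i. i < n \<and> sqrt (a_seq n) \<le> \<bar>degree_sum A i\<bar>}) < \<eta> * real n / 2" using ty unfolding typical_def by blast
        ultimately show "real (card U) \<le> \<eta> * real n" using kn In(2) by (simp add: N_def)
      qed (use In in \<open>auto simp: U_def\<close>)
      have nb: "net_bound n \<eta> t A" using ty by (simp add: typical_def)
      have "y n m \<le> ordered_eigenvalue m (laplacian A)"
      proof (rule laplacian_eigenvalue_lower[OF A In(1) I(2), where c = "level (\<lambda>i. x i + \<epsilon>) n m" and g = 20 and K = "sqrt (a_seq n)" and \<tau> = "2 * t" and r = "r n" and \<kappa> = "\<kappa> n" and a = "a_seq n"])
        show "level (\<lambda>i. x i + \<epsilon>) n m \<le> degree_sum A i" if "i \<in> I" for i using I(1) that by auto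
        show "\<bar>qform n (offdiag A) v\<bar> \<le> 20 * (\<Sum>i<n. (v i)\<^sup>2)" for v by (rule typical_full_bound[OF A n(1) ty])
        show "\<bar>qform n (offdiag A) v\<bar> \<le> 2 * t * (\<Sum>i<n. (v i)\<^sup>2)" if "\<forall>i. v i \<noteq> 0 \<longrightarrow> i \<in> I \<union> {j. j < n \<and> degree_sum A j < - sqrt (a_seq n)}" for v
          by (rule net_bound_qform[OF A n(1) \<eta> nb U]) (use that in \<open>auto simp: U_def\<close>)
        show "r n * (\<Sum>i<n. (v i)\<^sup>2) \<le> (\<Sum>j<n. (\<Sum>i<n. offdiag A i j * v i)\<^sup>2)" if v: "\<forall>i. v i \<noteq> 0 \<longrightarrow> i \<in> I" for v
          using typical_rows(1)[OF ty In v] unfolding r_def left_diff_distrib mult_1 by linarith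
        show "\<bar>qform n (offdiag A) v\<bar> \<le> \<kappa> n * (\<Sum>i<n. (v i)\<^sup>2)" if v: "\<forall>i. v i \<noteq> 0 \<longrightarrow> i \<in> I" for v
          using typical_rows(2)[OF ty In v] by (simp add: \<kappa>_def)
        define q where "q = (sqrt (a_seq n) + 20 + y n m) / a_seq n"
        have q: "(sqrt (a_seq n) + 20 + y n m) / (a_seq n)\<^sup>2 = q / a_seq n" by (simp add: q_def power2_eq_square)
        have q2: "q < 2" using elim(2) m by (simp add: q_def)
        show "(sqrt (a_seq n) + 20 + y n m) / (a_seq n)\<^sup>2 \<le> 2 / a_seq n"
          unfolding q using q2 a by (simp add: divide_right_mono)
        have "(1 - \<epsilon> / 2) + a_seq n * \<kappa> n \<le> (r n - 4 * t\<^sup>2) * (2 - q)" using elim(3) m unfolding q_def by fastforce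
        then have "((1 - \<epsilon> / 2) + a_seq n * \<kappa> n) / a_seq n \<le> (r n - 4 * t\<^sup>2) * (2 - q) / a_seq n"
          using a by (intro divide_right_mono) auto
        also have "(r n - 4 * t\<^sup>2) * (2 - q) / a_seq n = (r n - (2 * t)\<^sup>2) * (2 / a_seq n - q / a_seq n)"
          by (simp add: power_mult_distrib diff_divide_distrib[symmetric])
        also have "((1 - \<epsilon> / 2) + a_seq n * \<kappa> n) / a_seq n = y n m - level (\<lambda>i. x i + \<epsilon>) n m + \<kappa> n"
          using a by (simp add: y_def level_def b_seq_eq field_simps)
        finally show "y n m - level (\<lambda>i. x i + \<epsilon>) n m + \<kappa> n \<le> (r n - (2 * t)\<^sup>2) * (2 / a_seq n - (sqrt (a_seq n) + 20 + y n m) / (a_seq n)\<^sup>2)"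
          unfolding q .
      qed (use t a m n in auto)
      moreover have "ordered_eigenvalue m (laplacian A) \<le> b_seq n + x m / a_seq n" using ev m by blast
      moreover have "b_seq n + x m / a_seq n < y n m" using \<epsilon> a by (simp add: y_def divide_strict_right_mono)
      ultimately show False by linarith
    qed
  qed
qed

theorem theorem1p4:
  fixes M :: "nat \<Rightarrow> 'a measure"
    and A :: "nat \<Rightarrow> 'a \<Rightarrow> real mat"
    and k :: nat
    and x :: "nat \<Rightarrow> real"
  assumes "\<And>n. n \<ge> 1 \<Longrightarrow> GOE n (M n) (A n)"
    and "k \<ge> 1"
  shows "(\<lambda>n. measure (M n)
            {\<omega> \<in> space (M n).
               \<forall>i\<in>{1..k}. a_seq n * (ordered_eigenvalue i (laplacian (A n \<omega>)) - b_seq n) \<le> x i})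
         \<longlonglongrightarrow> F_cdf k x"
proof -
  note G = assms(1)
  define \<Lambda> where "\<Lambda> = (\<lambda>n. {\<omega> \<in> space (M n). \<forall>i\<in>{1..k}. a_seq n * (ordered_eigenvalue i (laplacian (A n \<omega>)) - b_seq n) \<le> x i})"
  define D where "D = (\<lambda>z n. {\<omega> \<in> space (M n). \<forall>i\<in>{1..k}. card {j. j < n \<and> level z n i < degree_sum (A n \<omega>) j} < i})"
  define S where "S = (\<Sum>i\<in>{1..k}. exp (- x i))"
  have Dlim: "(\<lambda>n. measure (M n) (D z n)) \<longlonglongrightarrow> order_limit k z" for z
    unfolding D_def by (rule degree_exceedance_counts_converge[OF G])
  have "(\<lambda>n. measure (M n) (\<Lambda> n)) \<longlonglongrightarrow> order_limit k x"
  proof (rule tendstoI)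
    fix e :: real assume e: "e > 0"
    \<comment> \<open>In the limit law, lowering the levels by \<epsilon> costs at most (exp
      \<epsilon> - 1) S and raising them at most (1 - exp (- \<epsilon>)) S. The first is the larger
      one, so a single choice of \<epsilon> serves both sides.\<close>
    have "((\<lambda>\<epsilon>. (exp \<epsilon> - 1) * S) \<longlongrightarrow> (exp 0 - 1) * S) (at_right 0)"
      by (intro tendsto_intros)
    then have "eventually (\<lambda>\<epsilon>. (exp \<epsilon> - 1) * S < e / 3) (at_right 0)"
      by (rule order_tendstoD(2)) (use e in simp)
    then have "eventually (\<lambda>\<epsilon>. 0 < \<epsilon> \<and> (exp \<epsilon> - 1) * S < e / 3) (at_right 0)"
      using eventually_at_right_less[of 0] by eventually_elim auto
    from eventually_happens'[OF trivial_limit_at_right_real this]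
    obtain \<epsilon> where \<epsilon>: "0 < \<epsilon>" "(exp \<epsilon> - 1) * S < e / 3" by blast
    \<comment> \<open>The square root makes the contribution of the intermediate coordinates
      proportional to \<epsilon>. The sparsity \<eta> is then taken so small that the net bound with
      constant \<open>t\<close> holds with high probability.\<close>
    define t where "t = sqrt \<epsilon> / 20"
    have t: "t > 0" "4 * t\<^sup>2 = \<epsilon> / 100" using \<epsilon> by (auto simp: t_def power_divide)
    have "t\<^sup>2 / 4 > 0" using t by simp
    then obtain \<eta> where \<eta>: "0 < \<eta>" "\<eta> \<le> 1" "2 * \<eta> + 16 * \<eta> * ln (2 / \<eta>) < t\<^sup>2 / 4"
      using sparsity_level_exists by blast
    obtain B where B: "\<And>n. n \<ge> 1 \<Longrightarrow> B n \<in> sets (M n)" "(\<lambda>n. measure (M n) (B n)) \<longlonglongrightarrow> 0"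
      "\<And>n \<omega>. n \<ge> 1 \<Longrightarrow> \<omega> \<in> space (M n) \<Longrightarrow> \<omega> \<notin> B n \<Longrightarrow> typical n \<eta> t (A n \<omega>)"
      using GOE_typical[OF G \<eta>(1,2) t(1) \<eta>(3)] by blast
    define xm xp where "xm = (\<lambda>i. x i - \<epsilon>)" and "xp = (\<lambda>i. x i + \<epsilon>)"
    have S0: "S \<ge> 0" unfolding S_def by (intro sum_nonneg) auto
    have up: "order_limit k xp - order_limit k x < e / 3"
    proof -
      have "(\<Sum>i\<in>{1..k}. exp (- x i) - exp (- (x i + \<epsilon>))) = (1 - exp (- \<epsilon>)) * S"
        by (simp add: S_def sum_distrib_left exp_diff exp_add exp_minus field_simps)
      moreover have "1 - exp (- \<epsilon>) \<le> exp \<epsilon> - 1"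
        using exp_ge_add_one_self[of \<epsilon>] exp_ge_add_one_self[of "- \<epsilon>"] by linarith
      then have "(1 - exp (- \<epsilon>)) * S \<le> (exp \<epsilon> - 1) * S" using S0 by (rule mult_right_mono)
      ultimately show ?thesis
        using order_limit_shift(2)[of \<epsilon> k x] \<epsilon> unfolding xp_def by linarith
    qed
    have lo: "order_limit k x - order_limit k xm < e / 3"
    proof -
      have "(\<Sum>i\<in>{1..k}. exp (- xm i) - exp (- (xm i + \<epsilon>))) = (exp \<epsilon> - 1) * S"
        by (simp add: S_def xm_def sum_distrib_left exp_diff exp_minus field_simps)
      moreover have "(\<lambda>i. xm i + \<epsilon>) = x" by (simp add: xm_def)
      ultimately show ?thesis using order_limit_shift(2)[of \<epsilon> k xm] \<epsilon> by simp
    qed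
    have e3: "e / 3 > 0" using e by simp
    note D1 = tendstoD[OF Dlim[of xm] e3] and D2 = tendstoD[OF Dlim[of xp] e3] and B0 = tendstoD[OF B(2) e3]
    show "eventually (\<lambda>n. dist (measure (M n) (\<Lambda> n)) (order_limit k x) < e) sequentially"
      using D1 D2 B0 typical_upper[OF \<epsilon>(1) t \<eta>(1), of k x] typical_lower[OF \<epsilon>(1) t \<eta>(1), of k x] eventually_ge_at_top[of "max 2 k"]
    proof eventually_elim
      case (elim n)
      have n: "n \<ge> 1" "n \<ge> 2" "k \<le> n" using elim(6) by auto
      interpret prob_space "M n" by (rule GOE_prob_space[OF G[OF n(1)]])
      have a: "a_seq n > 0" by (rule a_seq_pos[OF n(2)])
      have iff: "a_seq n * (l - b_seq n) \<le> z \<longleftrightarrow> l \<le> b_seq n + z / a_seq n" for l z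
        using a by (simp add: field_simps)
      have \<Lambda>m: "\<Lambda> n \<in> events"
        unfolding \<Lambda>_def
      proof (rule sets.sets_Collect_finite_All)
        fix i assume i: "i \<in> {1..k}"
        show "{\<omega> \<in> space (M n). a_seq n * (ordered_eigenvalue i (laplacian (A n \<omega>)) - b_seq n) \<le> x i} \<in> events"
          unfolding iff using i n by (intro borel_measurable_le ordered_eigenvalue_measurable[OF G[OF n(1)]]) auto
      qed simp
      have Bn: "B n \<in> events" by (rule B(1)[OF n(1)])
      have Dm: "D z n \<in> events" for z
        unfolding D_def by (intro exceedance_counts_measurable degree_sum_measurable[OF G[OF n(1)]])
      \<comment> \<open>Outside the exceptional set the eigenvalue event lies between two degree
        events whose levels are shifted by - \<epsilon> and by \<epsilon>.\<close>
      have "D xm n \<subseteq> \<Lambda> n \<union> B n"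
      proof
        fix \<omega> assume w: "\<omega> \<in> D xm n"
        then have ws: "\<omega> \<in> space (M n)" by (simp add: D_def)
        show "\<omega> \<in> \<Lambda> n \<union> B n"
        proof (cases "\<omega> \<in> B n")
          case False
          have "\<forall>m\<in>{1..k}. ordered_eigenvalue m (laplacian (A n \<omega>)) \<le> b_seq n + x m / a_seq n"
            using elim(4) GOE_carrier[OF G[OF n(1)] ws] GOE_sym[OF G[OF n(1)] ws] B(3)[OF n(1) ws False] w
            unfolding D_def xm_def by blast
          then show ?thesis using ws by (simp add: \<Lambda>_def iff)
        qed simp
      qed
      then have "prob (D xm n) \<le> prob (\<Lambda> n) + prob (B n)"
        using finite_measure_mono[of "D xm n" "\<Lambda> n \<union> B n"] measure_Un_le[OF \<Lambda>m Bn] \<Lambda>m Bn by (meson order_trans sets.Un)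
      moreover have "\<Lambda> n \<subseteq> D xp n \<union> B n"
      proof
        fix \<omega> assume w: "\<omega> \<in> \<Lambda> n"
        then have ws: "\<omega> \<in> space (M n)" by (simp add: \<Lambda>_def)
        show "\<omega> \<in> D xp n \<union> B n"
        proof (cases "\<omega> \<in> B n")
          case False
          have "\<forall>m\<in>{1..k}. ordered_eigenvalue m (laplacian (A n \<omega>)) \<le> b_seq n + x m / a_seq n"
            using w unfolding \<Lambda>_def iff by blast
          then have "\<forall>m\<in>{1..k}. card {j. j < n \<and> level xp n m < degree_sum (A n \<omega>) j} < m"
            using elim(5) GOE_carrier[OF G[OF n(1)] ws] GOE_sym[OF G[OF n(1)] ws] B(3)[OF n(1) ws False]
            unfolding xp_def by blast
          then show ?thesis using ws by (simp add: D_def)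
        qed simp
      qed
      then have "prob (\<Lambda> n) \<le> prob (D xp n) + prob (B n)"
        using finite_measure_mono[of "\<Lambda> n" "D xp n \<union> B n"] measure_Un_le[OF Dm Bn] Dm Bn by (meson order_trans sets.Un)
      ultimately show ?case
        using elim(1-3) up lo unfolding dist_real_def by linarith
    qed
  qed
  then show ?thesis unfolding \<Lambda>_def F_cdf_eq_order_limit .
qed

end
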